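(* Let $\theta$ be either the function $\theta(x)=x$ or a Young function, let $T\in\mathcal F_\theta'(\mathbb C)$ be non-zero, let $\Phi=\mathcal L(T)$, assume $\Phi$ has zeros, and let $\{\alpha_k\}_k$ be its distinct zeros ordered by $|\alpha_0|\le|\alpha_1|\le\cdots$, with multiplicities $m_k$. For $0\le l<m_k$ and $0\le j\le k$ let $P_{k,j,l}$ be the polynomial in $z$, of degree $<m_j$, given for $j<k$ by $$P_{k,j,l}(z)=\sum_{i=0}^{m_j-1}\frac{z^i}{i!}\,\partial_j^{\,m_j-1-i}\Big(\prod_{0\le n\le k-1,\ n\ne j}(\alpha_j-\alpha_n)^{-m_n}\,(\alpha_j-\alpha_k)^{-(l+1)}\Big)$$ and for $j=k$ by $$P_{k,k,l}(z)=\sum_{i=0}^{l}\frac{z^i}{i!}\,\partial_k^{\,l-i}\Big(\prod_{0\le n\le k-1}(\alpha_k-\alpha_n)^{-m_n}\Big),$$ where $\partial_j^m=\frac1{m!}\frac{\partial^m}{\partial\alpha_j^m}$. (i) Any $f\in\mathcal F_\theta(\mathbb C)$ with $T\star f=0$ admits the following expansion as a convergent series in $\mathcal F_\theta(\mathbb C)$: $$f(z)=\sum_{k\ge0}\sum_{l=0}^{m_k-1}c_{k,l}\Big[\sum_{j=0}^k e^{z\alpha_j}P_{k,j,l}(z)\Big],$$ where the coefficients $c_{k,l}\in\mathbb C$ satisfy $$\forall m>0,\qquad \sum_{k\ge0}e^{\theta(m|\alpha_k|)}\Big(\sum_{l=0}^{m_k-1}|c_{k,l}|\,(|\alpha_k|+1)^{-(m_0+\cdots+m_{k-1}+l)}\Big)<+\infty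 \qquad ( * )$$ and are given by $c_{k,l}=\langle S_{k,l},f\rangle$, where $S_{k,l}\in\mathcal F_\theta'(\mathbb C)$ is defined by $$\mathcal L(S_{k,l})(\xi)=(\xi-\alpha_k)^l\prod_{n=0}^{k-1}(\xi-\alpha_n)^{m_n}.$$ (ii) Conversely, any such series whose coefficients $c_{k,l}$ satisfy $( * )$ converges in $\mathcal F_\theta(\mathbb C)$ to a function $f$ solving $T\star f=0$.
   Context: A Young function is a convex, continuous, increasing function $\theta:[0,+\infty)\to[0,+\infty)$ with $\theta(0)=0$ and $r=o(\theta(r))$ as $r\to+\infty$. Its Legendre transform is $\theta^*(x)=\sup_{t\ge0}(tx-\theta(t))$. $\mathcal H(\mathbb C)$ is the space of entire functions. For $m>0$, $E_{\theta,m}(\mathbb C)$ is the Banach space of $f\in\mathcal H(\mathbb C)$ with $\|f\|_{\theta,m}=\sup_{z\in\mathbb C}|f(z)|e^{-\theta(m|z|)}<+\infty$, and $\mathcal G_\theta(\mathbb C)=\bigcup_{p\in\mathbb N^*}E_{\theta,p}(\mathbb C)$ with the inductive limit topology. If $\theta(x)=x$, $\mathcal F_\theta(\mathbb C)=\mathcal H(\mathbb C)$ with the topology of uniform convergence on compact sets; if $\theta$ is a Young function, $\mathcal F_\theta(\mathbb C)=\bigcap_{p\in\mathbb N^*}E_{\theta^*,1/p}(\mathbb C)$ with the projective limit topology. $\mathcal F_\theta'(\mathbb C)$ is the strong dual of $\mathcal F_\theta(\mathbb C)$, with duality bracket $\langle\cdot,\cdot\rangle$. For $S\in\mathcal F_\theta'(\mathbb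 C)$ and $f\in\mathcal F_\theta(\mathbb C)$, $(S\star f)(z)=\langle S,\tau_zf\rangle$ where $(\tau_zf)(w)=f(w+z)$; this is again in $\mathcal F_\theta(\mathbb C)$. The Fourier-Borel transform is $\mathcal L(S)(\xi)=\langle S,e^{\xi\,\cdot}\rangle$; it is a (known) topological isomorphism of $\mathcal F_\theta'(\mathbb C)$ onto $\mathcal G_\theta(\mathbb C)$. The zeros of $\Phi$ form a finite or infinite sequence; if it is finite, the index $k$ ranges over the corresponding finite set. In the formulas for $P_{k,j,l}$, $\partial_j^m$ means: treat $\alpha_j$ as a variable, the other $\alpha_n$ being fixed, differentiate, and evaluate at the actual value $\alpha_j$. For $k=0$, $m_0+\cdots+m_{k-1}=0$ and empty products are $1$. *)

theory Defs
  imports "HOL-Complex_Analysis.Complex_Analysis" "HOL-Library.Landau_Symbols"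
begin

text \<open>Functions on $[0,\infty)$ are total functions on the reals whose values at negative
  arguments are never used; accordingly, equality with $\theta(x) = x$ is only asked on
  $[0,\infty)$, and ``increasing'' is read in the wide sense.\<close>

definition young_function :: "(real \<Rightarrow> real) \<Rightarrow> bool" where
  "young_function \<theta> \<longleftrightarrow>
     convex_on {0..} \<theta> \<and> continuous_on {0..} \<theta> \<and> mono_on {0..} \<theta> \<and>
     (\<forall>x\<ge>0. 0 \<le> \<theta> x) \<and> \<theta> 0 = 0 \<and> (\<lambda>r. r) \<in> o[at_top](\<theta>)"

definition identity_weight :: "(real \<Rightarrow> real) \<Rightarrow> bool" where
  "identity_weight \<theta> \<longleftrightarrow> (\<forall>x\<ge>0. \<theta> x = x)"

definition legendre :: "(real \<Rightarrow> real) \<Rightarrow> real \<Rightarrow> real" where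
  "legendre \<theta> x = (SUP t\<in>{0..}. t * x - \<theta> t)"

definition E_space :: "(real \<Rightarrow> real) \<Rightarrow> real \<Rightarrow> (complex \<Rightarrow> complex) set" where
  "E_space \<theta> r = {f. f holomorphic_on UNIV \<and>
     bdd_above (range (\<lambda>z. cmod (f z) * exp (- \<theta> (r * cmod z))))}"

definition E_norm :: "(real \<Rightarrow> real) \<Rightarrow> real \<Rightarrow> (complex \<Rightarrow> complex) \<Rightarrow> real" where
  "E_norm \<theta> r f = (SUP z. cmod (f z) * exp (- \<theta> (r * cmod z)))"

definition E_top :: "(real \<Rightarrow> real) \<Rightarrow> real \<Rightarrow> (complex \<Rightarrow> complex) topology" where
  "E_top \<theta> r = topology_generated_by
     {{g \<in> E_space \<theta> r. E_norm \<theta> r (\<lambda>z. g z - f z) < e} |f e. f \<in> E_space \<theta> r \<and> 0 < e}"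

definition F_space :: "(real \<Rightarrow> real) \<Rightarrow> (complex \<Rightarrow> complex) set" where
  "F_space \<theta> = (if identity_weight \<theta> then {f. f holomorphic_on UNIV}
     else (\<Inter>p\<in>{1::nat..}. E_space (legendre \<theta>) (1 / real p)))"

text \<open>The first branch is the topology of uniform convergence on compact sets; the second is
  the projective limit topology, i.e. the coarsest one for which all inclusions into the
  spaces \<^term>\<open>E_space (legendre \<theta>) (1 / real p)\<close> are continuous.\<close>

definition F_top :: "(real \<Rightarrow> real) \<Rightarrow> (complex \<Rightarrow> complex) topology" where
  "F_top \<theta> = (if identity_weight \<theta>
     then topology_generated_by
       {{g \<in> F_space \<theta>. \<forall>z\<in>K. cmod (g z - f z) < e} |f K e. f \<in> F_space \<theta> \<and> compact K \<and> 0 < e}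
     else topology_generated_by
       {F_space \<theta> \<inter> U |U p. 1 \<le> p \<and> openin (E_top (legendre \<theta>) (1 / real p)) U})"

text \<open>Functionals are normalised to be \<^term>\<open>undefined\<close> outside \<^term>\<open>F_space \<theta>\<close>, so that two
  elements of the dual are equal iff they agree on \<^term>\<open>F_space \<theta>\<close>.\<close>

definition F_dual :: "(real \<Rightarrow> real) \<Rightarrow> ((complex \<Rightarrow> complex) \<Rightarrow> complex) set" where
  "F_dual \<theta> = {S \<in> extensional (F_space \<theta>).
     (\<forall>f\<in>F_space \<theta>. \<forall>g\<in>F_space \<theta>. S (\<lambda>z. f z + g z) = S f + S g) \<and>
     (\<forall>a. \<forall>f\<in>F_space \<theta>. S (\<lambda>z. a * f z) = a * S f) \<and>
     continuous_map (F_top \<theta>) euclidean S}"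

definition conv :: "((complex \<Rightarrow> complex) \<Rightarrow> complex) \<Rightarrow> (complex \<Rightarrow> complex) \<Rightarrow> complex \<Rightarrow> complex" where
  "conv S f z = S (\<lambda>w. f (w + z))"

definition fourier_borel :: "((complex \<Rightarrow> complex) \<Rightarrow> complex) \<Rightarrow> complex \<Rightarrow> complex" where
  "fourier_borel S \<xi> = S (\<lambda>z. exp (\<xi> * z))"

text \<open>The zeros are indexed by \<^term>\<open>K\<close>, which is either all of the naturals or a finite
  initial segment.\<close>

definition zero_enumeration ::
    "(complex \<Rightarrow> complex) \<Rightarrow> nat set \<Rightarrow> (nat \<Rightarrow> complex) \<Rightarrow> (nat \<Rightarrow> nat) \<Rightarrow> bool" where
  "zero_enumeration \<Phi> K \<alpha> m \<longleftrightarrow>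
     (K = UNIV \<or> (\<exists>n. K = {..<n})) \<and>
     bij_betw \<alpha> K {\<xi>. \<Phi> \<xi> = 0} \<and>
     (\<forall>k\<in>K. \<forall>j\<le>k. cmod (\<alpha> j) \<le> cmod (\<alpha> k)) \<and>
     (\<forall>k\<in>K. m k = nat (zorder \<Phi> (\<alpha> k)))"

definition taylor_coeff :: "nat \<Rightarrow> (complex \<Rightarrow> complex) \<Rightarrow> complex \<Rightarrow> complex" where
  "taylor_coeff r h w = (deriv ^^ r) h w / fact r"

text \<open>The operator $\partial_j^r$ acts on the variable put in place of $\alpha_j$, all other $\alpha_n$
  being fixed, and the result is evaluated at $\alpha_j$. Only $j \le k$ matters, so the second
  branch is the case $j = k$.\<close>

definition P_kjl :: "(nat \<Rightarrow> complex) \<Rightarrow> (nat \<Rightarrow> nat) \<Rightarrow> nat \<Rightarrow> nat \<Rightarrow> nat \<Rightarrow> complex \<Rightarrow> complex" where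
  "P_kjl \<alpha> m k j l z =
     (if j < k then
        (\<Sum>i<m j. z ^ i / fact i *
           taylor_coeff (m j - 1 - i)
             (\<lambda>w. (\<Prod>n\<in>{..<k} - {j}. inverse ((w - \<alpha> n) ^ m n)) * inverse ((w - \<alpha> k) ^ (l + 1)))
             (\<alpha> j))
      else
        (\<Sum>i\<le>l. z ^ i / fact i *
           taylor_coeff (l - i) (\<lambda>w. \<Prod>n<k. inverse ((w - \<alpha> n) ^ m n)) (\<alpha> k)))"

definition expansion_term ::
    "(nat \<Rightarrow> complex) \<Rightarrow> (nat \<Rightarrow> nat) \<Rightarrow> (nat \<Rightarrow> nat \<Rightarrow> complex) \<Rightarrow> nat \<Rightarrow> complex \<Rightarrow> complex" where
  "expansion_term \<alpha> m c k z =
     (\<Sum>l<m k. c k l * (\<Sum>j\<le>k. exp (z * \<alpha> j) * P_kjl \<alpha> m k j l z))"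

text \<open>For finite \<^term>\<open>K\<close> the partial sums are eventually constant.\<close>

definition expansion_converges_to ::
    "(real \<Rightarrow> real) \<Rightarrow> nat set \<Rightarrow> (nat \<Rightarrow> complex) \<Rightarrow> (nat \<Rightarrow> nat) \<Rightarrow> (nat \<Rightarrow> nat \<Rightarrow> complex) \<Rightarrow>
     (complex \<Rightarrow> complex) \<Rightarrow> bool" where
  "expansion_converges_to \<theta> K \<alpha> m c f \<longleftrightarrow>
     limitin (F_top \<theta>) (\<lambda>n z. \<Sum>k\<in>K \<inter> {..<n}. expansion_term \<alpha> m c k z) f sequentially"

definition coeff_condition ::
    "(real \<Rightarrow> real) \<Rightarrow> nat set \<Rightarrow> (nat \<Rightarrow> complex) \<Rightarrow> (nat \<Rightarrow> nat) \<Rightarrow> (nat \<Rightarrow> nat \<Rightarrow> complex) \<Rightarrow> bool" where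
  "coeff_condition \<theta> K \<alpha> m c \<longleftrightarrow>
     (\<forall>r>0. (\<lambda>k. exp (\<theta> (r * cmod (\<alpha> k))) *
        (\<Sum>l<m k. cmod (c k l) / (cmod (\<alpha> k) + 1) ^ ((\<Sum>n<k. m n) + l))) summable_on K)"

definition is_newton_functional :: "(real \<Rightarrow> real) \<Rightarrow> (nat \<Rightarrow> complex) \<Rightarrow> (nat \<Rightarrow> nat) \<Rightarrow> nat \<Rightarrow> nat \<Rightarrow>
    ((complex \<Rightarrow> complex) \<Rightarrow> complex) \<Rightarrow> bool" where
  "is_newton_functional \<theta> \<alpha> m k l S \<longleftrightarrow> S \<in> F_dual \<theta> \<and>
     fourier_borel S = (\<lambda>\<xi>. (\<xi> - \<alpha> k) ^ l * (\<Prod>n<k. (\<xi> - \<alpha> n) ^ m n))"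

end

theory Submission
  imports Defs
begin

text \<open>Put $L_j = \sup_{t \ge 0} t^j e^{-\theta(t)}$. In both cases of $\theta$ an entire function $f$ lies in
  $\mathcal F_\theta$ iff $\sum_j |f^{(j)}(0)| q^j / L_j < \infty$ for all $q$, and these norms define the
  topology; dually $\mathcal G_\theta$ consists of the entire $g$ with $|g^{(j)}(0)| / j! \le B p^j / L_j$, and
  $\langle \mathcal L^{-1} g, f\rangle = \sum_j g^{(j)}(0) f^{(j)}(0) / j!$. The equation $T \star f = 0$ says that $f$ is
  orthogonal to all $\xi^s \Phi$.

  The bracketed function of index $(k,l)$ is $\frac{1}{2 \pi i} \oint e^{zw} / Q(w) \, dw$ with
  $Q(w) = (w - \alpha_k)^{l+1} \prod_{n<k} (w - \alpha_n)^{m_n}$, by the residue theorem. Taking $|w| = 2 |\alpha_k| + 1$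
  bounds its norms and gives the convergence in (ii); it is orthogonal to $\xi^s \Phi$ because $Q$ divides $\Phi$.

  For (i), let $S \in \mathcal G_\theta$ be a polynomial divisible by the factor $N$ of $\Phi = N G$ belonging to the zeros
  of modulus less than $a$. Instead of solving an interpolation problem with bounds, one subtracts from $S$ the
  product of $\Phi$ with a Taylor polynomial of $S / \Phi$, which does not change the pairing with $f$. As $G$ has
  no zeros in $|\xi| < a$, it is bounded below on $|\xi| \le a/4$ by the Borel-Caratheodory inequality, so that
  the difference has a norm of size $e^{-\theta(r a)}$ for any prescribed $r$. Applied to the Newton polynomials
  this gives the condition on $c_{k,l}$; applied to the remainder of the Newton interpolation of $\xi^i$ it shows that the
  series has the same $i$-th derivative at $0$ as $f$.\<close>

section \<open>Weights\<close>

text \<open>Everything rests on two consequences of convexity and \<open>\<theta> 0 = 0\<close>: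
  \<open>s * \<theta> x \<le> \<theta> (s * x)\<close> for s \<ge> 1, and superadditivity. The costs
  of an estimate at radius a (number of zeros, logarithm of the maximum of \<Phi>, degree of the
  subtracted Taylor polynomial, prescribed decay) are all at most
  \<open>c + \<theta> (c * a)\<close> with c independent of a. At a point of modulus s a / 8 with s
  \<ge> 1 they occur multiplied by s, and the first inequality turns them into a mere dilation of
  the growth weight. A Taylor polynomial of very high degree, hence an arbitrarily strong decay near
  0, therefore changes only the type p of the difference, and one p serves for all a. The obstacle
  is that the zeros may cluster and have unbounded multiplicities. It is met by never using a lower
  bound of N near its zeros: below, only the zero-free cofactor G is estimated, and the factor (a +
  1)^n lost there is the one gained in the bound of S / N.\<close>

locale growth_weight =
  fixes \<theta> :: "real \<Rightarrow> real"
  assumes weight: "identity_weight \<theta> \<or> young_function \<theta>"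
begin

lemma theta_convex: "convex_on {0..} \<theta>"
proof -
  have "convex_on {0..} \<theta>" if "identity_weight \<theta>"
    using that by (intro convex_onI) (auto simp: identity_weight_def)
  then show ?thesis using weight by (auto simp: young_function_def)
qed

lemma theta_continuous: "continuous_on {0..} \<theta>"
proof -
  have "continuous_on {0..} \<theta>" if "identity_weight \<theta>"
    by (rule continuous_on_eq[OF continuous_on_id]) (use that in \<open>auto simp: identity_weight_def\<close>)
  then show ?thesis using weight by (auto simp: young_function_def)
qed

lemma theta_0 [simp]: "\<theta> 0 = 0"
  using weight by (auto simp: identity_weight_def young_function_def)

lemma theta_nonneg [simp]: "0 \<le> x \<Longrightarrow> 0 \<le> \<theta> x"
  using weight by (auto simp: identity_weight_def young_function_def)

lemma theta_mono: "0 \<le> x \<Longrightarrow> x \<le> y \<Longrightarrow> \<theta> x \<le> \<theta> y"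
  using weight by (auto simp: identity_weight_def young_function_def intro: mono_onD)

text \<open>Convexity on the segment from \<open>0\<close> to \<open>s * x\<close>. It lets a factor
  in front of an exponent be moved into the argument of \<theta>.\<close>

lemma theta_scale:
  assumes "1 \<le> s" "0 \<le> x"
  shows "s * \<theta> x \<le> \<theta> (s * x)"
proof -
  have "\<theta> ((1 - 1/s) *\<^sub>R 0 + (1/s) *\<^sub>R (s * x)) \<le> (1 - 1/s) * \<theta> 0 + (1/s) * \<theta> (s * x)"
    by (rule convex_onD[OF theta_convex]) (use assms in auto)
  then show ?thesis using assms by (simp add: field_simps)
qed

text \<open>Both \<open>x\<close> and \<open>y\<close> are fractions u of w = x + y, and convexity
  with \<open>\<theta> 0 = 0\<close> gives \<theta>(u w) \<le> u \<theta>(w). Products of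
  exponential bounds thereby stay of the same kind.\<close>

lemma theta_superadd:
  assumes "0 \<le> x" "0 \<le> y"
  shows "\<theta> x + \<theta> y \<le> \<theta> (x + y)"
proof -
  have *: "u * \<theta> (x + y) \<ge> \<theta> (u * (x + y))" if "0 \<le> u" "u \<le> 1" for u
  proof (cases "u = 0")
    case False
    have "(1/u) * \<theta> (u * (x + y)) \<le> \<theta> ((1/u) * (u * (x + y)))"
      by (rule theta_scale) (use that assms False in \<open>auto\<close>)
    then show ?thesis using that False by (simp add: divide_simps mult.commute split: if_splits)
  qed simp
  show ?thesis
  proof (cases "x + y = 0")
    case False
    then have pos: "x + y > 0" using assms by linarith
    have "\<theta> x \<le> x/(x+y) * \<theta> (x+y)" "\<theta> y \<le> y/(x+y) * \<theta> (x+y)"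
      using *[of "x/(x+y)"] *[of "y/(x+y)"] assms pos by auto
    moreover have "x/(x+y) * \<theta> (x+y) + y/(x+y) * \<theta> (x+y) = \<theta> (x+y)"
      using pos by (simp flip: distrib_right add_divide_distrib)
    ultimately show ?thesis by linarith
  next
    case True
    then have "x = 0" "y = 0" using assms by auto
    then show ?thesis by simp
  qed
qed

text \<open>A Young function eventually exceeds the identity, and below the threshold R the constant
  \<open>max R 0\<close> takes over. Thus exponentials of linear functions, and with them
  polynomials, are absorbed by the weight.\<close>

lemma ex_offset: "\<exists>b\<ge>0. \<forall>x\<ge>0. x \<le> b + \<theta> x"
proof (cases "identity_weight \<theta>")
  case True
  then show ?thesis by (intro exI[of _ 0]) (auto simp: identity_weight_def)
next
  case False
  then have "(\<lambda>r. r) \<in> o[at_top](\<theta>)" using weight by (auto simp: young_function_def)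
  from landau_o.smallD[OF this, of 1]
  obtain R where R: "\<And>r. r \<ge> R \<Longrightarrow> \<bar>r\<bar> \<le> \<bar>\<theta> r\<bar>"
    by (auto simp: eventually_at_top_linorder)
  have "x \<le> max R 0 + \<theta> x" if "x \<ge> 0" for x
  proof (cases "x \<ge> R")
    case True
    then have "x \<le> \<theta> x" using R[of x] that theta_nonneg[OF that] by simp
    then show ?thesis by simp
  next
    case False
    then show ?thesis using theta_nonneg[OF that] by linarith
  qed
  then show ?thesis by (intro exI[of _ "max R 0"]) auto
qed

definition offset :: real where
  "offset = (SOME b. b \<ge> 0 \<and> (\<forall>x\<ge>0. x \<le> b + \<theta> x))"

lemma offset_nonneg: "0 \<le> offset" and theta_lower: "0 \<le> x \<Longrightarrow> x \<le> offset + \<theta> x"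
  using someI_ex[OF ex_offset[unfolded Bex_def]] unfolding offset_def by auto

text \<open>The number L_j of the overview; its logarithm is the Legendre transform of
  \<open>\<theta> (exp u)\<close>, as a function of u, at the point j.\<close>

definition peak :: "nat \<Rightarrow> real" where
  "peak j = (SUP t\<in>{0..}. t ^ j * exp (- \<theta> t))"

lemma power_le_fact_exp: "0 \<le> t \<Longrightarrow> t ^ j \<le> fact j * exp (t::real)"
proof -
  assume t: "0 \<le> t"
  have "t ^ j / fact j \<le> (\<Sum>n. t ^ n /\<^sub>R fact n)"
    using sum_le_suminf[OF summable_exp_generic[of t], of "{j}"] t by (simp add: divide_inverse mult.commute)
  then show ?thesis by (simp add: exp_def field_simps)
qed

lemma peak_bound:
  assumes "0 \<le> t" shows "t ^ j * exp (- \<theta> t) \<le> fact j * exp offset"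
proof -
  have "t ^ j * exp (- \<theta> t) \<le> fact j * exp t * exp (- \<theta> t)"
    using power_le_fact_exp[OF assms] by (intro mult_right_mono) auto
  also have "\<dots> = fact j * exp (t - \<theta> t)" by (simp add: exp_diff exp_minus field_simps)
  also have "\<dots> \<le> fact j * exp offset" using theta_lower[OF assms] by simp
  finally show ?thesis .
qed

lemma peak_upper: "0 \<le> t \<Longrightarrow> t ^ j * exp (- \<theta> t) \<le> peak j"
  unfolding peak_def by (rule cSUP_upper) (auto intro!: bdd_aboveI2 peak_bound)

lemma peak_least: "(\<And>t. 0 \<le> t \<Longrightarrow> t ^ j * exp (- \<theta> t) \<le> B) \<Longrightarrow> peak j \<le> B"
  unfolding peak_def by (rule cSUP_least) auto

lemma peak_pos [simp]: "0 < peak j"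
  using peak_upper[of 1 j] by (auto intro: less_le_trans[OF exp_gt_zero])

lemma peak_nonneg [simp]: "0 \<le> peak j" and peak_neq_0 [simp]: "peak j \<noteq> 0"
  using peak_pos[of j] by linarith+

lemma peak_0: "peak 0 = 1"
  by (intro antisym peak_least) (use peak_upper[of 0 0] in auto)

lemma power_le_peak: "0 \<le> t \<Longrightarrow> t ^ j \<le> peak j * exp (\<theta> t)"
  using peak_upper[of t j] by (simp add: exp_minus field_simps)

text \<open>Superadditivity gives \<theta>(t) \<ge> 2 \<theta>(t/2). One copy of \<theta>(t/2) pays
  for t^n, the other, bounded below by t/2 - \<open>offset\<close>, pays for t^j. The factorial on
  the right is the one that the Taylor expansion of a translate cancels.\<close>

lemma peak_add: "peak (n + j) \<le> exp offset * 2 ^ (n + j) * peak n * fact j"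
proof (rule peak_least)
  fix t :: real assume t: "0 \<le> t"
  have "- \<theta> t \<le> - \<theta> (t/2) + offset - t/2"
    using theta_superadd[of "t/2" "t/2"] theta_lower[of "t/2"] t by simp
  then have "t ^ (n + j) * exp (- \<theta> t) \<le> t ^ (n + j) * exp (- \<theta> (t/2) + offset - t/2)"
    using t by (intro mult_left_mono) auto
  also have "\<dots> = exp offset * 2 ^ (n+j) * ((t/2) ^ n * exp (- \<theta> (t/2))) * ((t/2) ^ j / exp (t/2))"
    proof -
    have e: "exp (- \<theta> (t/2) + offset - t/2) = exp (- \<theta> (t/2)) * exp offset / exp (t/2)"
      by (simp only: exp_add exp_diff)
    show ?thesis unfolding e power_add power_divide by simp
  qed
  also have "\<dots> \<le> exp offset * 2 ^ (n+j) * peak n * fact j"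
    using t power_le_fact_exp[of "t/2" j] by (intro mult_mono peak_upper) (auto simp: pos_divide_le_eq)
  finally show "t ^ (n + j) * exp (- \<theta> t) \<le> exp offset * 2 ^ (n + j) * peak n * fact j" .
qed

text \<open>Evaluating \<open>power_le_peak\<close> at 2 x instead of x gains the geometric factor
  (1/2)^j; a dilation inside \<theta> is harmless because only whole families of norms
  matter.\<close>

lemma
  assumes "0 \<le> x"
  shows peak_series_summable: "summable (\<lambda>j. x ^ j / peak j)"
    and peak_series_le: "(\<Sum>j. x ^ j / peak j) \<le> 2 * exp (\<theta> (2 * x))"
proof -
  have le: "x ^ j / peak j \<le> exp (\<theta> (2 * x)) * (1/2) ^ j" for j
    using power_le_peak[of "2 * x" j] assms by (simp add: field_simps power_mult_distrib)
  have g: "(\<lambda>j. exp (\<theta> (2 * x)) * (1/2) ^ j) sums (exp (\<theta> (2 * x)) * 2)"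
    using sums_mult[OF geometric_sums[of "1/2::real"], of "exp (\<theta> (2 * x))"] by simp
  show s: "summable (\<lambda>j. x ^ j / peak j)"
    by (rule summable_comparison_test'[OF sums_summable[OF g]]) (use le assms in auto)
  show "(\<Sum>j. x ^ j / peak j) \<le> 2 * exp (\<theta> (2 * x))"
    using suminf_le[OF le s sums_summable[OF g]] g by (simp add: sums_iff mult.commute)
qed

end

section \<open>Taylor coefficient norms\<close>

definition jet :: "(complex \<Rightarrow> complex) \<Rightarrow> nat \<Rightarrow> complex" where
  "jet f j = (deriv ^^ j) f 0"

lemma jet_sums: "f holomorphic_on UNIV \<Longrightarrow> (\<lambda>j. jet f j / fact j * z ^ j) sums f z"
  using holomorphic_power_series[of f 0 "cmod z + 1" z] unfolding jet_def
  by (auto intro: holomorphic_on_subset)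

lemma
  assumes "\<And>z. (\<lambda>j. a j / fact j * z ^ j) sums f z"
  shows entire_if_jet_sums: "f holomorphic_on UNIV"
    and jet_eqI: "jet f j = a j"
proof -
  have "f holomorphic_on ball 0 r" for r
    by (rule power_series_holomorphic[where a = "\<lambda>j. a j / fact j"]) (use assms in auto)
  then have "f field_differentiable at z" for z
    using holomorphic_on_imp_differentiable_at[of f "ball 0 (cmod z + 1)" z] by auto
  then show "f holomorphic_on UNIV"
    by (simp add: holomorphic_on_def field_differentiable_at_within)
  have "f has_fps_expansion (Abs_fps (\<lambda>j. a j / fact j))"
    by (rule has_fps_expansionI) (use assms in \<open>auto intro: always_eventually\<close>)
  from fps_nth_fps_expansion[OF this, of j] show "jet f j = a j"
    by (simp add: jet_def)
qed

lemma
  assumes "f holomorphic_on UNIV" "g holomorphic_on UNIV"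
  shows jet_add: "jet (\<lambda>z. f z + g z) j = jet f j + jet g j"
    and jet_diff: "jet (\<lambda>z. f z - g z) j = jet f j - jet g j"
  using assms by (auto simp: jet_def intro!: higher_deriv_add[of _ UNIV] higher_deriv_diff[of _ UNIV])

lemma jet_cmult:
  assumes "f holomorphic_on UNIV"
  shows "jet (\<lambda>z. c * f z) j = c * jet f j"
  by (rule jet_eqI) (use sums_mult[OF jet_sums[OF assms], of c] in \<open>simp add: mult_ac\<close>)

lemma jet_sum:
  assumes "\<And>i. i \<in> A \<Longrightarrow> f i holomorphic_on UNIV"
  shows "jet (\<lambda>z. \<Sum>i\<in>A. f i z) j = (\<Sum>i\<in>A. jet (f i) j)"
  using sums_sum[OF jet_sums[OF assms]]
  by (intro jet_eqI) (simp add: sum_divide_distrib sum_distrib_right)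

lemma jet_le_Cauchy:
  assumes "f holomorphic_on UNIV" "0 < r" "\<And>z. cmod z = r \<Longrightarrow> cmod (f z) \<le> B"
  shows "cmod (jet f j) \<le> fact j * B / r ^ j"
  unfolding jet_def
  by (rule Cauchy_inequality)
    (use assms in \<open>auto intro: holomorphic_on_subset holomorphic_on_imp_continuous_on\<close>)

context growth_weight
begin

text \<open>Kept apart from \<open>wnorm\<close>, whose infinite sum carries no information when the
  series diverges.\<close>

definition wsummable :: "real \<Rightarrow> (complex \<Rightarrow> complex) \<Rightarrow> bool" where
  "wsummable q f \<longleftrightarrow> summable (\<lambda>j. cmod (jet f j) * q ^ j / peak j)"

definition wnorm :: "real \<Rightarrow> (complex \<Rightarrow> complex) \<Rightarrow> real" where
  "wnorm q f = (\<Sum>j. cmod (jet f j) * q ^ j / peak j)"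

lemma wnorm_nonneg: "0 \<le> q \<Longrightarrow> wsummable q f \<Longrightarrow> 0 \<le> wnorm q f"
  unfolding wnorm_def wsummable_def by (rule suminf_nonneg) auto

lemma jet_le_wnorm:
  assumes "0 < q" "wsummable q f"
  shows "cmod (jet f j) \<le> wnorm q f * peak j / q ^ j"
proof -
  have "(\<Sum>i\<in>{j}. cmod (jet f i) * q ^ i / peak i) \<le> wnorm q f"
    unfolding wnorm_def by (rule sum_le_suminf) (use assms in \<open>auto simp: wsummable_def\<close>)
  then show ?thesis using assms by (simp add: field_simps)
qed

lemma wnorm_mono:
  assumes "0 \<le> p" "p \<le> q" "wsummable q f"
  shows "wsummable p f" "wnorm p f \<le> wnorm q f"
proof -
  have le: "cmod (jet f j) * p ^ j / peak j \<le> cmod (jet f j) * q ^ j / peak j" for j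
    using assms by (intro divide_right_mono mult_left_mono power_mono) auto
  show "wsummable p f"
    unfolding wsummable_def
    by (rule summable_comparison_test'[OF assms(3)[unfolded wsummable_def]]) (use le assms in auto)
  then show "wnorm p f \<le> wnorm q f"
    using assms le unfolding wsummable_def wnorm_def by (intro suminf_le)
qed

text \<open>The hypothesis has the shape that the Cauchy estimates produce in both cases of
  \<theta>: S is the radius of a disc in one case and the index of a weighted sup norm in the other.
  The condition \<open>2 * exp 1 * q \<le> S\<close> leaves the ratio 1/2.\<close>

lemma wnorm_le_if_jet_le:
  assumes "0 \<le> q" "2 * exp 1 * q \<le> S" "0 < S"
    and "\<And>j. cmod (jet f j) \<le> (exp 1 / S) ^ j * peak j * B"
  shows "wsummable q f" "wnorm q f \<le> 2 * B"
proof -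
  have B: "0 \<le> B" using order_trans[OF norm_ge_zero assms(4)[of 0]] by (simp add: peak_0)
  have le: "cmod (jet f j) * q ^ j / peak j \<le> B * (1/2) ^ j" for j
  proof -
    have "cmod (jet f j) * q ^ j / peak j \<le> (exp 1 / S) ^ j * peak j * B * q ^ j / peak j"
      using assms by (intro divide_right_mono mult_right_mono) auto
    also have "\<dots> = B * (exp 1 * q / S) ^ j" by (simp add: power_mult_distrib power_divide)
    also have "\<dots> \<le> B * (1/2) ^ j"
      using assms B by (intro mult_left_mono power_mono) (auto simp: field_simps)
    finally show ?thesis .
  qed
  have g: "(\<lambda>j. B * (1/2) ^ j) sums (B * 2)"
    using sums_mult[OF geometric_sums[of "1/2::real"], of B] by simp
  show s: "wsummable q f" unfolding wsummable_def
    by (rule summable_comparison_test'[OF sums_summable[OF g]]) (use le assms in auto)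
  show "wnorm q f \<le> 2 * B"
    using suminf_le[OF le s[unfolded wsummable_def] sums_summable[OF g]] g
    by (simp add: wnorm_def sums_iff mult.commute)
qed

lemma wsummable_diff:
  assumes "f holomorphic_on UNIV" "g holomorphic_on UNIV" "wsummable q f" "wsummable q g" "0 \<le> q"
  shows "wsummable q (\<lambda>z. f z - g z)" "wnorm q (\<lambda>z. f z - g z) \<le> wnorm q f + wnorm q g"
proof -
  have s: "summable (\<lambda>j. cmod (jet f j) * q ^ j / peak j + cmod (jet g j) * q ^ j / peak j)"
    using assms by (intro summable_add) (auto simp: wsummable_def)
  have le: "cmod (jet (\<lambda>z. f z - g z) j) * q ^ j / peak j
      \<le> cmod (jet f j) * q ^ j / peak j + cmod (jet g j) * q ^ j / peak j" for j
    using assms unfolding jet_diff[OF assms(1,2)]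
    by (simp flip: add_divide_distrib distrib_right)
      (intro divide_right_mono mult_right_mono norm_triangle_ineq4, auto)
  show w: "wsummable q (\<lambda>z. f z - g z)" unfolding wsummable_def
    by (rule summable_comparison_test'[OF s]) (use le assms in auto)
  show "wnorm q (\<lambda>z. f z - g z) \<le> wnorm q f + wnorm q g"
    unfolding wnorm_def using suminf_le[OF le w[unfolded wsummable_def] s] assms
    by (simp add: suminf_add wsummable_def)
qed

lemma wsummable_cmult:
  assumes "f holomorphic_on UNIV" "wsummable q f"
  shows "wsummable q (\<lambda>z. c * f z)" "wnorm q (\<lambda>z. c * f z) = cmod c * wnorm q f"
proof -
  have "(\<lambda>j. cmod c * (cmod (jet f j) * q ^ j / peak j)) sums (cmod c * wnorm q f)"
    using assms unfolding wnorm_def wsummable_def by (intro sums_mult summable_sums)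
  then have "(\<lambda>j. cmod (jet (\<lambda>z. c * f z) j) * q ^ j / peak j) sums (cmod c * wnorm q f)"
    by (simp add: jet_cmult[OF assms(1)] norm_mult mult.assoc)
  then show "wsummable q (\<lambda>z. c * f z)" "wnorm q (\<lambda>z. c * f z) = cmod c * wnorm q f"
    by (auto simp: wsummable_def wnorm_def sums_iff)
qed

section \<open>Taylor coefficients against suprema on discs, for \<theta>(x) = x\<close>

lemma jet_le_identity:
  assumes "identity_weight \<theta>" "f holomorphic_on UNIV" "0 < S" "\<And>z. cmod z \<le> S \<Longrightarrow> cmod (f z) \<le> B"
  shows "cmod (jet f j) \<le> (exp 1 / S) ^ j * peak j * B"
proof -
  have B: "0 \<le> B" using order_trans[OF norm_ge_zero assms(4)[of 0]] assms by simp
  have e: "exp (- real j) * exp 1 ^ j = 1" by (simp flip: exp_of_nat_mult exp_add)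
  \<comment> \<open>The maximum of t^j e^(-t) is at t = j; with \<open>fact j \<le> j ^ j\<close>
    this bounds j! by \<open>peak j\<close> up to the geometric factor e^j.\<close>
  have "real j ^ j * exp (- real j) \<le> peak j"
    using peak_upper[of "real j" j] assms(1) by (simp add: identity_weight_def)
  then have "real j ^ j * exp (- real j) * exp 1 ^ j \<le> peak j * exp 1 ^ j"
    by (intro mult_right_mono) auto
  then have "real j ^ j \<le> peak j * exp 1 ^ j" using e by (simp add: mult.assoc)
  then have f: "fact j \<le> exp 1 ^ j * peak j"
    using fact_le_power[of j, where 'a = real] by (simp add: mult.commute)
  have "cmod (jet f j) \<le> fact j * B / S ^ j"
    by (rule jet_le_Cauchy) (use assms in auto)
  also have "\<dots> \<le> exp 1 ^ j * peak j * B / S ^ j"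
    using f B assms(3) by (intro divide_right_mono mult_right_mono) auto
  finally show ?thesis by (simp add: power_divide)
qed

text \<open>Here \<open>peak j \<le> fact j\<close>, so the Taylor series is majorised term by term
  by the series of \<open>wnorm\<close>.\<close>

lemma norm_le_wnorm_identity:
  assumes "identity_weight \<theta>" "f holomorphic_on UNIV" "wsummable q f" "cmod z \<le> q"
  shows "cmod (f z) \<le> wnorm q f"
proof -
  have "peak j \<le> fact j" for j
  proof (rule peak_least)
    fix t :: real assume "0 \<le> t"
    then show "t ^ j * exp (- \<theta> t) \<le> fact j"
      using power_le_fact_exp[of t j] assms(1) by (simp add: identity_weight_def exp_minus field_simps)
  qed
  moreover have "0 \<le> q" using assms(4) norm_ge_zero order_trans by blast
  ultimately have le: "cmod (jet f j / fact j * z ^ j) \<le> cmod (jet f j) * q ^ j / peak j" for j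
    using assms(4) by (auto simp: norm_mult norm_divide norm_power
      intro!: frac_le mult_left_mono power_mono order_trans[OF norm_ge_zero assms(4)])
  have "f z = (\<Sum>j. jet f j / fact j * z ^ j)" using jet_sums[OF assms(2), of z] by (simp add: sums_iff)
  also have "cmod \<dots> \<le> wnorm q f" unfolding wnorm_def
    by (rule norm_suminf_le[OF le]) (use assms in \<open>auto simp: wsummable_def\<close>)
  finally show ?thesis .
qed

section \<open>Taylor coefficients against the Legendre transform of a Young function\<close>

lemma legendre_upper:
  assumes "young_function \<theta>" "0 \<le> x" "0 \<le> t"
  shows "t * x - \<theta> t \<le> legendre \<theta> x"
proof -
  have "(\<lambda>r. r) \<in> o[at_top](\<theta>)" using assms by (auto simp: young_function_def)
  \<comment> \<open>A supremum of reals is meaningful only for a bounded set. With the constant 1 /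
    (x + 1), \<theta>(t) outweighs t x beyond R, and below R the bound \<open>max R 0 * x\<close> is
    enough.\<close>
  from landau_o.smallD[OF this, of "1 / (x + 1)"] assms(2)
  obtain R where R: "\<And>r. r \<ge> R \<Longrightarrow> \<bar>r\<bar> \<le> 1 / (x + 1) * \<bar>\<theta> r\<bar>"
    by (auto simp: eventually_at_top_linorder)
  have "u * x - \<theta> u \<le> max R 0 * x" if u: "0 \<le> u" for u
  proof (cases "R \<le> u")
    case True
    then have "(x + 1) * u \<le> \<theta> u" using R[of u] u assms(2) by (simp add: field_simps)
    then have "u * x - \<theta> u \<le> 0" using u by (simp add: algebra_simps)
    also have "0 \<le> max R 0 * x" using assms(2) by simp
    finally show ?thesis .
  next
    case False
    then have "u * x \<le> max R 0 * x" using assms(2) by (intro mult_right_mono) auto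
    then show ?thesis using theta_nonneg[OF u] by linarith
  qed
  then have "bdd_above ((\<lambda>t. t * x - \<theta> t) ` {0..})" by (intro bdd_aboveI2) auto
  then show ?thesis unfolding legendre_def by (rule cSUP_upper[rotated]) (use assms in auto)
qed

lemma legendre_nonneg: "young_function \<theta> \<Longrightarrow> 0 \<le> x \<Longrightarrow> 0 \<le> legendre \<theta> x"
  using legendre_upper[of x 0] by simp

text \<open>By \<open>peak_upper\<close> for \<open>Suc j\<close> the function is at most
  \<open>peak (Suc j) / t\<close>, so it is below its value at 1 for t \<ge> M, and the supremum is
  a maximum over a compact interval. It is not attained at 0 because j \<ge> 1.\<close>

lemma peak_attained:
  assumes "1 \<le> j" obtains t where "0 < t" "peak j = t ^ j * exp (- \<theta> t)"
proof -
  define u where "u = (\<lambda>t. t ^ j * exp (- \<theta> t))"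
  define M where "M = peak (Suc j) / u 1"
  have u1: "0 < u 1" by (simp add: u_def)
  have M: "0 < M" using u1 by (simp add: M_def)
  have large: "u t \<le> u 1" if "M \<le> t" for t
  proof -
    have t: "0 < t" using that M by linarith
    have "t * u t \<le> peak (Suc j)" using peak_upper[of t "Suc j"] t by (simp add: u_def mult_ac)
    also have "\<dots> = M * u 1" using u1 by (simp add: M_def)
    also have "\<dots> \<le> t * u 1" using that u1 by (intro mult_right_mono) auto
    finally show ?thesis using t by simp
  qed
  have "continuous_on {0..max M 1} u"
    unfolding u_def by (intro continuous_intros continuous_on_subset[OF theta_continuous]) auto
  then obtain t where t: "t \<in> {0..max M 1}" "\<And>s. s \<in> {0..max M 1} \<Longrightarrow> u s \<le> u t"
    using continuous_attains_sup[of "{0..max M 1}" u] by fastforce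
  have all: "u s \<le> u t" if "0 \<le> s" for s
    using large[of s] t(2)[of s] t(2)[of 1] that by (cases "s \<le> max M 1") (auto simp: not_le)
  have "peak j = u t"
    by (intro antisym peak_least) (use all peak_upper[of t j] t(1) in \<open>auto simp: u_def\<close>)
  moreover have "0 < t"
    using all[of 1] u1 t(1) assms by (cases "t = 0") (auto simp: u_def power_0_left not_le)
  ultimately show ?thesis using that by (simp add: u_def)
qed

text \<open>At the maximiser $t$ of $t^j e^{-\theta(t)}$ the slope $j/t$ is a subgradient of $\theta$.\<close>

lemma legendre_le_peak:
  assumes "1 \<le> j"
  obtains s where "0 < s" "exp (legendre \<theta> s) * fact j \<le> exp 1 ^ j * peak j * s ^ j"
proof -
  obtain t where t: "0 < t" "peak j = t ^ j * exp (- \<theta> t)" using peak_attained[OF assms] .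
  define s where "s = real j / t"
  have j: "0 < real j" using assms by simp
  have sub: "\<theta> t + s * (u - t) \<le> \<theta> u" if u: "0 \<le> u" for u
  proof (rule ccontr)
    assume neg: "\<not> ?thesis"
    define y where "y = (u - t) / t"
    \<comment> \<open>\<theta> need not be differentiable, so the first order condition is tested
      along the segment from t to u. Convexity of \<theta> and maximality at t give \<phi>(h) \<ge>
      0 for small h > 0, whereas \<phi>(0) = 0 and a failing subgradient inequality makes the
      derivative of \<phi> at 0 negative.\<close>
    define \<phi> where "\<phi> = (\<lambda>h. h * (\<theta> u - \<theta> t) - real j * ln (1 + h * y))"
    have "DERIV \<phi> 0 :> (\<theta> u - \<theta> t) - real j * y"
      unfolding \<phi>_def by (auto intro!: derivative_eq_intros)
    moreover have "(\<theta> u - \<theta> t) - real j * y < 0"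
      using neg t(1) by (simp add: s_def y_def field_simps)
    ultimately obtain d where d: "d > 0" "\<And>h. h > 0 \<Longrightarrow> h < d \<Longrightarrow> \<phi> (0 + h) < \<phi> 0"
      using DERIV_neg_dec_right by blast
    define h where "h = min (d/2) (1/2)"
    have h: "0 < h" "h < d" "h < 1" using d(1) by (auto simp: h_def)
    define v where "v = t + h * (u - t)"
    have v: "v = t * (1 + h * y)" using t(1) by (simp add: v_def y_def field_simps)
    have "v = (1 - h) * t + h * u" by (simp add: v_def algebra_simps)
    then have v0: "0 < v" using h t(1) u by (simp add: add_pos_nonneg)
    then have pos: "0 < 1 + h * y" using v t(1) by (simp add: zero_less_mult_iff)
    have "\<theta> ((1 - h) *\<^sub>R t + h *\<^sub>R u) \<le> (1 - h) * \<theta> t + h * \<theta> u"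
      by (rule convex_onD[OF theta_convex]) (use h t(1) u in auto)
    then have "\<theta> v - \<theta> t \<le> h * (\<theta> u - \<theta> t)" by (simp add: v_def algebra_simps)
    moreover have "real j * ln (1 + h * y) \<le> \<theta> v - \<theta> t"
    proof -
      have "v ^ j * exp (- \<theta> v) \<le> t ^ j * exp (- \<theta> t)" using peak_upper[of v j] v0 t(2) by simp
      then have "ln (v ^ j * exp (- \<theta> v)) \<le> ln (t ^ j * exp (- \<theta> t))"
        using v0 t(1) by (subst ln_le_cancel_iff) auto
      then have "real j * ln v - \<theta> v \<le> real j * ln t - \<theta> t"
        using v0 t(1) by (simp add: ln_mult ln_realpow)
      moreover have "ln v = ln t + ln (1 + h * y)" unfolding v using t(1) pos by (simp add: ln_mult)
      ultimately show ?thesis by (simp add: algebra_simps)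
    qed
    ultimately have "0 \<le> \<phi> h" by (simp add: \<phi>_def)
    then show False using d(2)[OF h(1,2)] by (simp add: \<phi>_def)
  qed
  \<comment> \<open>The subgradient inequality says that u s - \<theta>(u) is largest at u = t,
    where s t = j.\<close>
  have "legendre \<theta> s \<le> real j - \<theta> t"
    unfolding legendre_def
  proof (rule cSUP_least)
    fix u :: real assume "u \<in> {0..}"
    then have "u * s - \<theta> u \<le> s * t - \<theta> t" using sub[of u] by (simp add: algebra_simps)
    then show "u * s - \<theta> u \<le> real j - \<theta> t" using t(1) by (simp add: s_def)
  qed simp
  then have "exp (legendre \<theta> s) \<le> exp (real j - \<theta> t)" by simp
  also have "\<dots> = exp 1 ^ j * exp (- \<theta> t)" by (simp add: exp_diff exp_minus divide_inverse flip: exp_of_nat_mult)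
  also have "\<dots> = exp 1 ^ j * peak j / t ^ j" using t by simp
  finally have "exp (legendre \<theta> s) * fact j \<le> exp 1 ^ j * peak j / t ^ j * real j ^ j"
    using fact_le_power[of j, where 'a = real] t(1) by (intro mult_mono) auto
  also have "\<dots> = exp 1 ^ j * peak j * s ^ j" by (simp add: s_def power_divide)
  finally show ?thesis using that[of s] j t(1) by (simp add: s_def)
qed

lemma E_norm_upper:
  "f \<in> E_space \<psi> r \<Longrightarrow> cmod (f z) * exp (- \<psi> (r * cmod z)) \<le> E_norm \<psi> r f"
  unfolding E_space_def E_norm_def by (auto intro: cSUP_upper)

text \<open>Cauchy's estimate on the circle of radius p s, with the s that
  \<open>legendre_le_peak\<close> attaches to j. For j = 0 the value at the origin is used
  directly.\<close>

lemma jet_le_young: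
  assumes "young_function \<theta>" "f \<in> E_space (legendre \<theta>) (1 / p)" "0 < p"
  shows "cmod (jet f j) \<le> (exp 1 / p) ^ j * peak j * E_norm (legendre \<theta>) (1 / p) f"
    (is "_ \<le> _ * ?N")
proof -
  have hol: "f holomorphic_on UNIV" using assms by (simp add: E_space_def)
  have le: "cmod (f z) \<le> ?N * exp (legendre \<theta> (cmod z / p))" for z
    using E_norm_upper[OF assms(2), of z] by (simp add: exp_minus field_simps)
  have N: "0 \<le> ?N" using order_trans[OF _ E_norm_upper[OF assms(2), of 0]] by simp
  show ?thesis
  proof (cases "j = 0")
    case True
    have "legendre \<theta> 0 \<le> 0" unfolding legendre_def by (rule cSUP_least) auto
    then have "?N * exp (legendre \<theta> 0) \<le> ?N * 1" using N by (intro mult_left_mono) auto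
    then show ?thesis using le[of 0] True by (simp add: jet_def peak_0)
  next
    case False
    then obtain s where s: "0 < s" "exp (legendre \<theta> s) * fact j \<le> exp 1 ^ j * peak j * s ^ j"
      using legendre_le_peak[of j] by auto
    have "cmod (jet f j) \<le> fact j * (?N * exp (legendre \<theta> s)) / (p * s) ^ j"
    proof (rule jet_le_Cauchy[OF hol])
      fix z :: complex assume "cmod z = p * s"
      then show "cmod (f z) \<le> ?N * exp (legendre \<theta> s)" using le[of z] assms(3) by simp
    qed (use s assms in auto)
    also have "\<dots> = ?N * (exp (legendre \<theta> s) * fact j) / (p * s) ^ j" by simp
    also have "\<dots> \<le> ?N * (exp 1 ^ j * peak j * s ^ j) / (p * s) ^ j"
      using s N assms by (intro divide_right_mono mult_left_mono) auto
    also have "\<dots> = (exp 1 / p) ^ j * peak j * ?N"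
      using s(1) by (simp add: power_divide power_mult_distrib)
    finally show ?thesis .
  qed
qed

text \<open>From t^j x^j \<le> j! e^(t x) and t x \<le> \<theta>(t) +
  \<open>legendre \<theta> x\<close> follows
  \<open>peak j * x ^ j \<le> fact j * exp (legendre \<theta> x)\<close>. Hence each Taylor term at
  z is at most the corresponding term of \<open>wnorm p f\<close> times the weight.\<close>

lemma norm_le_wnorm_young:
  assumes "young_function \<theta>" "f holomorphic_on UNIV" "0 < p" "wsummable p f"
  shows "cmod (f z) \<le> wnorm p f * exp (legendre \<theta> (cmod z / p))"
proof -
  define x where "x = cmod z / p"
  have x: "0 \<le> x" using assms by (simp add: x_def)
  have pk: "peak j * x ^ j \<le> fact j * exp (legendre \<theta> x)" for j
  proof (cases "x = 0")
    case True
    show ?thesis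
    proof (cases "j = 0")
      case True
      then show ?thesis using legendre_nonneg[OF assms(1) x] by (simp add: peak_0)
    qed (use \<open>x = 0\<close> in \<open>simp add: power_0_left\<close>)
  next
    case False
    then have x0: "0 < x" using x by simp
    have "peak j \<le> fact j * exp (legendre \<theta> x) / x ^ j"
    proof (rule peak_least)
      fix t :: real assume t: "0 \<le> t"
      have "t ^ j * exp (- \<theta> t) * x ^ j = (t * x) ^ j * exp (- \<theta> t)" by (simp add: power_mult_distrib)
      also have "\<dots> \<le> fact j * exp (t * x) * exp (- \<theta> t)"
        using t x by (intro mult_right_mono power_le_fact_exp) auto
      also have "\<dots> = fact j * exp (t * x - \<theta> t)" by (simp add: exp_diff exp_minus field_simps)
      also have "\<dots> \<le> fact j * exp (legendre \<theta> x)" using legendre_upper[OF assms(1) x t] by simp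
      finally show "t ^ j * exp (- \<theta> t) \<le> fact j * exp (legendre \<theta> x) / x ^ j"
        using x0 by (simp add: field_simps)
    qed
    then show ?thesis using x0 by (simp add: field_simps)
  qed
  have le: "cmod (jet f j / fact j * z ^ j) \<le> cmod (jet f j) * p ^ j / peak j * exp (legendre \<theta> x)" for j
  proof -
    have "cmod z ^ j = (p * x) ^ j" using assms(3) by (simp add: x_def)
    then have "cmod z ^ j / fact j = p ^ j / (peak j * fact j) * (peak j * x ^ j)"
      by (simp add: power_mult_distrib)
    also have "\<dots> \<le> p ^ j / (peak j * fact j) * (fact j * exp (legendre \<theta> x))"
      using pk assms(3) by (intro mult_left_mono) auto
    also have "\<dots> = p ^ j / peak j * exp (legendre \<theta> x)" by simp
    finally have "cmod (jet f j) * (cmod z ^ j / fact j)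
        \<le> cmod (jet f j) * (p ^ j / peak j * exp (legendre \<theta> x))"
      by (rule mult_left_mono) simp
    then show ?thesis by (simp add: norm_mult norm_divide norm_power)
  qed
  have "f z = (\<Sum>j. jet f j / fact j * z ^ j)" using jet_sums[OF assms(2), of z] by (simp add: sums_iff)
  also have "cmod \<dots> \<le> (\<Sum>j. cmod (jet f j) * p ^ j / peak j * exp (legendre \<theta> x))"
    by (rule norm_suminf_le[OF le summable_mult2]) (use assms in \<open>simp add: wsummable_def\<close>)
  also have "\<dots> = wnorm p f * exp (legendre \<theta> x)"
    unfolding wnorm_def using assms(4) by (intro suminf_mult2[symmetric]) (auto simp: wsummable_def)
  finally show ?thesis unfolding x_def .
qed

lemma E_norm_le_wnorm:
  assumes "young_function \<theta>" "f holomorphic_on UNIV" "0 < p" "wsummable p f"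
  shows "f \<in> E_space (legendre \<theta>) (1 / p)" "E_norm (legendre \<theta>) (1 / p) f \<le> wnorm p f"
proof -
  have le: "cmod (f z) * exp (- legendre \<theta> (1 / p * cmod z)) \<le> wnorm p f" for z
    using norm_le_wnorm_young[OF assms, of z] by (simp add: exp_minus field_simps)
  then show "f \<in> E_space (legendre \<theta>) (1 / p)"
    using assms(2) by (auto simp: E_space_def intro!: bdd_aboveI2)
  show "E_norm (legendre \<theta>) (1 / p) f \<le> wnorm p f"
    unfolding E_norm_def by (rule cSUP_least) (use le in auto)
qed

lemma wnorm_le_identity:
  assumes "identity_weight \<theta>" "f holomorphic_on UNIV" "0 < q"
    "\<And>z. z \<in> cball 0 (2 * exp 1 * q) \<Longrightarrow> cmod (f z) \<le> B"
  shows "wsummable q f" "wnorm q f \<le> 2 * B"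
proof -
  have "cmod (jet f j) \<le> (exp 1 / (2 * exp 1 * q)) ^ j * peak j * B" for j
    by (rule jet_le_identity) (use assms in auto)
  then show "wsummable q f" "wnorm q f \<le> 2 * B"
    using wnorm_le_if_jet_le[of q "2 * exp 1 * q" f B] assms(3) by auto
qed

lemma wnorm_le_E_norm:
  assumes "young_function \<theta>" "0 < q" "2 * exp 1 * q \<le> p" "f \<in> E_space (legendre \<theta>) (1 / p)"
  shows "wsummable q f" "wnorm q f \<le> 2 * E_norm (legendre \<theta>) (1 / p) f"
proof -
  have p: "0 < p" using assms by (meson exp_gt_zero less_le_trans mult_pos_pos zero_less_numeral)
  show "wsummable q f" "wnorm q f \<le> 2 * E_norm (legendre \<theta>) (1 / p) f"
    using wnorm_le_if_jet_le[of q p f, OF _ assms(3) p jet_le_young[OF assms(1,4) p]] assms(2) by auto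
qed

lemma F_space_iff: "f \<in> F_space \<theta> \<longleftrightarrow> f holomorphic_on UNIV \<and> (\<forall>q>0. wsummable q f)"
proof (cases "identity_weight \<theta>")
  case True
  have "wsummable q f" if hol: "f holomorphic_on UNIV" and q: "q > 0" for q
  proof -
    have "compact (f ` cball 0 (2 * exp 1 * q))"
      using hol by (intro compact_continuous_image holomorphic_on_imp_continuous_on[OF holomorphic_on_subset[OF hol]]) auto
    then obtain B where "\<And>z. z \<in> cball 0 (2 * exp 1 * q) \<Longrightarrow> cmod (f z) \<le> B"
      using compact_imp_bounded bounded_iff by (metis imageI)
    then show ?thesis using wnorm_le_identity(1)[OF True hol q] by blast
  qed
  then show ?thesis using True by (auto simp: F_space_def)
next
  case False
  then have y: "young_function \<theta>" using weight by auto
  show ?thesis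
  proof
    assume f: "f \<in> F_space \<theta>"
    have E: "f \<in> E_space (legendre \<theta>) (1 / real p)" if "1 \<le> p" for p
      using f False that by (auto simp: F_space_def)
    have "wsummable q f" if q: "q > 0" for q
    proof -
      obtain p :: nat where p: "2 * exp 1 * q \<le> real p" using real_arch_simple by blast
      then have "1 \<le> p" using q by (cases p) (auto simp: mult_le_0_iff)
      then show ?thesis using wnorm_le_E_norm(1)[OF y q p E] by blast
    qed
    then show "f holomorphic_on UNIV \<and> (\<forall>q>0. wsummable q f)"
      using E[of 1] by (auto simp: E_space_def)
  next
    assume "f holomorphic_on UNIV \<and> (\<forall>q>0. wsummable q f)"
    then show "f \<in> F_space \<theta>" using False y by (auto simp: F_space_def intro!: E_norm_le_wnorm(1))
  qed
qed

section \<open>The topology of $\mathcal F_\theta$\<close>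

lemma F_entire: "f \<in> F_space \<theta> \<Longrightarrow> f holomorphic_on UNIV"
  and F_wsummable: "f \<in> F_space \<theta> \<Longrightarrow> 0 < q \<Longrightarrow> wsummable q f"
  by (auto simp: F_space_iff)

lemma F_diff: "f \<in> F_space \<theta> \<Longrightarrow> g \<in> F_space \<theta> \<Longrightarrow> (\<lambda>z. f z - g z) \<in> F_space \<theta>"
  unfolding F_space_iff by (auto intro!: holomorphic_intros wsummable_diff(1))

lemma F_cmult: "f \<in> F_space \<theta> \<Longrightarrow> (\<lambda>z. c * f z) \<in> F_space \<theta>"
  unfolding F_space_iff by (auto intro!: holomorphic_intros wsummable_cmult(1))

lemma F_zero: "(\<lambda>z. 0) \<in> F_space \<theta>"
proof -
  have "jet (\<lambda>z. 0) j = 0" for j by (rule jet_eqI[of "\<lambda>j. 0"]) auto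
  then show ?thesis by (auto simp: F_space_iff wsummable_def)
qed

lemma F_add: "f \<in> F_space \<theta> \<Longrightarrow> g \<in> F_space \<theta> \<Longrightarrow> (\<lambda>z. f z + g z) \<in> F_space \<theta>"
  using F_diff[of f "\<lambda>z. - 1 * g z"] F_cmult[of g "- 1"] by simp

lemma F_sum:
  assumes "finite A" "\<And>i. i \<in> A \<Longrightarrow> f i \<in> F_space \<theta>"
  shows "(\<lambda>z. \<Sum>i\<in>A. f i z) \<in> F_space \<theta>"
  using assms by (induction A) (auto intro: F_zero F_add)

text \<open>Openness for the topology of the norms \<open>wnorm q\<close>. One ball per point
  suffices: \<open>wnorm q\<close> increases with q, so finitely many norms are dominated by a
  single one.\<close>

definition wopen :: "(complex \<Rightarrow> complex) set \<Rightarrow> bool" where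
  "wopen U \<longleftrightarrow> U \<subseteq> F_space \<theta> \<and>
     (\<forall>f\<in>U. \<exists>q>0. \<exists>e>0. \<forall>g\<in>F_space \<theta>. wnorm q (\<lambda>z. g z - f z) < e \<longrightarrow> g \<in> U)"

lemma wopenD:
  assumes "wopen U" "f \<in> U"
  obtains q e where "0 < q" "0 < e" "\<And>g. g \<in> F_space \<theta> \<Longrightarrow> wnorm q (\<lambda>z. g z - f z) < e \<Longrightarrow> g \<in> U"
  using assms unfolding wopen_def by blast

lemma wopen_Int:
  assumes "wopen U" "wopen V" shows "wopen (U \<inter> V)"
  unfolding wopen_def
proof (intro conjI ballI)
  fix f assume f: "f \<in> U \<inter> V"
  then obtain p d where p: "0 < p" "0 < d" "\<And>g. g \<in> F_space \<theta> \<Longrightarrow> wnorm p (\<lambda>z. g z - f z) < d \<Longrightarrow> g \<in> U"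
    using wopenD[OF assms(1)] by blast
  obtain q e where q: "0 < q" "0 < e" "\<And>g. g \<in> F_space \<theta> \<Longrightarrow> wnorm q (\<lambda>z. g z - f z) < e \<Longrightarrow> g \<in> V"
    using wopenD[OF assms(2)] f by blast
  have fF: "f \<in> F_space \<theta>" using f assms by (auto simp: wopen_def)
  have "g \<in> U \<inter> V" if g: "g \<in> F_space \<theta>" "wnorm (max p q) (\<lambda>z. g z - f z) < min d e" for g
  proof -
    have w: "wsummable (max p q) (\<lambda>z. g z - f z)"
      using F_wsummable[OF F_diff[OF g(1) fF]] p q by auto
    show ?thesis
      using p(3)[OF g(1)] q(3)[OF g(1)] wnorm_mono(2)[OF _ _ w, of p] wnorm_mono(2)[OF _ _ w, of q] g(2) p q
      by auto
  qed
  then show "\<exists>q>0. \<exists>e>0. \<forall>g\<in>F_space \<theta>. wnorm q (\<lambda>z. g z - f z) < e \<longrightarrow> g \<in> U \<inter> V"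
    using p q by (intro exI[of _ "max p q"] conjI exI[of _ "min d e"]) auto
qed (use assms in \<open>auto simp: wopen_def\<close>)

lemma wopen_generated:
  assumes "generate_topology_on \<B> U" "\<And>B. B \<in> \<B> \<Longrightarrow> wopen B"
  shows "wopen U"
  using assms(1)
proof (induction rule: generate_topology_on.induct)
  case (UN \<K>)
  show ?case unfolding wopen_def
  proof (intro conjI ballI)
    fix f assume "f \<in> \<Union>\<K>"
    then obtain k where k: "k \<in> \<K>" "f \<in> k" by blast
    then obtain q e where "0 < q" "0 < e" "\<And>g. g \<in> F_space \<theta> \<Longrightarrow> wnorm q (\<lambda>z. g z - f z) < e \<Longrightarrow> g \<in> k"
      using wopenD[OF UN.IH] by blast
    then show "\<exists>q>0. \<exists>e>0. \<forall>g\<in>F_space \<theta>. wnorm q (\<lambda>z. g z - f z) < e \<longrightarrow> g \<in> \<Union>\<K>"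
      using k by blast
  qed (use UN.IH in \<open>auto simp: wopen_def\<close>)
qed (auto simp: assms(2) wopen_Int, auto simp: wopen_def)

lemma E_triangle:
  assumes "f \<in> E_space \<psi> r" "g \<in> E_space \<psi> r"
  shows "(\<lambda>z. f z + g z) \<in> E_space \<psi> r" "E_norm \<psi> r (\<lambda>z. f z + g z) \<le> E_norm \<psi> r f + E_norm \<psi> r g"
proof -
  have le: "cmod (f z + g z) * exp (- \<psi> (r * cmod z)) \<le> E_norm \<psi> r f + E_norm \<psi> r g" for z
  proof -
    have "cmod (f z + g z) * exp (- \<psi> (r * cmod z))
        \<le> cmod (f z) * exp (- \<psi> (r * cmod z)) + cmod (g z) * exp (- \<psi> (r * cmod z))"
      by (simp flip: distrib_right add: norm_triangle_ineq)
    then show ?thesis using E_norm_upper[OF assms(1), of z] E_norm_upper[OF assms(2), of z] by linarith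
  qed
  then show "(\<lambda>z. f z + g z) \<in> E_space \<psi> r"
    using assms by (auto simp: E_space_def intro!: bdd_aboveI2 holomorphic_intros)
  show "E_norm \<psi> r (\<lambda>z. f z + g z) \<le> E_norm \<psi> r f + E_norm \<psi> r g"
    unfolding E_norm_def[of _ _ "\<lambda>z. f z + g z"] by (rule cSUP_least) (use le in auto)
qed

lemma E_diff:
  assumes "f \<in> E_space \<psi> r" "g \<in> E_space \<psi> r"
  shows "(\<lambda>z. f z - g z) \<in> E_space \<psi> r"
proof -
  have "(\<lambda>z. - g z) \<in> E_space \<psi> r"
    using assms(2) by (auto simp: E_space_def intro!: holomorphic_intros)
  from E_triangle(1)[OF assms(1) this] show ?thesis by simp
qed

text \<open>The balls are declared only as a subbase; recentring a ball at a given point of it by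
  the triangle inequality shows that they behave as a base.\<close>

lemma E_top_ball:
  assumes "openin (E_top \<psi> r) U" "f \<in> U"
  shows "\<exists>e>0. \<forall>g\<in>E_space \<psi> r. E_norm \<psi> r (\<lambda>z. g z - f z) < e \<longrightarrow> g \<in> U"
  using openin_topology_generated_by[OF assms(1)[unfolded E_top_def]] assms(2)
proof (induction arbitrary: f rule: generate_topology_on.induct)
  case (Int a b)
  from Int.IH(1)[of f] Int.prems obtain d where d: "d > 0"
    "\<forall>g\<in>E_space \<psi> r. E_norm \<psi> r (\<lambda>z. g z - f z) < d \<longrightarrow> g \<in> a" by blast
  from Int.IH(2)[of f] Int.prems obtain e where e: "e > 0"
    "\<forall>g\<in>E_space \<psi> r. E_norm \<psi> r (\<lambda>z. g z - f z) < e \<longrightarrow> g \<in> b" by blast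
  show ?case using d e by (intro exI[of _ "min d e"]) auto
next
  case (UN K)
  then obtain k where "k \<in> K" "f \<in> k" by blast
  from UN.IH[OF this] this(1) show ?case by blast
next
  case (Basis s)
  then obtain f0 e where s: "s = {g \<in> E_space \<psi> r. E_norm \<psi> r (\<lambda>z. g z - f0 z) < e}"
    and f0: "f0 \<in> E_space \<psi> r" by auto
  have f: "f \<in> E_space \<psi> r" "E_norm \<psi> r (\<lambda>z. f z - f0 z) < e" using Basis s by auto
  have "g \<in> s" if g: "g \<in> E_space \<psi> r" "E_norm \<psi> r (\<lambda>z. g z - f z) < e - E_norm \<psi> r (\<lambda>z. f z - f0 z)" for g
    using E_triangle(2)[OF E_diff[OF g(1) f(1)] E_diff[OF f(1) f0]] g s by simp
  then show ?case using f by (intro exI[of _ "e - E_norm \<psi> r (\<lambda>z. f z - f0 z)"]) auto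
qed auto

text \<open>Each topology is finer than the other, by the comparison of norms in both directions.
  Together with \<open>F_space_iff\<close> this ends the case distinction on \<theta>.\<close>

lemma openin_F_top_iff: "openin (F_top \<theta>) U \<longleftrightarrow> wopen U"
proof (cases "identity_weight \<theta>")
  case True
  define \<B> where "\<B> = {{g \<in> F_space \<theta>. \<forall>z\<in>K. cmod (g z - f z) < e} |f K e. f \<in> F_space \<theta> \<and> compact K \<and> 0 < e}"
  have top: "F_top \<theta> = topology_generated_by \<B>" using True by (simp add: F_top_def \<B>_def)
  show ?thesis
  proof
    have "wopen B" if mem: "B \<in> \<B>" for B
    proof -
      obtain f0 K e where B: "B = {g \<in> F_space \<theta>. \<forall>z\<in>K. cmod (g z - f0 z) < e}"
        and f0: "f0 \<in> F_space \<theta>" and K: "compact K" and e: "0 < e"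
        using mem unfolding \<B>_def by blast
      show ?thesis unfolding wopen_def
      proof (intro conjI ballI)
        fix f assume f: "f \<in> B"
        then have fF: "f \<in> F_space \<theta>" by (simp add: B)
        \<comment> \<open>By compactness the supremum of |f - f0| over K stays strictly below e; the
          gap e - d is the radius of the ball around f. The value d = 0 serves an empty K.\<close>
        obtain d where d: "d < e" "\<And>z. z \<in> K \<Longrightarrow> cmod (f z - f0 z) \<le> d"
        proof (cases "K = {}")
          case False
          have "continuous_on K (\<lambda>z. cmod (f z - f0 z))"
            using F_entire[OF fF] F_entire[OF f0]
            by (intro continuous_intros) (auto intro: holomorphic_on_imp_continuous_on holomorphic_on_subset)
          from continuous_attains_sup[OF K False this]
          obtain z0 where z0: "z0 \<in> K" "\<And>z. z \<in> K \<Longrightarrow> cmod (f z - f0 z) \<le> cmod (f z0 - f0 z0)" by blast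
          have "cmod (f z0 - f0 z0) < e" using z0(1) f by (simp add: B)
          with z0 that show ?thesis by blast
        qed (use that[of 0] e in auto)
        obtain R where R: "0 < R" "\<And>z. z \<in> K \<Longrightarrow> cmod z \<le> R"
          using compact_imp_bounded[OF K] by (auto simp: bounded_pos)
        have "g \<in> B" if g: "g \<in> F_space \<theta>" "wnorm R (\<lambda>z. g z - f z) < e - d" for g
        proof -
          have D: "(\<lambda>z. g z - f z) \<in> F_space \<theta>" by (rule F_diff[OF g(1) fF])
          have "cmod (g z - f0 z) < e" if z: "z \<in> K" for z
          proof -
            have "cmod (g z - f z) \<le> wnorm R (\<lambda>z. g z - f z)"
              using norm_le_wnorm_identity[OF True F_entire[OF D] F_wsummable[OF D R(1)] R(2)[OF z]] .
            moreover have "cmod (g z - f0 z) \<le> cmod (g z - f z) + cmod (f z - f0 z)"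
              using norm_triangle_ineq[of "g z - f z" "f z - f0 z"] by simp
            ultimately show ?thesis using g(2) d(2)[OF z] by linarith
          qed
          then show ?thesis using g(1) by (simp add: B)
        qed
        then show "\<exists>q>0. \<exists>e>0. \<forall>g\<in>F_space \<theta>. wnorm q (\<lambda>z. g z - f z) < e \<longrightarrow> g \<in> B"
          using R(1) d(1) by (intro exI[of _ R] conjI exI[of _ "e - d"]) auto
      qed (auto simp: B)
    qed
    then show "wopen U" if "openin (F_top \<theta>) U"
      using that wopen_generated unfolding top openin_topology_generated_by_iff by blast
  next
    assume U: "wopen U"
    show "openin (F_top \<theta>) U"
    proof (subst openin_subopen, intro ballI)
      fix f assume f: "f \<in> U"
      then obtain q e where q: "0 < q" "0 < e"
        "\<And>g. g \<in> F_space \<theta> \<Longrightarrow> wnorm q (\<lambda>z. g z - f z) < e \<Longrightarrow> g \<in> U"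
        using wopenD[OF U] by blast
      have fF: "f \<in> F_space \<theta>" using f U by (auto simp: wopen_def)
      \<comment> \<open>\<open>wnorm q\<close> is at most twice the supremum over the disc of radius
        \<open>2 * exp 1 * q\<close>, so the tolerance \<open>e / 3\<close> gives a norm below
        \<open>e\<close>.\<close>
      define V where "V = {g \<in> F_space \<theta>. \<forall>z\<in>cball 0 (2 * exp 1 * q). cmod (g z - f z) < e / 3}"
      have "V \<in> \<B>" unfolding \<B>_def V_def using fF q(2) compact_cball
        by (intro CollectI exI[of _ f] exI[of _ "cball 0 (2 * exp 1 * q)"] exI[of _ "e/3"]) auto
      moreover have "f \<in> V" using fF q by (simp add: V_def)
      moreover have "V \<subseteq> U"
      proof
        fix g assume g: "g \<in> V"
        then have D: "(\<lambda>z. g z - f z) holomorphic_on UNIV"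
          using F_entire[OF F_diff[OF _ fF]] by (auto simp: V_def)
        have "wnorm q (\<lambda>z. g z - f z) \<le> 2 * (e / 3)"
          by (rule wnorm_le_identity(2)[OF True D q(1)]) (use g in \<open>auto simp: V_def intro: less_imp_le\<close>)
        then show "g \<in> U" using q g by (auto simp: V_def)
      qed
      ultimately show "\<exists>T. openin (F_top \<theta>) T \<and> f \<in> T \<and> T \<subseteq> U"
        unfolding top using topology_generated_by_Basis by blast
    qed
  qed
next
  case False
  then have y: "young_function \<theta>" using weight by auto
  define \<B> where "\<B> = {F_space \<theta> \<inter> U |U p. 1 \<le> p \<and> openin (E_top (legendre \<theta>) (1 / real p)) U}"
  have top: "F_top \<theta> = topology_generated_by \<B>" using False by (simp add: F_top_def \<B>_def)
  have FE: "f \<in> E_space (legendre \<theta>) (1 / real p)" if "f \<in> F_space \<theta>" "1 \<le> p" for f p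
    using that False by (auto simp: F_space_def)
  show ?thesis
  proof
    have "wopen B" if mem: "B \<in> \<B>" for B
    proof -
      obtain V p where B: "B = F_space \<theta> \<inter> V" and p: "1 \<le> p"
        and V: "openin (E_top (legendre \<theta>) (1 / real p)) V"
        using mem unfolding \<B>_def by blast
      show ?thesis unfolding wopen_def
      proof (intro conjI ballI)
        fix f assume f: "f \<in> B"
        then have fF: "f \<in> F_space \<theta>" "f \<in> V" by (auto simp: B)
        obtain e where e: "e > 0" "\<And>g. g \<in> E_space (legendre \<theta>) (1 / real p) \<Longrightarrow>
            E_norm (legendre \<theta>) (1 / real p) (\<lambda>z. g z - f z) < e \<Longrightarrow> g \<in> V"
          using E_top_ball[OF V fF(2)] by blast
        have "g \<in> B" if g: "g \<in> F_space \<theta>" "wnorm p (\<lambda>z. g z - f z) < e" for g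
        proof -
          have D: "(\<lambda>z. g z - f z) \<in> F_space \<theta>" by (rule F_diff[OF g(1) fF(1)])
          have "E_norm (legendre \<theta>) (1 / real p) (\<lambda>z. g z - f z) \<le> wnorm p (\<lambda>z. g z - f z)"
            using E_norm_le_wnorm(2)[OF y F_entire[OF D]] F_wsummable[OF D] p by auto
          then show ?thesis using g e(2) FE[OF g(1) p] by (auto simp: B)
        qed
        then show "\<exists>q>0. \<exists>e>0. \<forall>g\<in>F_space \<theta>. wnorm q (\<lambda>z. g z - f z) < e \<longrightarrow> g \<in> B"
          using p e(1) by (intro exI[of _ "real p"] conjI exI[of _ e]) auto
      qed (auto simp: B)
    qed
    then show "wopen U" if "openin (F_top \<theta>) U"
      using that wopen_generated unfolding top openin_topology_generated_by_iff by blast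
  next
    assume U: "wopen U"
    show "openin (F_top \<theta>) U"
    proof (subst openin_subopen, intro ballI)
      fix f assume f: "f \<in> U"
      then obtain q e where q: "0 < q" "0 < e"
        "\<And>g. g \<in> F_space \<theta> \<Longrightarrow> wnorm q (\<lambda>z. g z - f z) < e \<Longrightarrow> g \<in> U"
        using wopenD[OF U] by blast
      have fF: "f \<in> F_space \<theta>" using f U by (auto simp: wopen_def)
      obtain p :: nat where p: "2 * exp 1 * q \<le> real p" using real_arch_simple by blast
      then have p1: "1 \<le> p" using q by (cases p) (auto simp: mult_le_0_iff)
      define V where "V = {g \<in> E_space (legendre \<theta>) (1 / real p).
        E_norm (legendre \<theta>) (1 / real p) (\<lambda>z. g z - f z) < e / 3}"
      have "openin (E_top (legendre \<theta>) (1 / real p)) V"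
        unfolding E_top_def V_def using FE[OF fF p1] q(2)
        by (intro topology_generated_by_Basis CollectI exI[of _ f] exI[of _ "e/3"]) auto
      then have "F_space \<theta> \<inter> V \<in> \<B>" using p1 by (auto simp: \<B>_def)
      moreover have "f \<in> V" using FE[OF fF p1] q by (simp add: V_def E_norm_def)
      moreover have "F_space \<theta> \<inter> V \<subseteq> U"
      proof
        fix g assume g: "g \<in> F_space \<theta> \<inter> V"
        have "wnorm q (\<lambda>z. g z - f z) \<le> 2 * E_norm (legendre \<theta>) (1 / real p) (\<lambda>z. g z - f z)"
          using wnorm_le_E_norm(2)[OF y q(1) p] E_diff[OF FE[OF _ p1] FE[OF fF p1]] g by auto
        then show "g \<in> U" using q g by (auto simp: V_def)
      qed
      ultimately show "\<exists>T. openin (F_top \<theta>) T \<and> f \<in> T \<and> T \<subseteq> U"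
        unfolding top using topology_generated_by_Basis fF by (intro exI[of _ "F_space \<theta> \<inter> V"]) auto
    qed
  qed
qed

lemma topspace_F_top: "topspace (F_top \<theta>) = F_space \<theta>"
proof
  have "wopen (F_space \<theta>)" by (auto simp: wopen_def intro: exI[of _ 1])
  then show "F_space \<theta> \<subseteq> topspace (F_top \<theta>)"
    by (metis openin_F_top_iff openin_subset)
  show "topspace (F_top \<theta>) \<subseteq> F_space \<theta>"
    using openin_topspace[of "F_top \<theta>"] unfolding openin_F_top_iff wopen_def by blast
qed

lemma limitin_F_topI:
  assumes "f \<in> F_space \<theta>" "\<And>n. s n \<in> F_space \<theta>"
    and "\<And>q. 0 < q \<Longrightarrow> (\<lambda>n. wnorm q (\<lambda>z. s n z - f z)) \<longlonglongrightarrow> 0"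
  shows "limitin (F_top \<theta>) s f sequentially"
  unfolding limitin_def topspace_F_top
proof (intro conjI allI impI)
  fix U assume "openin (F_top \<theta>) U \<and> f \<in> U"
  then obtain q e where q: "0 < q" "0 < e" "\<And>g. g \<in> F_space \<theta> \<Longrightarrow> wnorm q (\<lambda>z. g z - f z) < e \<Longrightarrow> g \<in> U"
    using wopenD[of U f] openin_F_top_iff by blast
  show "\<forall>\<^sub>F n in sequentially. s n \<in> U"
    by (rule eventually_mono[OF order_tendstoD(2)[OF assms(3)[OF q(1)] q(2)]]) (use q assms in auto)
qed (use assms in auto)

lemma
  assumes "S \<in> F_dual \<theta>"
  shows dual_add: "f \<in> F_space \<theta> \<Longrightarrow> g \<in> F_space \<theta> \<Longrightarrow> S (\<lambda>z. f z + g z) = S f + S g"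
    and dual_cmult: "f \<in> F_space \<theta> \<Longrightarrow> S (\<lambda>z. a * f z) = a * S f"
  using assms by (auto simp: F_dual_def)

text \<open>Homogeneity, applied to a ball on which |S| < 1. Scaling by an arbitrary y above
  \<open>1 / e * wnorm q f\<close>, instead of by the norm itself, avoids a division by a norm that
  may be zero.\<close>

lemma dual_bound:
  assumes "S \<in> F_dual \<theta>"
  obtains C q where "0 < C" "0 < q" "\<And>f. f \<in> F_space \<theta> \<Longrightarrow> cmod (S f) \<le> C * wnorm q f"
proof -
  have S0: "S (\<lambda>z. 0) = 0" using dual_cmult[OF assms F_zero, of 0] by simp
  have "openin (F_top \<theta>) {f \<in> topspace (F_top \<theta>). S f \<in> ball 0 1}"
    using assms open_ball[of "0::complex" 1] unfolding F_dual_def continuous_map open_openin[symmetric] by blast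
  then have "wopen {f \<in> F_space \<theta>. S f \<in> ball 0 1}" by (simp add: openin_F_top_iff topspace_F_top)
  then obtain q e where q: "0 < q" "0 < e" "\<And>g. g \<in> F_space \<theta> \<Longrightarrow> wnorm q g < e \<Longrightarrow> cmod (S g) < 1"
    using wopenD[of "{f \<in> F_space \<theta>. S f \<in> ball 0 1}" "\<lambda>z. 0"] F_zero S0 by (auto simp: dist_norm)
  have "cmod (S f) \<le> 1 / e * wnorm q f" if f: "f \<in> F_space \<theta>" for f
  proof (rule dense_ge)
    fix y assume y: "1 / e * wnorm q f < y"
    have w: "0 \<le> wnorm q f" using wnorm_nonneg[OF _ F_wsummable[OF f q(1)]] q by simp
    have "0 \<le> 1 / e * wnorm q f" using w q by simp
    with y have y0: "0 < y" by linarith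
    have "wnorm q (\<lambda>z. complex_of_real (1 / y) * f z) = wnorm q f / y"
      using wsummable_cmult(2)[OF F_entire[OF f] F_wsummable[OF f q(1)], of "complex_of_real (1/y)"] y0
      by (simp add: norm_divide)
    also have "\<dots> < e" using y y0 q by (simp add: field_simps)
    finally have "wnorm q (\<lambda>z. complex_of_real (1 / y) * f z) < e" .
    then have "cmod (S (\<lambda>z. complex_of_real (1 / y) * f z)) < 1" by (rule q(3)[OF F_cmult[OF f]])
    then have "y * cmod (S (\<lambda>z. complex_of_real (1 / y) * f z)) \<le> y * 1"
      using y0 by (intro mult_left_mono) auto
    moreover have "S f = y * S (\<lambda>z. complex_of_real (1 / y) * f z)"
      using dual_cmult[OF assms f, of "complex_of_real (1/y)"] y0 by simp
    ultimately show "cmod (S f) \<le> y" using y0 by (simp add: norm_mult)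
  qed
  then show ?thesis using that[of "1/e" q] q by simp
qed

lemma dualI:
  assumes "S \<in> extensional (F_space \<theta>)"
    and add: "\<And>f g. f \<in> F_space \<theta> \<Longrightarrow> g \<in> F_space \<theta> \<Longrightarrow> S (\<lambda>z. f z + g z) = S f + S g"
    and cmult: "\<And>a f. f \<in> F_space \<theta> \<Longrightarrow> S (\<lambda>z. a * f z) = a * S f"
    and bound: "0 < q" "\<And>f. f \<in> F_space \<theta> \<Longrightarrow> cmod (S f) \<le> C * wnorm q f"
  shows "S \<in> F_dual \<theta>"
proof -
  have "wopen {f \<in> F_space \<theta>. S f \<in> V}" if V: "open V" for V
    unfolding wopen_def
  proof (intro conjI ballI)
    fix f assume f: "f \<in> {f \<in> F_space \<theta>. S f \<in> V}"
    then obtain e where e: "e > 0" "ball (S f) e \<subseteq> V" using V openE by blast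
    define d where "d = e / (\<bar>C\<bar> + 1)"
    have d: "0 < d" using e by (simp add: d_def)
    have "S g \<in> V" if g: "g \<in> F_space \<theta>" "wnorm q (\<lambda>z. g z - f z) < d" for g
    proof -
      have D: "(\<lambda>z. g z - f z) \<in> F_space \<theta>" using F_diff f g by auto
      have w: "0 \<le> wnorm q (\<lambda>z. g z - f z)" using wnorm_nonneg F_wsummable[OF D] bound by simp
      have "S g = S (\<lambda>z. (g z - f z) + f z)" by simp
      also have "\<dots> = S (\<lambda>z. g z - f z) + S f" by (rule add[OF D]) (use f in auto)
      finally have "cmod (S g - S f) \<le> C * wnorm q (\<lambda>z. g z - f z)" using bound(2)[OF D] by simp
      also have "\<dots> \<le> (\<bar>C\<bar> + 1) * wnorm q (\<lambda>z. g z - f z)" using w by (intro mult_right_mono) auto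
      also have "\<dots> < (\<bar>C\<bar> + 1) * d" using g(2) by (intro mult_strict_left_mono) auto
      also have "\<dots> = e" by (simp add: d_def)
      finally show ?thesis using e by (auto simp: dist_norm norm_minus_commute)
    qed
    then show "\<exists>q>0. \<exists>e>0. \<forall>g\<in>F_space \<theta>. wnorm q (\<lambda>z. g z - f z) < e \<longrightarrow> g \<in> {f \<in> F_space \<theta>. S f \<in> V}"
      using d bound(1) by (intro exI[of _ q] conjI exI[of _ d]) auto
  qed auto
  then show ?thesis
    using assms(1) add cmult by (auto simp: F_dual_def continuous_map openin_F_top_iff topspace_F_top)
qed

end

section \<open>Duality and convolution\<close>

text \<open>Absolutely convergent rows with summable row sums are transferred to unordered summation
  over pairs, where Fubini's theorem applies, and then back to series over the naturals.\<close>

lemma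
  fixes u :: "nat \<Rightarrow> nat \<Rightarrow> 'a::banach"
  assumes "\<And>k. summable (\<lambda>i. norm (u k i))" "summable (\<lambda>k. \<Sum>i. norm (u k i))"
  shows double_series_summable: "summable (\<lambda>k. norm (u k i))"
    and double_series_swap: "(\<lambda>i. \<Sum>k. u k i) sums (\<Sum>k. \<Sum>i. u k i)"
proof -
  have eqs: "(\<Sum>\<^sub>\<infinity>i. norm (u k i)) = (\<Sum>i. norm (u k i))" for k
    using assms(1)[of k] by (intro infsumI norm_summable_imp_has_sum) (auto intro: summable_sums)
  have 1: "(\<lambda>x. norm (case x of (k, i) \<Rightarrow> u k i)) summable_on (UNIV \<times> UNIV)"
    using assms eqs
    by (intro Infinite_Sum.abs_summable_on_Sigma_iff[where f = "\<lambda>(k, i). u k i" and A = UNIV and B = "\<lambda>_. UNIV", THEN iffD2]) (auto simp: summable_on_UNIV_nonneg_real_iff suminf_nonneg)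
  have 2: "(\<lambda>x. norm (case x of (i, k) \<Rightarrow> u k i)) summable_on (UNIV \<times> UNIV)"
    using 1 summable_on_swap[of "\<lambda>x. norm (case x of (k, i) \<Rightarrow> u k i)" UNIV UNIV]
    by (simp add: case_prod_unfold)
  then have cols: "(\<lambda>k. norm (u k i)) summable_on UNIV" for i
    using Infinite_Sum.abs_summable_on_Sigma_iff[where f = "\<lambda>(i, k). u k i" and A = UNIV and B = "\<lambda>_. UNIV"] by auto
  show c: "summable (\<lambda>k. norm (u k i))" for i
    using cols[of i] by (auto intro: summable_on_imp_summable)
  have rows: "summable (\<lambda>k. norm (\<Sum>i. u k i))"
    by (rule summable_comparison_test'[OF assms(2)]) (use assms(1) in \<open>auto intro: summable_norm\<close>)
  have row: "(\<Sum>\<^sub>\<infinity>i. u k i) = (\<Sum>i. u k i)" for k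
    using assms(1)[of k] by (intro infsumI norm_summable_imp_has_sum) (auto intro: summable_sums summable_norm_cancel)
  have col: "(\<Sum>\<^sub>\<infinity>k. u k i) = (\<Sum>k. u k i)" for i
    using c[of i] by (intro infsumI norm_summable_imp_has_sum) (auto intro: summable_sums summable_norm_cancel)
  have s: "(\<lambda>(k, i). u k i) summable_on UNIV \<times> UNIV" by (rule Infinite_Sum.abs_summable_summable[OF 1])
  have "(\<Sum>\<^sub>\<infinity>k. \<Sum>i. u k i) = (\<Sum>\<^sub>\<infinity>i. \<Sum>k. u k i)"
    using infsum_swap_banach[OF s] by (simp add: row col)
  moreover have "(\<Sum>\<^sub>\<infinity>k. \<Sum>i. u k i) = (\<Sum>k. \<Sum>i. u k i)"
    using rows by (intro infsumI norm_summable_imp_has_sum) (auto intro: summable_sums summable_norm_cancel)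
  moreover have "(\<lambda>i. \<Sum>k. u k i) summable_on UNIV"
    using summable_on_Sigma_banach[OF Infinite_Sum.abs_summable_summable[OF 2]] by (simp add: col)
  ultimately show "(\<lambda>i. \<Sum>k. u k i) sums (\<Sum>k. \<Sum>i. u k i)"
    by (metis has_sum_imp_sums has_sum_infsum)
qed

text \<open>The bracket of the s-th derivative of f with the functional of transform g, because the
  jet of the derivative is the shifted jet. For s = 0 it is the duality bracket itself.\<close>

definition shift_pair :: "(complex \<Rightarrow> complex) \<Rightarrow> (complex \<Rightarrow> complex) \<Rightarrow> nat \<Rightarrow> complex" where
  "shift_pair g f s = (\<Sum>i. jet g i / fact i * jet f (i + s))"

abbreviation pair :: "(complex \<Rightarrow> complex) \<Rightarrow> (complex \<Rightarrow> complex) \<Rightarrow> complex" where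
  "pair g f \<equiv> shift_pair g f 0"

lemma jet_power: "jet (\<lambda>z. z ^ i) j = (if j = i then fact i else 0)"
proof (rule jet_eqI)
  fix z :: complex
  show "(\<lambda>j. (if j = i then fact i else 0) / fact j * z ^ j) sums z ^ i"
    using sums_single[of i "\<lambda>j. z ^ j"] by (rule sums_cong[THEN iffD1, rotated]) auto
qed

lemma jet_exp: "jet (\<lambda>z. exp (\<xi> * z)) j = \<xi> ^ j"
  by (rule jet_eqI) (use exp_converges[of "\<xi> * _"] in \<open>simp add: scaleR_conv_of_real field_simps power_mult_distrib\<close>)

lemma jet_zero: "jet (\<lambda>z. 0) j = 0"
  by (rule jet_eqI[of "\<lambda>j. 0"]) auto

lemma jet_translate:
  assumes "f holomorphic_on UNIV"
  shows "(\<lambda>j. jet f (i + j) / fact j * z ^ j) sums jet (\<lambda>w. f (w + z)) i"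
proof -
  have "(deriv ^^ i) f holomorphic_on UNIV" using assms by (intro holomorphic_higher_deriv) auto
  from jet_sums[OF this, of z] have "(\<lambda>j. jet f (i + j) / fact j * z ^ j) sums (deriv ^^ i) f z"
    by (simp add: jet_def add.commute flip: funpow_add[unfolded comp_def, THEN fun_cong])
  also have "(deriv ^^ i) f z = jet (\<lambda>w. f (w + z)) i"
    unfolding jet_def by (subst higher_deriv_shift_0) (simp add: comp_def add.commute)
  finally show ?thesis .
qed

context growth_weight
begin

lemma F_power: "(\<lambda>z. z ^ i) \<in> F_space \<theta>"
  and wnorm_power: "wnorm q (\<lambda>z. z ^ i) = fact i * q ^ i / peak i"
proof -
  have s: "(\<lambda>j. if j = i then fact i * q ^ j / peak j else 0) sums (fact i * q ^ i / peak i)" for q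
    by (rule sums_single)
  have e: "cmod (jet (\<lambda>z. z ^ i) j) * q ^ j / peak j = (if j = i then fact i * q ^ j / peak j else 0)" for j q
    by (simp add: jet_power)
  show "(\<lambda>z. z ^ i) \<in> F_space \<theta>"
    unfolding F_space_iff wsummable_def e using s by (auto intro!: holomorphic_intros simp: sums_iff)
  show "wnorm q (\<lambda>z. z ^ i) = fact i * q ^ i / peak i"
    unfolding wnorm_def e using s by (simp add: sums_iff)
qed

lemma F_exp: "(\<lambda>z. exp (\<xi> * z)) \<in> F_space \<theta>"
proof -
  have "wsummable q (\<lambda>z. exp (\<xi> * z))" if "0 < q" for q
    using peak_series_summable[of "cmod \<xi> * q"] that
    by (simp add: wsummable_def jet_exp norm_power power_mult_distrib)
  then show ?thesis by (auto simp: F_space_iff intro!: holomorphic_intros)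
qed

lemma dual_sum:
  assumes "S \<in> F_dual \<theta>" "finite A" "\<And>i. i \<in> A \<Longrightarrow> f i \<in> F_space \<theta>"
  shows "S (\<lambda>z. \<Sum>i\<in>A. f i z) = (\<Sum>i\<in>A. S (f i))"
  using assms(2,3)
proof (induction A)
  case empty
  then show ?case using dual_cmult[OF assms(1) F_zero, of 0] by simp
next
  case (insert i A)
  then show ?case using dual_add[OF assms(1) _ F_sum[of A f]] by simp
qed

lemma wnorm_taylor_tail:
  assumes "f \<in> F_space \<theta>" "0 < q"
  shows "(\<lambda>n. wnorm q (\<lambda>z. f z - (\<Sum>i<n. jet f i / fact i * z ^ i))) \<longlonglongrightarrow> 0"
proof -
  define a where "a = (\<lambda>j. cmod (jet f j) * q ^ j / peak j)"
  have a: "summable a" using F_wsummable[OF assms] by (simp add: a_def wsummable_def)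
  have hol: "f holomorphic_on UNIV" by (rule F_entire[OF assms(1)])
  have jt: "jet (\<lambda>z. f z - (\<Sum>i<n. jet f i / fact i * z ^ i)) j = (if j < n then 0 else jet f j)" for n j
  proof -
    have "jet (\<lambda>z. \<Sum>i<n. jet f i / fact i * z ^ i) j = (\<Sum>i<n. jet f i / fact i * (if j = i then fact i else 0))"
    proof (subst jet_sum)
      show "(\<Sum>i<n. jet (\<lambda>z. jet f i / fact i * z ^ i) j)
          = (\<Sum>i<n. jet f i / fact i * (if j = i then fact i else 0))"
        by (intro sum.cong refl, subst jet_cmult) (auto intro!: holomorphic_intros simp: jet_power)
    qed (auto intro!: holomorphic_intros)
    also have "\<dots> = (\<Sum>i<n. if i = j then jet f i else 0)" by (intro sum.cong) auto
    also have "\<dots> = (if j < n then jet f j else 0)" by simp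
    finally show ?thesis by (subst jet_diff) (use hol in \<open>auto intro!: holomorphic_intros\<close>)
  qed
  have "wnorm q (\<lambda>z. f z - (\<Sum>i<n. jet f i / fact i * z ^ i)) = suminf a - sum a {..<n}" for n
  proof -
    have "(\<lambda>j. a j - (if j \<in> {..<n} then a j else 0)) sums (suminf a - sum a {..<n})"
      by (intro sums_diff summable_sums a sums_If_finite_set) auto
    moreover have "(\<lambda>j. a j - (if j \<in> {..<n} then a j else 0))
        = (\<lambda>j. cmod (jet (\<lambda>z. f z - (\<Sum>i<n. jet f i / fact i * z ^ i)) j) * q ^ j / peak j)"
      by (rule ext) (simp only: jt, simp add: a_def)
    ultimately show ?thesis by (simp add: wnorm_def sums_iff)
  qed
  moreover have "(\<lambda>n. suminf a - sum a {..<n}) \<longlonglongrightarrow> suminf a - suminf a"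
    by (intro tendsto_intros summable_LIMSEQ a)
  ultimately show ?thesis by simp
qed

text \<open>The Taylor polynomials of f converge to f in every \<open>wnorm q\<close>, so a
  continuous functional is determined by its values on monomials.\<close>

lemma dual_sums_jet:
  assumes S: "S \<in> F_dual \<theta>" and f: "f \<in> F_space \<theta>"
  shows "(\<lambda>i. S (\<lambda>z. z ^ i) / fact i * jet f i) sums S f"
proof -
  obtain C q where Cq: "0 < C" "0 < q" "\<And>f. f \<in> F_space \<theta> \<Longrightarrow> cmod (S f) \<le> C * wnorm q f"
    using dual_bound[OF S] by blast
  define p where "p = (\<lambda>n z. \<Sum>i<n. jet f i / fact i * z ^ i)"
  have pF: "p n \<in> F_space \<theta>" for n unfolding p_def by (intro F_sum F_cmult F_power) auto
  have Sp: "S (p n) = (\<Sum>i<n. S (\<lambda>z. z ^ i) / fact i * jet f i)" for n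
  proof -
    have "S (p n) = (\<Sum>i<n. S (\<lambda>z. jet f i / fact i * z ^ i))"
      unfolding p_def by (rule dual_sum[OF S]) (simp, rule F_cmult[OF F_power])
    also have "\<dots> = (\<Sum>i<n. S (\<lambda>z. z ^ i) / fact i * jet f i)"
      by (rule sum.cong[OF refl], subst dual_cmult[OF S F_power]) simp
    finally show ?thesis .
  qed
  have "cmod (S (p n) - S f) \<le> C * wnorm q (\<lambda>z. f z - p n z)" for n
  proof -
    have "S f = S (\<lambda>z. (f z - p n z) + p n z)" by simp
    also have "\<dots> = S (\<lambda>z. f z - p n z) + S (p n)" by (rule dual_add[OF S F_diff[OF f pF] pF])
    finally show ?thesis using Cq(3)[OF F_diff[OF f pF]] by (simp add: norm_minus_commute)
  qed
  moreover have "(\<lambda>n. C * wnorm q (\<lambda>z. f z - p n z)) \<longlonglongrightarrow> 0"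
    using tendsto_mult_right_zero[OF wnorm_taylor_tail[OF f Cq(2)]] by (simp add: p_def)
  ultimately have "(\<lambda>n. S (p n) - S f) \<longlonglongrightarrow> 0" by (rule Lim_null_comparison[OF always_eventually, OF allI])
  then have "(\<lambda>n. S (p n)) \<longlonglongrightarrow> S f" by (rule LIM_zero_cancel)
  then show ?thesis by (simp add: sums_def Sp)
qed

lemma
  assumes "S \<in> F_dual \<theta>"
  shows entire_fourier_borel: "fourier_borel S holomorphic_on UNIV"
    and jet_fourier_borel: "jet (fourier_borel S) i = S (\<lambda>z. z ^ i)"
proof -
  have s: "(\<lambda>i. S (\<lambda>z. z ^ i) / fact i * \<xi> ^ i) sums fourier_borel S \<xi>" for \<xi>
    using dual_sums_jet[OF assms F_exp] by (simp add: fourier_borel_def jet_exp)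
  from entire_if_jet_sums[OF s] show "fourier_borel S holomorphic_on UNIV" .
  from jet_eqI[OF s] show "jet (fourier_borel S) i = S (\<lambda>z. z ^ i)" .
qed

lemma dual_eq_pair:
  assumes "S \<in> F_dual \<theta>" "f \<in> F_space \<theta>" shows "S f = pair (fourier_borel S) f"
  using dual_sums_jet[OF assms] by (simp add: shift_pair_def jet_fourier_borel[OF assms(1)] sums_iff)

text \<open>Both constants stay visible: in \<open>key_estimate\<close> the decay sits entirely in
  B, while p must not depend on the radius.\<close>

definition coeff_growth :: "real \<Rightarrow> real \<Rightarrow> (complex \<Rightarrow> complex) \<Rightarrow> bool" where
  "coeff_growth B p g \<longleftrightarrow> g holomorphic_on UNIV \<and> 0 \<le> B \<and> 0 < p \<and>
     (\<forall>i. cmod (jet g i / fact i) \<le> B * p ^ i / peak i)"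

lemma coeff_growth_fourier_borel:
  assumes "S \<in> F_dual \<theta>" obtains B p where "coeff_growth B p (fourier_borel S)"
proof -
  obtain C q where Cq: "0 < C" "0 < q" "\<And>f. f \<in> F_space \<theta> \<Longrightarrow> cmod (S f) \<le> C * wnorm q f"
    using dual_bound[OF assms] by blast
  have "cmod (jet (fourier_borel S) i / fact i) \<le> C * q ^ i / peak i" for i
    using Cq(3)[OF F_power[of i]]
    by (simp add: jet_fourier_borel[OF assms] wnorm_power norm_divide field_simps)
  then show ?thesis using that[of C q] Cq entire_fourier_borel[OF assms] by (auto simp: coeff_growth_def)
qed

text \<open>Cauchy's estimate on the circle of radius t / p, with t the point where
  \<open>peak i\<close> is attained, keeps B and p unchanged.\<close>

lemma coeff_growth_if_le:
  assumes "g holomorphic_on UNIV" "0 < p" "\<And>\<xi>. cmod (g \<xi>) \<le> B * exp (\<theta> (p * cmod \<xi>))"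
  shows "coeff_growth B p g"
proof -
  have B: "0 \<le> B" using order_trans[OF norm_ge_zero assms(3)[of 0]] by simp
  have "cmod (jet g i / fact i) \<le> B * p ^ i / peak i" for i
  proof (cases "i = 0")
    case True
    then show ?thesis using assms(3)[of 0] by (simp add: peak_0 jet_def)
  next
    case False
    then obtain t where t: "0 < t" "peak i = t ^ i * exp (- \<theta> t)" using peak_attained[of i] by auto
    have "cmod (jet g i) \<le> fact i * (B * exp (\<theta> t)) / (t / p) ^ i"
    proof (rule jet_le_Cauchy[OF assms(1)])
      fix z :: complex assume "cmod z = t / p"
      then show "cmod (g z) \<le> B * exp (\<theta> t)" using assms(3)[of z] assms(2) by simp
    qed (use t assms in auto)
    also have "\<dots> = fact i * (B * p ^ i / peak i)"
      using t by (simp add: power_divide exp_minus field_simps)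
    finally show ?thesis by (simp add: norm_divide field_simps)
  qed
  then show ?thesis using B assms by (auto simp: coeff_growth_def)
qed

text \<open>Summing the coefficient bounds costs a doubling of p, by \<open>peak_series_le\<close>;
  up to constants the two forms of growth therefore agree.\<close>

lemma coeff_growth_norm_le:
  assumes "coeff_growth B p g"
  shows "cmod (g \<xi>) \<le> 2 * B * exp (\<theta> (2 * p * cmod \<xi>))"
proof -
  have hol: "g holomorphic_on UNIV" and p: "0 < p" and B: "0 \<le> B" using assms by (auto simp: coeff_growth_def)
  have x: "0 \<le> p * cmod \<xi>" using p by simp
  have le: "cmod (jet g i / fact i * \<xi> ^ i) \<le> B * ((p * cmod \<xi>) ^ i / peak i)" for i
  proof -
    have "cmod (jet g i / fact i) * cmod \<xi> ^ i \<le> B * p ^ i / peak i * cmod \<xi> ^ i"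
      using assms by (intro mult_right_mono) (auto simp: coeff_growth_def)
    then show ?thesis by (simp add: norm_mult norm_divide norm_power power_mult_distrib)
  qed
  have "g \<xi> = (\<Sum>i. jet g i / fact i * \<xi> ^ i)" using jet_sums[OF hol, of \<xi>] by (simp add: sums_iff)
  also have "cmod \<dots> \<le> (\<Sum>i. B * ((p * cmod \<xi>) ^ i / peak i))"
    by (rule norm_suminf_le[OF le]) (intro summable_mult peak_series_summable[OF x])
  also have "\<dots> = B * (\<Sum>i. (p * cmod \<xi>) ^ i / peak i)" by (rule suminf_mult[OF peak_series_summable[OF x]])
  also have "\<dots> \<le> B * (2 * exp (\<theta> (2 * (p * cmod \<xi>))))" by (intro mult_left_mono peak_series_le x B)
  finally show ?thesis by (simp add: mult_ac)
qed

text \<open>The coefficient bound and \<open>wnorm p\<close> are dual to each other, like weighted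
  spaces of bounded and of summable sequences with reciprocal weights.\<close>

lemma
  assumes g: "coeff_growth B p g" and f: "f \<in> F_space \<theta>"
  shows pair_summable: "summable (\<lambda>i. jet g i / fact i * jet f i)"
    and pair_le: "cmod (pair g f) \<le> B * wnorm p f"
proof -
  have p: "0 < p" and B: "0 \<le> B" using g by (auto simp: coeff_growth_def)
  have le: "norm (jet g i / fact i * jet f i) \<le> B * (cmod (jet f i) * p ^ i / peak i)" for i
  proof -
    have "cmod (jet g i / fact i) * cmod (jet f i) \<le> B * p ^ i / peak i * cmod (jet f i)"
      using g by (intro mult_right_mono) (auto simp: coeff_growth_def)
    then show ?thesis by (simp add: norm_mult norm_divide mult_ac)
  qed
  have s: "summable (\<lambda>i. B * (cmod (jet f i) * p ^ i / peak i))"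
    using F_wsummable[OF f p] by (intro summable_mult) (simp add: wsummable_def)
  show "summable (\<lambda>i. jet g i / fact i * jet f i)" using summable_comparison_test'[OF s le] by simp
  have "cmod (pair g f) \<le> (\<Sum>i. B * (cmod (jet f i) * p ^ i / peak i))"
    unfolding shift_pair_def by (simp only: add_0_right) (rule norm_suminf_le[OF le s])
  also have "\<dots> = B * wnorm p f"
    unfolding wnorm_def using F_wsummable[OF f p] by (intro suminf_mult) (simp add: wsummable_def)
  finally show "cmod (pair g f) \<le> B * wnorm p f" .
qed

section \<open>Translations and the Taylor expansion of a convolution\<close>

lemma translate_jet_summable:
  assumes f: "f \<in> F_space \<theta>" and Q: "0 < Q" "4 * cmod z \<le> Q"
  shows "summable (\<lambda>j. cmod (jet f (i + j) / fact j * z ^ j))"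
    and "(\<Sum>j. cmod (jet f (i + j) / fact j * z ^ j)) \<le> (2 / Q) ^ i * peak i * (2 * exp offset * wnorm Q f)"
proof -
  define W where "W = exp offset * wnorm Q f"
  have W: "0 \<le> W" using wnorm_nonneg[OF _ F_wsummable[OF f Q(1)]] Q by (simp add: W_def)
  \<comment> \<open>\<open>peak_add\<close> produces 2^(i+j) and j!; the factorial cancels the one
    of the Taylor expansion, and \<open>4 * cmod z \<le> Q\<close> leaves the ratio 1/2 in
    j.\<close>
  have le: "cmod (jet f (i + j) / fact j * z ^ j) \<le> (2 / Q) ^ i * peak i * W * (1/2) ^ j" for j
  proof -
    have "cmod (jet f (i + j)) \<le> wnorm Q f * peak (i + j) / Q ^ (i + j)"
      by (rule jet_le_wnorm[OF Q(1) F_wsummable[OF f Q(1)]])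
    also have "\<dots> \<le> wnorm Q f * (exp offset * 2 ^ (i + j) * peak i * fact j) / Q ^ (i + j)"
      using wnorm_nonneg[OF _ F_wsummable[OF f Q(1)]] Q
      by (intro divide_right_mono mult_left_mono peak_add) auto
    also have "\<dots> = W * (2 / Q) ^ i * (2 / Q) ^ j * peak i * fact j"
      by (simp add: W_def power_add power_divide)
    finally have "cmod (jet f (i + j)) * (cmod z ^ j / fact j)
        \<le> W * (2 / Q) ^ i * (2 / Q) ^ j * peak i * fact j * (cmod z ^ j / fact j)"
      by (intro mult_right_mono) auto
    also have "\<dots> = (2 / Q) ^ i * peak i * W * (2 * cmod z / Q) ^ j"
      by (simp add: power_mult_distrib power_divide)
    also have "\<dots> \<le> (2 / Q) ^ i * peak i * W * (1/2) ^ j"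
      using Q W by (intro mult_left_mono power_mono) (auto simp: field_simps)
    finally show ?thesis by (simp add: norm_mult norm_divide norm_power)
  qed
  have g: "(\<lambda>j. (2 / Q) ^ i * peak i * W * (1/2) ^ j) sums ((2 / Q) ^ i * peak i * W * 2)"
    using sums_mult[OF geometric_sums[of "1/2::real"], of "(2 / Q) ^ i * peak i * W"] by simp
  show s: "summable (\<lambda>j. cmod (jet f (i + j) / fact j * z ^ j))"
    by (rule summable_comparison_test'[OF sums_summable[OF g]]) (use le in auto)
  show "(\<Sum>j. cmod (jet f (i + j) / fact j * z ^ j)) \<le> (2 / Q) ^ i * peak i * (2 * exp offset * wnorm Q f)"
    using suminf_le[OF le s sums_summable[OF g]] g by (simp add: sums_iff W_def mult_ac)
qed

lemma F_translate:
  assumes f: "f \<in> F_space \<theta>" shows "(\<lambda>w. f (w + z)) \<in> F_space \<theta>"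
proof -
  have hol: "f holomorphic_on UNIV" by (rule F_entire[OF f])
  have "wsummable q (\<lambda>w. f (w + z))" if q: "0 < q" for q
  proof -
    define Q where "Q = 4 * max q (cmod z)"
    have Q: "0 < Q" "4 * cmod z \<le> Q" "4 * q \<le> Q" using q by (auto simp: Q_def)
    \<comment> \<open>The ratio 2 / Q is written as \<open>exp 1 / S\<close> with
      \<open>S = exp 1 * Q / 2\<close> to fit \<open>wnorm_le_if_jet_le\<close>, whose condition
      then reads 4 q \<le> Q.\<close>
    have "cmod (jet (\<lambda>w. f (w + z)) i) \<le> (exp 1 / (exp 1 * Q / 2)) ^ i * peak i * (2 * exp offset * wnorm Q f)" for i
    proof -
      have "cmod (jet (\<lambda>w. f (w + z)) i) \<le> (\<Sum>j. cmod (jet f (i + j) / fact j * z ^ j))"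
        using jet_translate[OF hol, of i z] summable_norm[OF translate_jet_summable(1)[OF f Q(1,2), of i]]
        by (simp add: sums_iff)
      also have "\<dots> \<le> (2 / Q) ^ i * peak i * (2 * exp offset * wnorm Q f)"
        by (rule translate_jet_summable(2)[OF f Q(1,2)])
      finally show ?thesis by simp
    qed
    from wnorm_le_if_jet_le(1)[OF _ _ _ this] show ?thesis using q Q by simp
  qed
  moreover have "(\<lambda>w. f (w + z)) holomorphic_on UNIV"
    by (rule holomorphic_on_compose_gen[OF _ hol, unfolded comp_def]) (auto intro!: holomorphic_intros)
  ultimately show ?thesis by (auto simp: F_space_iff)
qed

text \<open>Expanding the translate of f and interchanging the two sums shows that the derivatives
  of the convolution at 0 are the brackets of T with the derivatives of f. The equation is thus
  reduced to countably many scalar conditions.\<close>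

lemma conv_sums:
  assumes T: "T \<in> F_dual \<theta>" and f: "f \<in> F_space \<theta>"
  shows "(\<lambda>s. shift_pair (fourier_borel T) f s / fact s * z ^ s) sums conv T f z"
proof -
  let ?\<Phi> = "fourier_borel T"
  obtain B p where g: "coeff_growth B p ?\<Phi>" using coeff_growth_fourier_borel[OF T] .
  have p: "0 < p" and B: "0 \<le> B" using g by (auto simp: coeff_growth_def)
  define Q where "Q = 4 * max p (cmod z)"
  have Q: "0 < Q" "4 * cmod z \<le> Q" "4 * p \<le> Q" using p by (auto simp: Q_def)
  define W where "W = 2 * exp offset * wnorm Q f"
  have W: "0 \<le> W" using wnorm_nonneg[OF _ F_wsummable[OF f Q(1)]] Q by (simp add: W_def)
  define u where "u = (\<lambda>i s. jet ?\<Phi> i / fact i * (jet f (i + s) / fact s * z ^ s))"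
  have nu: "norm (u i s) = cmod (jet ?\<Phi> i / fact i) * cmod (jet f (i + s) / fact s * z ^ s)" for i s
    by (simp add: u_def norm_mult norm_divide)
  have s1: "summable (\<lambda>s. norm (u i s))" for i
    unfolding nu by (intro summable_mult translate_jet_summable(1)[OF f Q(1,2)])
  have row: "(\<Sum>s. norm (u i s)) \<le> B * W * (1/2) ^ i" for i
  proof -
    have "(\<Sum>s. norm (u i s)) = cmod (jet ?\<Phi> i / fact i) * (\<Sum>s. cmod (jet f (i + s) / fact s * z ^ s))"
      unfolding nu by (intro suminf_mult translate_jet_summable(1)[OF f Q(1,2)])
    also have "\<dots> \<le> (B * p ^ i / peak i) * ((2 / Q) ^ i * peak i * W)"
      using g translate_jet_summable[OF f Q(1,2)] B p unfolding W_def
      by (intro mult_mono suminf_nonneg) (auto simp: coeff_growth_def)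
    also have "\<dots> = B * W * (2 * p / Q) ^ i" by (simp add: power_divide power_mult_distrib)
    also have "\<dots> \<le> B * W * (1/2) ^ i"
      using B W p Q by (intro mult_left_mono power_mono) (auto simp: field_simps)
    finally show ?thesis .
  qed
  have geo: "summable (\<lambda>i. B * W * (1/2) ^ i)" by (intro summable_mult summable_geometric) auto
  have s2: "summable (\<lambda>i. \<Sum>s. norm (u i s))"
    by (rule summable_comparison_test'[OF geo, of 0]) (subst real_norm_def, subst abs_of_nonneg, rule suminf_nonneg[OF s1], simp, rule row)
  have "(\<lambda>s. \<Sum>i. u i s) sums (\<Sum>i. \<Sum>s. u i s)" by (rule double_series_swap[OF s1 s2])
  moreover have "(\<Sum>i. u i s) = shift_pair ?\<Phi> f s / fact s * z ^ s" for s
  proof -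
    \<comment> \<open>The inner series is known to converge only after multiplication by c. Dividing
      by c needs c \<noteq> 0; for c = 0, that is z = 0 and s > 0, both sides vanish.\<close>
    define c where "c = z ^ s / fact s"
    have u: "u i s = jet ?\<Phi> i / fact i * jet f (i + s) * c" for i by (simp add: u_def c_def)
    show ?thesis
    proof (cases "c = 0")
      case True
      have "shift_pair ?\<Phi> f s / fact s * z ^ s = shift_pair ?\<Phi> f s * c" by (simp add: c_def)
      then show ?thesis unfolding u by (simp only: True) simp
    next
      case False
      have "summable (\<lambda>i. u i s)"
        using double_series_summable[OF s1 s2, of s] by (rule summable_norm_cancel)
      then have "summable (\<lambda>i. jet ?\<Phi> i / fact i * jet f (i + s))"
        using False summable_divide[of "\<lambda>i. u i s" c] by (simp add: u)
      then have "(\<Sum>i. u i s) = shift_pair ?\<Phi> f s * c"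
        unfolding u shift_pair_def by (rule suminf_mult2[symmetric])
      then show ?thesis by (simp add: c_def)
    qed
  qed
  moreover have "(\<Sum>s. u i s) = jet ?\<Phi> i / fact i * jet (\<lambda>w. f (w + z)) i" for i
    using sums_mult[OF jet_translate[OF F_entire[OF f], of i z], of "jet ?\<Phi> i / fact i"]
    by (simp add: u_def sums_iff)
  moreover have "conv T f z = (\<Sum>i. jet ?\<Phi> i / fact i * jet (\<lambda>w. f (w + z)) i)"
    using dual_eq_pair[OF T F_translate[OF f]] by (simp add: conv_def shift_pair_def)
  ultimately show ?thesis by simp
qed

lemma conv_eq_0_iff:
  assumes T: "T \<in> F_dual \<theta>" and f: "f \<in> F_space \<theta>"
  shows "(\<forall>z. conv T f z = 0) \<longleftrightarrow> (\<forall>s. shift_pair (fourier_borel T) f s = 0)"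
proof
  assume "\<forall>z. conv T f z = 0"
  then show "\<forall>s. shift_pair (fourier_borel T) f s = 0"
    using jet_eqI[of "shift_pair (fourier_borel T) f" "\<lambda>z. 0"] conv_sums[OF T f] by (simp add: jet_zero)
next
  assume "\<forall>s. shift_pair (fourier_borel T) f s = 0"
  then show "\<forall>z. conv T f z = 0" using conv_sums[OF T f] by (simp add: sums_iff)
qed

text \<open>Surjectivity of the Fourier-Borel transform, with an explicit preimage. The restriction
  is due to the normalisation of functionals outside \<open>F_space \<theta>\<close>.\<close>

lemma pair_in_dual:
  assumes g: "coeff_growth B p g"
  shows "restrict (pair g) (F_space \<theta>) \<in> F_dual \<theta>"
    and "fourier_borel (restrict (pair g) (F_space \<theta>)) = g"
proof -
  have p: "0 < p" and hol: "g holomorphic_on UNIV" using g by (auto simp: coeff_growth_def)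
  have add: "pair g (\<lambda>z. f z + h z) = pair g f + pair g h" if "f \<in> F_space \<theta>" "h \<in> F_space \<theta>" for f h
    unfolding shift_pair_def
    using suminf_add[OF pair_summable[OF g that(1)] pair_summable[OF g that(2)]]
    by (simp add: jet_add[OF F_entire F_entire] that distrib_left)
  have cmult: "pair g (\<lambda>z. a * f z) = a * pair g f" if "f \<in> F_space \<theta>" for f a
    unfolding shift_pair_def
    using suminf_mult[OF pair_summable[OF g that], of a] by (simp add: jet_cmult[OF F_entire[OF that]] mult_ac)
  show "restrict (pair g) (F_space \<theta>) \<in> F_dual \<theta>"
    by (rule dualI[where q = p and C = B])
      (auto simp: add cmult F_add F_cmult p intro: pair_le[OF g])
  show "fourier_borel (restrict (pair g) (F_space \<theta>)) = g"
  proof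
    fix \<xi>
    show "fourier_borel (restrict (pair g) (F_space \<theta>)) \<xi> = g \<xi>"
      using jet_sums[OF hol, of \<xi>] by (simp add: fourier_borel_def F_exp shift_pair_def jet_exp sums_iff)
  qed
qed

lemma dual_eqI:
  assumes "S \<in> F_dual \<theta>" "S' \<in> F_dual \<theta>" "fourier_borel S = fourier_borel S'"
  shows "S = S'"
proof (rule extensionalityI[of _ "F_space \<theta>"])
  show "S f = S' f" if "f \<in> F_space \<theta>" for f
    using dual_eq_pair[OF assms(1) that] dual_eq_pair[OF assms(2) that] assms(3) by simp
qed (use assms in \<open>auto simp: F_dual_def\<close>)

end

section \<open>Cofactors without zeros\<close>

text \<open>Borel-Caratheodory: with $h = \ln (g / g(z_0))$ and $A = \ln (M / k)$, the Schwarz lemma applies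
  to $h / (2 A - h)$.\<close>

lemma zero_free_lower_bound:
  assumes hol: "g holomorphic_on ball z0 r" and r: "0 < r"
    and nz: "\<And>z. z \<in> ball z0 r \<Longrightarrow> g z \<noteq> 0"
    and up: "\<And>z. z \<in> ball z0 r \<Longrightarrow> cmod (g z) < M"
    and lo: "k \<le> cmod (g z0)" "0 < k" and z: "cmod (z - z0) \<le> r / 2"
  shows "k ^ 3 / M ^ 2 \<le> cmod (g z)"
proof -
  have z0: "z0 \<in> ball z0 r" using r by simp
  have g0: "g z0 \<noteq> 0" using nz[OF z0] .
  have kM: "k < M" using lo up[OF z0] by linarith
  obtain L where L: "L holomorphic_on ball z0 r" "\<And>z. z \<in> ball z0 r \<Longrightarrow> g z = exp (L z)"
    using simply_connected_eq_holomorphic_log[of "ball z0 r"] convex_imp_simply_connected[OF convex_ball]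
      hol nz by (metis open_ball)
  define h where "h = (\<lambda>z. L z - L z0)"
  define A where "A = ln (M / k)"
  have A: "0 < A" using kM lo by (simp add: A_def)
  have norm_g: "cmod (g z) = cmod (g z0) * exp (Re (h z))" if "z \<in> ball z0 r" for z
    using L(2)[OF that] L(2)[OF z0] by (simp add: h_def exp_diff)
  have Re: "Re (h z) < A" if "z \<in> ball z0 r" for z
  proof -
    have "cmod (g z0) * exp (Re (h z)) < M" using up[OF that] norm_g[OF that] by simp
    then have "exp (Re (h z)) < M / cmod (g z0)" using g0 by (simp add: field_simps)
    also have "\<dots> \<le> M / k" using lo kM by (intro divide_left_mono mult_pos_pos) auto
    also have "\<dots> = exp A" using lo kM by (simp add: A_def)
    finally show ?thesis by simp
  qed
  define f where "f = (\<lambda>w::complex. h (z0 + r * w) / (2 * A - h (z0 + r * w)))"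
  have inb: "z0 + r * w \<in> ball z0 r" if "cmod w < 1" for w :: complex
    using that r by (simp add: dist_norm norm_mult)
  have den: "2 * A - h (z0 + r * w) \<noteq> 0" if "cmod w < 1" for w :: complex
  proof
    assume "2 * A - h (z0 + r * w) = 0"
    then have "Re (2 * A - h (z0 + r * w)) = 0" by simp
    then show False using Re[OF inb[OF that]] A by simp
  qed
  have "(\<lambda>w. h (z0 + r * w)) holomorphic_on ball 0 1"
  proof -
    have "(h \<circ> (\<lambda>w. z0 + r * w)) holomorphic_on ball 0 1"
      by (rule holomorphic_on_compose_gen[where t = "ball z0 r"])
        (use L(1) inb in \<open>auto simp: h_def intro!: holomorphic_intros\<close>)
    then show ?thesis by (simp add: comp_def)
  qed
  then have "f holomorphic_on ball 0 1"
    unfolding f_def using den by (intro holomorphic_intros) auto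
  moreover have "f 0 = 0" by (simp add: f_def h_def)
  moreover have "cmod (f w) < 1" if w: "cmod w < 1" for w :: complex
  proof -
    let ?h = "h (z0 + r * w)"
    have "(cmod ?h)\<^sup>2 < (cmod (2 * A - ?h))\<^sup>2"
    proof -
      have "(cmod (2 * A - ?h))\<^sup>2 - (cmod ?h)\<^sup>2 = 4 * A * (A - Re ?h)"
        unfolding cmod_power2 by (simp add: power2_eq_square algebra_simps)
      also have "\<dots> > 0" using A Re[OF inb[OF w]] by simp
      finally show ?thesis by simp
    qed
    then have "cmod ?h < cmod (2 * A - ?h)" by (rule power2_less_imp_less) simp
    then show ?thesis using den[OF w] by (simp add: f_def norm_divide)
  qed
  moreover define w where "w = (z - z0) / r"
  have w: "cmod w \<le> 1/2" "z = z0 + r * w" using z r by (auto simp: w_def norm_divide field_simps)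
  ultimately have "cmod (f w) \<le> 1/2"
    using Schwarz_Lemma(1)[of f w] by force
  have w1: "cmod w < 1" using w by simp
  have zb: "z \<in> ball z0 r" using inb[OF w1] w by simp
  \<comment> \<open>Solving for h: |f| \<le> 1/2 gives |h| \<le> (2 A + |h|) / 2, hence |h| \<le> 2
    A, and k e^(-2 A) = k^3 / M^2.\<close>
  have hz: "h z = f w * (2 * A - h z)" using den[OF w1] w by (simp add: f_def)
  have "cmod (h z) = cmod (f w) * cmod (2 * A - h z)" using hz by (metis norm_mult)
  also have "\<dots> \<le> 1/2 * (cmod (2 * A) + cmod (h z))"
    using \<open>cmod (f w) \<le> 1/2\<close> by (intro mult_mono norm_triangle_ineq4) auto
  also have "cmod (2 * A) = 2 * A" using A by (simp add: norm_mult)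
  finally have "cmod (h z) \<le> 2 * A" by simp
  then have "- (2 * A) \<le> Re (h z)" using abs_Re_le_cmod[of "h z"] by linarith
  then have "k * exp (- (2 * A)) \<le> cmod (g z)"
    unfolding norm_g[OF zb] using lo by (intro mult_mono) auto
  moreover have "exp (- (2 * A)) = (k / M)\<^sup>2"
  proof -
    have "exp (- A) = k / M" using kM lo by (simp add: A_def exp_minus)
    moreover have "exp (- (2 * A)) = (exp (- A))\<^sup>2" by (simp flip: exp_double)
    ultimately show ?thesis by simp
  qed
  ultimately show ?thesis by (simp add: power2_eq_square power3_eq_cube)
qed

text \<open>Here $N$ collects $n$ zeros of $\Phi$, all of modulus at most $a$.\<close>

lemma
  fixes n :: nat
  assumes G: "G holomorphic_on UNIV" and fac: "\<And>\<xi>. \<Phi> \<xi> = N \<xi> * G \<xi>"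
    and N_lower: "\<And>\<xi>. a \<le> cmod \<xi> \<Longrightarrow> (cmod \<xi> - a) ^ n \<le> cmod (N \<xi>)"
    and N_upper: "\<And>\<xi>. cmod (N \<xi>) \<le> (cmod \<xi> + a) ^ n"
    and a: "0 \<le> a" and M: "\<And>\<xi>. cmod \<xi> \<le> 3 * a + 2 \<Longrightarrow> cmod (\<Phi> \<xi>) \<le> M"
    and z0: "cmod z0 \<le> 1" "\<Phi> z0 \<noteq> 0"
  shows cofactor_count: "cmod (\<Phi> z0) * 2 ^ n \<le> M"
    and cofactor_lower: "\<lbrakk>6 \<le> a; \<And>\<xi>. cmod \<xi> < a \<Longrightarrow> G \<xi> \<noteq> 0; cmod \<xi> \<le> a / 4\<rbrakk>
      \<Longrightarrow> cmod (\<Phi> z0) ^ 3 / (2 * M) ^ 2 \<le> cmod (G \<xi>) * (a + 1) ^ n"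
proof -
  have pos: "0 < (2 * (a + 1)) ^ n" using a by simp
  \<comment> \<open>On the circle of radius 3 a + 2 the modulus of N is at least (2 (a + 1))^n,
    whereas at z0 it is at most (a + 1)^n. The surplus 2^n bounds the number of zeros.\<close>
  have U: "cmod (G \<xi>) \<le> M / (2 * (a + 1)) ^ n" if "cmod \<xi> \<le> 3 * a + 2" for \<xi>
  proof (rule maximum_modulus_frontier[of G "cball 0 (3 * a + 2)"])
    fix w :: complex assume "w \<in> frontier (cball 0 (3 * a + 2))"
    then have w: "cmod w = 3 * a + 2" using a by (simp add: frontier_cball)
    have "cmod (G w) * (2 * (a + 1)) ^ n \<le> cmod (G w) * cmod (N w)"
      using N_lower[of w] w a by (intro mult_left_mono) (auto simp: algebra_simps)
    also have "\<dots> = cmod (\<Phi> w)" by (simp add: fac norm_mult)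
    also have "\<dots> \<le> M" using M[of w] w by simp
    finally show "cmod (G w) \<le> M / (2 * (a + 1)) ^ n" using pos by (simp add: field_simps)
  qed (use G that in \<open>auto intro: holomorphic_on_subset holomorphic_on_imp_continuous_on\<close>)
  have up: "cmod (G \<xi>) * (a + 1) ^ n * 2 ^ n \<le> M" if "cmod \<xi> \<le> 3 * a + 2" for \<xi>
    using U[OF that] pos by (simp only: pos_le_divide_eq power_mult_distrib mult_ac)
  have base: "cmod (\<Phi> z0) \<le> cmod (G z0) * (a + 1) ^ n"
  proof -
    have "cmod (N z0) \<le> (a + 1) ^ n"
      by (rule order_trans[OF N_upper power_mono]) (use z0 a in auto)
    then show ?thesis by (simp add: fac norm_mult mult.commute mult_left_mono)
  qed
  show "cmod (\<Phi> z0) * 2 ^ n \<le> M"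
    by (rule order_trans[OF mult_right_mono[OF base] up]) (use z0 a in auto)
  show "cmod (\<Phi> z0) ^ 3 / (2 * M) ^ 2 \<le> cmod (G \<xi>) * (a + 1) ^ n"
    if a6: "6 \<le> a" and nz: "\<And>\<xi>. cmod \<xi> < a \<Longrightarrow> G \<xi> \<noteq> 0" and \<xi>: "cmod \<xi> \<le> a / 4"
  proof -
    have M0: "0 < M" using M[of z0] z0 a by (smt (verit) zero_less_norm_iff)
    define g where "g = (\<lambda>\<xi>. complex_of_real ((a + 1) ^ n) * G \<xi>)"
    have ng: "cmod (g \<xi>) = cmod (G \<xi>) * (a + 1) ^ n" for \<xi>
      using a by (simp add: g_def norm_mult norm_power)
    have sub: "cmod w < a" if "w \<in> ball z0 (a - 1)" for w
      using that z0 norm_triangle_sub[of w z0] by (simp add: dist_norm norm_minus_commute)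
    \<comment> \<open>The ball around z0 of radius a - 1 lies in the zero-free disc, and the
      concentric ball of half the radius still contains |\<xi>| \<le> a / 4, because a / 4 + 1 \<le>
      (a - 1) / 2 for a \<ge> 6. The bound 2 M in place of M supplies strictness.\<close>
    have "cmod (\<Phi> z0) ^ 3 / (2 * M) ^ 2 \<le> cmod (g \<xi>)"
    proof (rule zero_free_lower_bound[where g = g and z = \<xi> and z0 = z0 and r = "a - 1" and M = "2 * M"])
      show "g holomorphic_on ball z0 (a - 1)"
        unfolding g_def by (intro holomorphic_intros holomorphic_on_subset[OF G]) auto
      show "g w \<noteq> 0" if "w \<in> ball z0 (a - 1)" for w
      proof -
        have "0 < (a + 1) ^ n" using a by simp
        then have "0 < cmod (g w)" using nz[OF sub[OF that]] unfolding ng by (intro mult_pos_pos) auto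
        then show ?thesis by simp
      qed
      show "cmod (g w) < 2 * M" if "w \<in> ball z0 (a - 1)" for w
      proof -
        have "cmod (g w) * 1 \<le> cmod (g w) * 2 ^ n" by (intro mult_left_mono) auto
        also have "\<dots> \<le> M" using up[of w] sub[OF that] a by (simp add: ng)
        finally show ?thesis using M0 by simp
      qed
      show "cmod (\<Phi> z0) \<le> cmod (g z0)" using base by (simp add: ng)
      show "cmod (\<xi> - z0) \<le> (a - 1) / 2"
        using \<xi> z0 a6 norm_triangle_ineq4[of \<xi> z0] by simp
    qed (use a6 z0 in auto)
    then show ?thesis by (simp add: ng)
  qed
qed

context growth_weight
begin

section \<open>The algebra of Fourier-Borel transforms and the linearity of the pairing\<close>

definition gclass :: "(complex \<Rightarrow> complex) \<Rightarrow> bool" where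
  "gclass g \<longleftrightarrow> (\<exists>B p. coeff_growth B p g)"

lemma gclass_entire: "gclass g \<Longrightarrow> g holomorphic_on UNIV"
  by (auto simp: gclass_def coeff_growth_def)

lemma gclassI:
  assumes "g holomorphic_on UNIV" "\<And>\<xi>. cmod (g \<xi>) \<le> B * exp (\<theta> (p * cmod \<xi>))" "0 < p"
  shows "gclass g"
  using coeff_growth_if_le[OF assms(1,3,2)] by (auto simp: gclass_def)

lemma gclassE:
  assumes "gclass g"
  obtains B p where "0 < B" "0 < p" "\<And>\<xi>. cmod (g \<xi>) \<le> B * exp (\<theta> (p * cmod \<xi>))"
proof -
  obtain B p where g: "coeff_growth B p g" using assms by (auto simp: gclass_def)
  have "cmod (g \<xi>) \<le> (2 * B + 1) * exp (\<theta> (2 * p * cmod \<xi>))" for \<xi>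
    by (rule order_trans[OF coeff_growth_norm_le[OF g] mult_right_mono]) auto
  then show ?thesis using that[of "2 * B + 1" "2 * p"] g by (auto simp: coeff_growth_def)
qed

lemma gclass_add:
  assumes "gclass g" "gclass h" shows "gclass (\<lambda>\<xi>. g \<xi> + h \<xi>)"
proof -
  obtain B p where g: "0 < B" "0 < p" "\<And>\<xi>. cmod (g \<xi>) \<le> B * exp (\<theta> (p * cmod \<xi>))"
    using gclassE[OF assms(1)] by blast
  obtain C q where h: "0 < C" "0 < q" "\<And>\<xi>. cmod (h \<xi>) \<le> C * exp (\<theta> (q * cmod \<xi>))"
    using gclassE[OF assms(2)] by blast
  show ?thesis
  proof (rule gclassI[where B = "B + C" and p = "max p q"])
    fix \<xi>
    have "cmod (g \<xi> + h \<xi>) \<le> cmod (g \<xi>) + cmod (h \<xi>)" by (rule norm_triangle_ineq)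
    also have "\<dots> \<le> B * exp (\<theta> (max p q * cmod \<xi>)) + C * exp (\<theta> (max p q * cmod \<xi>))"
      using g h by (intro add_mono order_trans[OF g(3)] order_trans[OF h(3)] mult_left_mono)
        (auto intro!: theta_mono mult_right_mono)
    finally show "cmod (g \<xi> + h \<xi>) \<le> (B + C) * exp (\<theta> (max p q * cmod \<xi>))" by (simp add: distrib_right)
  qed (use g h gclass_entire[OF assms(1)] gclass_entire[OF assms(2)] in \<open>auto intro!: holomorphic_intros\<close>)
qed

lemma gclass_mult:
  assumes "gclass g" "gclass h" shows "gclass (\<lambda>\<xi>. g \<xi> * h \<xi>)"
proof -
  obtain B p where g: "0 < B" "0 < p" "\<And>\<xi>. cmod (g \<xi>) \<le> B * exp (\<theta> (p * cmod \<xi>))"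
    using gclassE[OF assms(1)] by blast
  obtain C q where h: "0 < C" "0 < q" "\<And>\<xi>. cmod (h \<xi>) \<le> C * exp (\<theta> (q * cmod \<xi>))"
    using gclassE[OF assms(2)] by blast
  show ?thesis
  proof (rule gclassI[where B = "B * C" and p = "p + q"])
    fix \<xi>
    have "cmod (g \<xi> * h \<xi>) \<le> (B * exp (\<theta> (p * cmod \<xi>))) * (C * exp (\<theta> (q * cmod \<xi>)))"
      unfolding norm_mult using g h by (intro mult_mono) auto
    also have "\<dots> = B * C * exp (\<theta> (p * cmod \<xi>) + \<theta> (q * cmod \<xi>))" by (simp add: exp_add)
    also have "\<dots> \<le> B * C * exp (\<theta> ((p + q) * cmod \<xi>))"
      using g h theta_superadd[of "p * cmod \<xi>" "q * cmod \<xi>"]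
      by (intro mult_left_mono) (auto simp: distrib_right)
    finally show "cmod (g \<xi> * h \<xi>) \<le> B * C * exp (\<theta> ((p + q) * cmod \<xi>))" .
  qed (use g h gclass_entire[OF assms(1)] gclass_entire[OF assms(2)] in \<open>auto intro!: holomorphic_intros\<close>)
qed

lemma gclass_const: "gclass (\<lambda>\<xi>. c)"
  by (rule gclassI[where B = "cmod c" and p = 1]) (auto intro: mult_left_mono[of 1 _ "cmod c", simplified])

lemma gclass_id: "gclass (\<lambda>\<xi>. \<xi>)"
proof (rule gclassI[where B = "exp offset" and p = 1])
  fix \<xi> :: complex
  have "cmod \<xi> \<le> exp (cmod \<xi>)" using exp_ge_add_one_self[of "cmod \<xi>"] by linarith
  also have "\<dots> \<le> exp (offset + \<theta> (cmod \<xi>))" using theta_lower[of "cmod \<xi>"] by simp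
  finally show "cmod \<xi> \<le> exp offset * exp (\<theta> (1 * cmod \<xi>))" by (simp add: exp_add)
qed auto

lemma gclass_power: "gclass g \<Longrightarrow> gclass (\<lambda>\<xi>. g \<xi> ^ n)"
  by (induction n) (auto intro: gclass_const gclass_mult)

lemma gclass_diff:
  assumes "gclass g" "gclass h" shows "gclass (\<lambda>\<xi>. g \<xi> - h \<xi>)"
  using gclass_add[OF assms(1) gclass_mult[OF gclass_const[of "- 1"] assms(2)]] by simp

lemma gclass_sum: "finite A \<Longrightarrow> (\<And>i. i \<in> A \<Longrightarrow> gclass (f i)) \<Longrightarrow> gclass (\<lambda>\<xi>. \<Sum>i\<in>A. f i \<xi>)"
  by (induction A rule: finite_induct) (auto intro: gclass_const gclass_add)

lemma gclass_prod: "finite A \<Longrightarrow> (\<And>i. i \<in> A \<Longrightarrow> gclass (f i)) \<Longrightarrow> gclass (\<lambda>\<xi>. \<Prod>i\<in>A. f i \<xi>)"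
  by (induction A rule: finite_induct) (auto intro: gclass_const gclass_mult)

lemma pair_sums:
  assumes "gclass g" "f \<in> F_space \<theta>"
  shows "(\<lambda>i. jet g i / fact i * jet f i) sums pair g f"
  using assms pair_summable unfolding gclass_def shift_pair_def by (auto intro: summable_sums)

lemma pair_add:
  assumes "gclass g" "gclass h" "f \<in> F_space \<theta>"
  shows "pair (\<lambda>\<xi>. g \<xi> + h \<xi>) f = pair g f + pair h f"
  using sums_unique2[OF pair_sums[OF gclass_add[OF assms(1,2)] assms(3)]]
    sums_add[OF pair_sums[OF assms(1,3)] pair_sums[OF assms(2,3)]]
  by (simp add: jet_add[OF gclass_entire[OF assms(1)] gclass_entire[OF assms(2)]] algebra_simps add_divide_distrib)

lemma pair_cmult:
  assumes "gclass g" "f \<in> F_space \<theta>"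
  shows "pair (\<lambda>\<xi>. c * g \<xi>) f = c * pair g f"
  using sums_unique2[OF pair_sums[OF gclass_mult[OF gclass_const assms(1)] assms(2), of c]]
    sums_mult[OF pair_sums[OF assms], of c]
  by (simp add: jet_cmult[OF gclass_entire[OF assms(1)]] mult.assoc)

lemma pair_sum:
  assumes "finite A" "\<And>i. i \<in> A \<Longrightarrow> gclass (g i)" "f \<in> F_space \<theta>"
  shows "pair (\<lambda>\<xi>. \<Sum>i\<in>A. g i \<xi>) f = (\<Sum>i\<in>A. pair (g i) f)"
  using assms(1,2)
proof (induction A)
  case empty
  then show ?case by (simp add: shift_pair_def jet_zero)
next
  case (insert i A)
  then show ?case using pair_add[OF _ gclass_sum[of A g] assms(3)] by simp
qed

lemma pair_power:
  assumes "f \<in> F_space \<theta>" shows "pair (\<lambda>\<xi>. \<xi> ^ i) f = jet f i"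
proof -
  have "(\<lambda>j. if j = i then jet f j else 0) sums jet f i" by (rule sums_single)
  moreover have "(\<lambda>j. if j = i then jet f j else 0) = (\<lambda>j. jet (\<lambda>\<xi>. \<xi> ^ i) j / fact j * jet f j)"
    by (auto simp: jet_power)
  ultimately show ?thesis by (simp add: shift_pair_def sums_iff)
qed

text \<open>Multiplication by \<xi>^s shifts the Taylor coefficients of g, which is dual to
  differentiating f s times.\<close>

lemma pair_power_mult:
  assumes g: "gclass g" and f: "f \<in> F_space \<theta>"
  shows "pair (\<lambda>\<xi>. \<xi> ^ s * g \<xi>) f = shift_pair g f s"
proof -
  have hol: "g holomorphic_on UNIV" by (rule gclass_entire[OF g])
  have jt: "jet (\<lambda>\<xi>. \<xi> ^ s * g \<xi>) i = (if i < s then 0 else fact i * (jet g (i - s) / fact (i - s)))" for i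
  proof (rule jet_eqI)
    fix \<xi> :: complex
    have "(\<lambda>i. \<xi> ^ s * (jet g i / fact i * \<xi> ^ i)) sums (\<xi> ^ s * g \<xi>)"
      by (intro sums_mult jet_sums[OF hol])
    also have "(\<lambda>i. \<xi> ^ s * (jet g i / fact i * \<xi> ^ i))
        = (\<lambda>i. (if i + s < s then 0 else fact (i + s) * (jet g (i + s - s) / fact (i + s - s))) / fact (i + s) * \<xi> ^ (i + s))"
      by (auto simp: power_add)
    finally show "(\<lambda>i. (if i < s then 0 else fact i * (jet g (i - s) / fact (i - s))) / fact i * \<xi> ^ i) sums (\<xi> ^ s * g \<xi>)"
      by (subst (asm) sums_zero_iff_shift) auto
  qed
  have "(\<lambda>i. jet (\<lambda>\<xi>. \<xi> ^ s * g \<xi>) i / fact i * jet f i) sums pair (\<lambda>\<xi>. \<xi> ^ s * g \<xi>) f"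
    by (intro pair_sums gclass_mult gclass_power gclass_id g f)
  then have "(\<lambda>i. jet (\<lambda>\<xi>. \<xi> ^ s * g \<xi>) (i + s) / fact (i + s) * jet f (i + s)) sums pair (\<lambda>\<xi>. \<xi> ^ s * g \<xi>) f"
    by (subst sums_zero_iff_shift) (auto simp: jt)
  then show ?thesis by (simp add: shift_pair_def jt sums_iff)
qed

section \<open>Decay of the pairing\<close>

text \<open>Bookkeeping for exponents at radius a. A single c serves as additive constant and as
  dilation, so that by superadditivity the constants of a sum simply add up.\<close>

definition dominated :: "real \<Rightarrow> real \<Rightarrow> real \<Rightarrow> bool" where
  "dominated c a x \<longleftrightarrow> x \<le> c + \<theta> (c * a)"

lemma dominated_add:
  assumes "dominated c a x" "dominated d a y" "0 \<le> c" "0 \<le> d" "0 \<le> a"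
  shows "dominated (c + d) a (x + y)"
  using assms theta_superadd[of "c * a" "d * a"] by (simp add: dominated_def distrib_right)

lemma dominated_mono:
  assumes "dominated c a x" "c \<le> d" "y \<le> x" "0 \<le> c" "0 \<le> a"
  shows "dominated d a y"
  using assms theta_mono[of "c * a" "d * a"] by (auto simp: dominated_def mult_right_mono)

lemma dominated_theta: "0 \<le> r \<Longrightarrow> dominated r a (\<theta> (r * a))"
  by (simp add: dominated_def)

lemma dominated_const: "0 \<le> c \<Longrightarrow> 0 \<le> a \<Longrightarrow> dominated c a c"
  by (simp add: dominated_def)

text \<open>The transform may vanish at 0, so lower bounds are anchored at a nearby point; one point
  of the unit disc serves for all radii.\<close>

lemma ex_base_point:
  assumes "g holomorphic_on UNIV" "jet g i \<noteq> 0"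
  obtains z where "cmod z \<le> 1" "g z \<noteq> 0"
proof -
  have "\<exists>z\<in>ball 0 1. g z \<noteq> 0"
  proof (rule ccontr)
    assume "\<not> ?thesis"
    then have "\<forall>\<^sub>F z in nhds 0. g z = (\<lambda>z. 0) z"
      by (intro eventually_nhds_in_open[of "ball 0 1", THEN eventually_mono]) auto
    then have "jet g i = jet (\<lambda>z. 0) i" unfolding jet_def by (rule higher_deriv_cong_ev) simp
    then show False using assms(2) by (simp add: jet_zero)
  qed
  then obtain z where "z \<in> ball 0 1" "g z \<noteq> 0" by blast
  then show ?thesis using that[of z] by simp
qed

lemma taylor_remainder_le:
  assumes h: "h holomorphic_on ball 0 R" and \<rho>: "0 < \<rho>" "\<rho> < R"
    and B: "\<And>z. cmod z \<le> \<rho> \<Longrightarrow> cmod (h z) \<le> B"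
  shows "cmod ((deriv ^^ j) h 0 / fact j) \<le> B / \<rho> ^ j"
    and "cmod z \<le> \<rho> / 2 \<Longrightarrow> cmod (h z - (\<Sum>j<J. (deriv ^^ j) h 0 / fact j * z ^ j)) \<le> 2 * B * (1/2) ^ J"
proof -
  let ?c = "\<lambda>j. (deriv ^^ j) h 0 / fact j"
  have B0: "0 \<le> B" using order_trans[OF norm_ge_zero B[of 0]] \<rho> by simp
  have c: "cmod (?c j) \<le> B / \<rho> ^ j" for j
  proof -
    have "cmod ((deriv ^^ j) h 0) \<le> fact j * B / \<rho> ^ j"
      by (rule Cauchy_inequality)
        (use \<rho> h B in \<open>auto intro!: holomorphic_on_imp_continuous_on intro: holomorphic_on_subset\<close>)
    then show ?thesis by (simp add: norm_divide field_simps)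
  qed
  show "cmod (?c j) \<le> B / \<rho> ^ j" by (rule c)
  show "cmod (h z - (\<Sum>j<J. ?c j * z ^ j)) \<le> 2 * B * (1/2) ^ J" if z: "cmod z \<le> \<rho> / 2"
  proof -
    have "(\<lambda>j. ?c j * z ^ j) sums h z"
      using holomorphic_power_series[OF h, of z] z \<rho> by simp
    then have s: "(\<lambda>j. ?c (j + J) * z ^ (j + J)) sums (h z - (\<Sum>j<J. ?c j * z ^ j))"
      by (rule sums_split_initial_segment)
    have le: "norm (?c (j + J) * z ^ (j + J)) \<le> B * (1/2) ^ J * (1/2) ^ j" for j
    proof -
      have "norm (?c (j + J) * z ^ (j + J)) \<le> B / \<rho> ^ (j + J) * (\<rho> / 2) ^ (j + J)"
        unfolding norm_mult norm_power using c z B0 \<rho> by (intro mult_mono power_mono) auto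
      also have "\<dots> = B * (1/2) ^ J * (1/2) ^ j" using \<rho> by (simp add: power_divide power_add)
      finally show ?thesis .
    qed
    have g: "(\<lambda>j. B * (1/2) ^ J * (1/2) ^ j) sums (B * (1/2) ^ J * 2)"
      using sums_mult[OF geometric_sums[of "1/2::real"], of "B * (1/2) ^ J"] by simp
    have "cmod (h z - (\<Sum>j<J. ?c j * z ^ j)) \<le> B * (1/2) ^ J * 2"
      using norm_suminf_le[OF le sums_summable[OF g]] unfolding sums_unique[OF s, symmetric] sums_unique[OF g, symmetric] .
    then show ?thesis by simp
  qed
qed

text \<open>The pairing annihilates $\Phi H$ for every polynomial $H$. With $H$ the Taylor polynomial of degree
  less than $J$ of $q / G$, the difference $S - \Phi H$ is small near $0$ and not too large elsewhere.\<close>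

lemma key_estimate:
  assumes f: "f \<in> F_space \<theta>" and ann: "\<And>s. shift_pair \<Phi> f s = 0"
    and \<Phi>: "gclass \<Phi>" and z0: "cmod z0 \<le> 1" "\<Phi> z0 \<noteq> 0" and r: "0 < r" and c0: "0 \<le> c0"
  obtains C where "0 < C"
    "\<And>a n N G S q A d. \<lbrakk>6 \<le> a; G holomorphic_on UNIV; q holomorphic_on ball 0 a; gclass S;
       \<And>\<xi>. cmod \<xi> < a \<Longrightarrow> S \<xi> = N \<xi> * q \<xi>; \<And>\<xi>. \<Phi> \<xi> = N \<xi> * G \<xi>; \<And>\<xi>. a \<le> cmod \<xi> \<Longrightarrow> (cmod \<xi> - a) ^ n \<le> cmod (N \<xi>);
       \<And>\<xi>. cmod (N \<xi>) \<le> (cmod \<xi> + a) ^ n; \<And>\<xi>. cmod \<xi> < a \<Longrightarrow> G \<xi> \<noteq> 0; 0 \<le> A;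
       \<And>\<xi>. cmod (S \<xi>) \<le> A * (cmod \<xi> + a + 1) ^ d;
       \<And>\<xi>. cmod \<xi> \<le> a / 4 \<Longrightarrow> cmod (q \<xi>) * (a + 1) ^ n \<le> A * 2 ^ d * (a + 1) ^ d;
       dominated c0 a d\<rbrakk>
     \<Longrightarrow> cmod (pair S f) \<le> C * A * (a + 1) ^ d * exp (- \<theta> (r * a))"
proof -
  obtain B0 p where B0: "0 < B0" and p: "0 < p"
    and growth0: "\<And>\<xi>. cmod (\<Phi> \<xi>) \<le> B0 * exp (\<theta> (p * cmod \<xi>))"
    using gclassE[OF \<Phi>] by blast
  define B where "B = max B0 1"
  have B: "1 \<le> B" by (simp add: B_def)
  have growth: "cmod (\<Phi> \<xi>) \<le> B * exp (\<theta> (p * cmod \<xi>))" for \<xi>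
    by (rule order_trans[OF growth0 mult_right_mono]) (auto simp: B_def)
  define \<kappa> where "\<kappa> = cmod (\<Phi> z0)"
  have \<kappa>: "0 < \<kappa>" using z0 by (simp add: \<kappa>_def)
  \<comment> \<open>\<open>cM\<close>, \<open>cY\<close>, \<open>cX\<close> are the
    \<open>dominated\<close> constants of ln (2 M), ln Y and ln X below, and \<open>c\<close> is
    that of 2 ln X + 1, which controls J. They are fixed before a and the functions N, G, S,
    q.\<close>
  define cM where "cM = ln (2 * B) + 4 * p"
  define cY where "cY = c0 + (cM + cM) + 3 * \<bar>ln \<kappa>\<bar>"
  define cX where "cX = 1 + cM + cY + r"
  define c where "c = cX + cX + 1"
  have cpos: "0 \<le> cM" "0 \<le> cY" "0 \<le> cX" "0 \<le> c" "cY \<le> c" "c0 \<le> c" "r \<le> c"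
    using B p r c0 by (auto simp: cM_def cY_def cX_def c_def)
  define P where "P = p + 40 * c"
  have P: "0 < P" using p cpos by (simp add: P_def)
  define E where "E = 2 * B * exp offset"
  have E: "1 \<le> E"
  proof -
    have "1 * 1 \<le> (2 * B) * exp offset" using B offset_nonneg by (intro mult_mono) auto
    then show ?thesis by (simp add: E_def)
  qed
  have W: "0 \<le> wnorm P f" using wnorm_nonneg[OF _ F_wsummable[OF f P]] P by simp
  show ?thesis
  proof (rule that[of "E * wnorm P f + 1"])
    show "0 < E * wnorm P f + 1" using E W by (simp add: add_nonneg_pos)
    fix a A :: real and n d :: nat and N G S q :: "complex \<Rightarrow> complex"
    assume a: "6 \<le> a" and G: "G holomorphic_on UNIV"
      and q: "q holomorphic_on ball 0 a" and fac: "\<And>\<xi>. \<Phi> \<xi> = N \<xi> * G \<xi>"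
      and N_lower: "\<And>\<xi>. a \<le> cmod \<xi> \<Longrightarrow> (cmod \<xi> - a) ^ n \<le> cmod (N \<xi>)"
      and N_upper: "\<And>\<xi>. cmod (N \<xi>) \<le> (cmod \<xi> + a) ^ n" and nz: "\<And>\<xi>. cmod \<xi> < a \<Longrightarrow> G \<xi> \<noteq> 0"
      and A: "0 \<le> A" and gP: "gclass S" and S: "\<And>\<xi>. cmod \<xi> < a \<Longrightarrow> S \<xi> = N \<xi> * q \<xi>"
      and P_le: "\<And>\<xi>. cmod (S \<xi>) \<le> A * (cmod \<xi> + a + 1) ^ d"
      and q_le: "\<And>\<xi>. cmod \<xi> \<le> a / 4 \<Longrightarrow> cmod (q \<xi>) * (a + 1) ^ n \<le> A * 2 ^ d * (a + 1) ^ d"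
      and d: "dominated c0 a d"
    have a0: "0 \<le> a" using a by simp
    define M where "M = B * exp (\<theta> (4 * p * a))"
    \<comment> \<open>Q Y will bound h = q / G on |\<xi>| \<le> a / 4, by the lower bound of G. X is
      what 2^J has to exceed: it collects the maximum of \<Phi>, the factor Y and the wanted decay.
      J \<ge> 2 ln X is enough since ln 2 \<ge> 1/2.\<close>
    define Y where "Y = 2 ^ d * (2 * M) ^ 2 / \<kappa> ^ 3"
    define X where "X = 2 * M * Y * exp (\<theta> (r * a))"
    define J where "J = nat \<lceil>2 * ln X\<rceil>"
    define V where "V = c + \<theta> (c * a)"
    define Q where "Q = A * (a + 1) ^ d"
    have M0: "0 < M" using B by (simp add: M_def)
    have Y0: "0 < Y" using M0 \<kappa> by (simp add: Y_def)
    have X0: "0 < X" using M0 Y0 by (simp add: X_def)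
    have Q0: "0 \<le> Q" using A a0 by (simp add: Q_def)
    have lnM: "dominated cM a (ln (2 * M))"
    proof -
      have "ln (2 * M) = ln (2 * B) + \<theta> (4 * p * a)"
        using B by (simp add: M_def ln_mult flip: mult.assoc)
      then show ?thesis unfolding cM_def
        using dominated_add[OF dominated_const[of "ln (2 * B)" a] dominated_theta[of "4 * p" a]] B p a0 by simp
    qed
    have lnY: "dominated cY a (ln Y)"
    proof -
      have "dominated cY a (d + (ln (2 * M) + ln (2 * M)) + 3 * \<bar>ln \<kappa>\<bar>)"
        unfolding cY_def by (intro dominated_add d lnM dominated_const c0 cpos a0 add_nonneg_nonneg) auto
      moreover have "ln Y \<le> d + (ln (2 * M) + ln (2 * M)) + 3 * \<bar>ln \<kappa>\<bar>"
      proof -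
        have "ln (2 ^ d * D ^ 2 / \<kappa> ^ 3) = d * ln 2 + 2 * ln D - 3 * ln \<kappa>" if "0 < D" for D
          using that \<kappa> by (simp add: ln_mult ln_div ln_realpow)
        from this[of "2 * M"] have "ln Y = d * ln 2 + 2 * ln (2 * M) - 3 * ln \<kappa>"
          using M0 unfolding Y_def by simp
        moreover have "d * ln 2 \<le> real d * 1" by (intro mult_left_mono) (auto simp: ln_le_minus_one order_trans[OF ln_le_minus_one])
        ultimately show ?thesis by linarith
      qed
      ultimately show ?thesis using dominated_mono[of cY a _ cY] cpos a0 by blast
    qed
    have lnX: "dominated cX a (ln X)"
    proof -
      have "dominated cX a (1 + ln (2 * M) + ln Y + \<theta> (r * a))"
        unfolding cX_def using r by (intro dominated_add lnM lnY dominated_const dominated_theta cpos a0 add_nonneg_nonneg) auto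
      moreover have "ln X \<le> 1 + ln (2 * M) + ln Y + \<theta> (r * a)"
        using M0 Y0 by (simp add: X_def ln_mult)
      ultimately show ?thesis using dominated_mono[of cX a _ cX] cpos a0 by blast
    qed
    have JV: "J \<le> V"
    proof -
      have "real J \<le> max 0 (2 * ln X + 1)" unfolding J_def by linarith
      moreover have "2 * ln X + 1 \<le> V" unfolding V_def c_def
        using dominated_add[OF dominated_add[OF lnX lnX] dominated_const[of 1 a]] cpos a0 by (simp add: dominated_def c_def)
      moreover have "0 \<le> V" using cpos a0 by (simp add: V_def)
      ultimately show ?thesis by linarith
    qed
    have dV: "d \<le> V" and YV: "ln Y \<le> V" and rV: "\<theta> (r * a) \<le> V"
      using dominated_mono[OF d, of c] dominated_mono[OF lnY, of c] dominated_mono[OF dominated_theta[of r a], of c] cpos c0 r a0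
      by (auto simp: V_def dominated_def)
    have V0: "0 \<le> V" using cpos a0 by (simp add: V_def)
    have X_le: "X \<le> 2 ^ J"
    proof -
      have "2 * ln X \<le> J" unfolding J_def by linarith
      moreover have "1/2 \<le> ln (2::real)" by (rule order_trans[OF _ ln2_ge_two_thirds]) simp
      then have "real J * (1/2) \<le> J * ln 2" by (intro mult_left_mono) auto
      ultimately have "ln X \<le> ln (2 ^ J)" by (simp add: ln_realpow)
      then show ?thesis using X0 by (simp add: ln_le_cancel_iff)
    qed
    have M_le: "cmod (\<Phi> \<xi>) \<le> M" if "cmod \<xi> \<le> 3 * a + 2" for \<xi>
    proof -
      have "cmod (\<Phi> \<xi>) \<le> B * exp (\<theta> (p * cmod \<xi>))" by (rule growth)
      also have "\<theta> (p * cmod \<xi>) \<le> \<theta> (p * (4 * a))"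
        using that a p by (intro theta_mono mult_left_mono) auto
      finally show ?thesis using B by (simp add: M_def mult_ac)
    qed
    have G_lower: "\<kappa> ^ 3 / (2 * M) ^ 2 \<le> cmod (G \<xi>) * (a + 1) ^ n" if "cmod \<xi> \<le> a / 4" for \<xi>
      unfolding \<kappa>_def by (rule cofactor_lower[OF G fac N_lower N_upper a0 M_le z0 a nz that])
    define h where "h = (\<lambda>\<xi>. q \<xi> / G \<xi>)"
    have h_hol: "h holomorphic_on ball 0 a"
      unfolding h_def by (intro holomorphic_intros q holomorphic_on_subset[OF G]) (use nz in auto)
    have h_le: "cmod (h \<xi>) \<le> Q * Y" if \<xi>: "cmod \<xi> \<le> a / 4" for \<xi>
    proof -
      have pos: "0 < \<kappa> ^ 3 / (2 * M) ^ 2" using \<kappa> M0 by simp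
      have "cmod (h \<xi>) = (cmod (q \<xi>) * (a + 1) ^ n) / (cmod (G \<xi>) * (a + 1) ^ n)"
        using a by (simp add: h_def norm_divide)
      also have "\<dots> \<le> (A * 2 ^ d * (a + 1) ^ d) / (\<kappa> ^ 3 / (2 * M) ^ 2)"
        using q_le[OF \<xi>] G_lower[OF \<xi>] pos A a0 by (intro frac_le) auto
      also have "\<dots> = Q * Y" by (simp add: Q_def Y_def)
      finally show ?thesis .
    qed
    define cf where "cf = (\<lambda>j. (deriv ^^ j) h 0 / fact j)"
    have cf: "cmod (cf j) \<le> Q * Y / (a / 4) ^ j" for j
      unfolding cf_def by (rule taylor_remainder_le(1)[OF h_hol, where \<rho> = "a / 4"]) (use a h_le in auto)
    define H where "H = (\<lambda>\<xi>. \<Sum>j<J. cf j * \<xi> ^ j)"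
    \<comment> \<open>The product of \<Phi> and H is written out in monomials, so that
      \<open>ann\<close> kills each summand of its pairing with f.\<close>
    define g where "g = (\<lambda>\<xi>. S \<xi> - (\<Sum>j<J. cf j * (\<xi> ^ j * \<Phi> \<xi>)))"
    have g_eq: "g \<xi> = S \<xi> - \<Phi> \<xi> * H \<xi>" for \<xi>
      by (simp add: g_def H_def sum_distrib_left mult_ac)
    have gmon: "gclass (\<lambda>\<xi>. \<xi> ^ j * \<Phi> \<xi>)" for j by (intro gclass_mult gclass_power gclass_id \<Phi>)
    have gsum: "gclass (\<lambda>\<xi>. \<Sum>j<J. cf j * (\<xi> ^ j * \<Phi> \<xi>))"
      by (intro gclass_sum gclass_mult gclass_const gmon) auto
    have gg: "gclass g" unfolding g_def by (intro gclass_diff gP gsum)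
    have "pair (\<lambda>\<xi>. \<Sum>j<J. cf j * (\<xi> ^ j * \<Phi> \<xi>)) f = (\<Sum>j<J. cf j * pair (\<lambda>\<xi>. \<xi> ^ j * \<Phi> \<xi>) f)"
      by (subst pair_sum[OF _ _ f]) (auto intro!: gclass_mult gclass_const gclass_power gclass_id \<Phi> simp: pair_cmult[OF gmon f])
    also have "\<dots> = 0" by (simp add: pair_power_mult[OF \<Phi> f] ann)
    finally have pair_eq: "pair S f = pair g f"
      using pair_add[OF gg gsum f] by (simp add: g_def)
    have g_le: "cmod (g \<xi>) \<le> Q * exp (- \<theta> (r * a)) * E * exp (\<theta> (P * cmod \<xi>))" for \<xi>
    \<comment> \<open>a / 8 is half the radius on which h is bounded; inside, the Taylor remainder
      of h is at most 2 Q Y / 2^J.\<close>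
    proof (cases "cmod \<xi> \<le> a / 8")
      case True
      then have "cmod \<xi> < a" using a by linarith
      then have "g \<xi> = \<Phi> \<xi> * (h \<xi> - H \<xi>)"
        using S[of \<xi>] nz[of \<xi>] by (simp add: g_eq h_def fac algebra_simps)
      moreover have "cmod (h \<xi> - H \<xi>) \<le> 2 * (Q * Y) * (1/2) ^ J"
        unfolding H_def cf_def by (rule taylor_remainder_le(2)[OF h_hol, where \<rho> = "a / 4"]) (use a True h_le in auto)
      ultimately have "cmod (g \<xi>) \<le> M * (2 * (Q * Y) * (1/2) ^ J)"
        unfolding norm_mult using M_le[of \<xi>] True a M0 by (simp only: norm_mult) (intro mult_mono, auto)
      also have "\<dots> = Q * exp (- \<theta> (r * a)) * (X / 2 ^ J)"
        by (simp add: X_def exp_minus field_simps)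
      also have "\<dots> \<le> Q * exp (- \<theta> (r * a)) * (E * exp (\<theta> (P * cmod \<xi>)))"
      proof (intro mult_left_mono)
        have "X / 2 ^ J \<le> 1" using X_le by simp
        also have "1 \<le> E * exp (\<theta> (P * cmod \<xi>))"
          using mult_mono[of 1 E 1 "exp (\<theta> (P * cmod \<xi>))"] E P by simp
        finally show "X / 2 ^ J \<le> E * exp (\<theta> (P * cmod \<xi>))" by simp
      qed (use Q0 in auto)
      finally show ?thesis by (simp add: mult_ac)
    next
      case False
      define x where "x = cmod \<xi>"
      \<comment> \<open>Outside, s \<ge> 1 measures |\<xi>| in units of a / 8. Up to the factor Q
        and the growth of \<Phi>, both parts of g are bounded by the exponential of a multiple of V
        s.\<close>
      define s where "s = 8 * x / a"
      have x: "0 \<le> x" and xs: "x = s * a / 8" using a by (auto simp: x_def s_def)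
      have "4 * x \<le> a * x" using a x by (intro mult_right_mono) auto
      then have s: "1 \<le> s" "s \<le> 2 * x" using False a by (auto simp: s_def x_def field_simps)
      have t1: "cmod (S \<xi>) \<le> Q * exp (V * s)"
      proof -
        have "cmod (S \<xi>) \<le> A * (x + a + 1) ^ d" unfolding x_def by (rule P_le)
        also have "\<dots> \<le> A * ((a + 1) * exp s) ^ d"
        proof (intro mult_left_mono power_mono)
          have "x + a + 1 \<le> (a + 1) * (1 + s)" using xs s a by (simp add: algebra_simps)
          also have "\<dots> \<le> (a + 1) * exp s" using a exp_ge_add_one_self[of s] by (intro mult_left_mono) auto
          finally show "x + a + 1 \<le> (a + 1) * exp s" .
        qed (use A x a in auto)
        also have "\<dots> = Q * exp (d * s)" by (simp add: Q_def power_mult_distrib exp_of_nat_mult)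
        also have "\<dots> \<le> Q * exp (V * s)" using Q0 dV s by (intro mult_left_mono) (auto intro: mult_right_mono)
        finally show ?thesis .
      qed
      have "cmod (H \<xi>) \<le> (\<Sum>j<J. Q * Y * exp (V * s))"
        unfolding H_def
      proof (rule sum_norm_le)
        fix j assume "j \<in> {..<J}"
        then have jJ: "j \<le> J" by simp
        have "cmod (cf j * \<xi> ^ j) \<le> Q * Y / (a / 4) ^ j * x ^ j"
          unfolding norm_mult norm_power x_def by (intro mult_right_mono cf) auto
        also have "\<dots> = Q * Y * (x / (a / 4)) ^ j" by (simp only: power_divide times_divide_eq_left times_divide_eq_right)
        also have "x / (a / 4) = s / 2" by (simp add: s_def)
        also have "Q * Y * (s / 2) ^ j \<le> Q * Y * exp s ^ j"
        proof (intro mult_left_mono power_mono)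
          show "s / 2 \<le> exp s" using s exp_ge_add_one_self[of s] by linarith
        qed (use Q0 Y0 s in auto)
        also have "\<dots> \<le> Q * Y * exp (V * s)"
        proof (intro mult_left_mono)
          have "j * s \<le> V * s" using jJ JV s by (intro mult_right_mono) linarith+
          then show "exp s ^ j \<le> exp (V * s)" by (simp flip: exp_of_nat_mult)
        qed (use Q0 Y0 in auto)
        finally show "cmod (cf j * \<xi> ^ j) \<le> Q * Y * exp (V * s)" .
      qed
      also have "\<dots> = J * (Q * Y * exp (V * s))" by simp
      also have "\<dots> \<le> exp V * (Q * exp V * exp (V * s))"
      proof (intro mult_mono)
        show "real J \<le> exp V" using JV exp_ge_add_one_self[of V] by linarith
        show "Y \<le> exp V" using YV Y0 by (metis exp_le_cancel_iff exp_ln)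
      qed (use Q0 Y0 in auto)
      also have "\<dots> = Q * exp (2 * V + V * s)" by (simp add: mult_exp_exp mult_ac)
      also have "\<dots> \<le> Q * exp (3 * V * s)"
      proof -
        have "V * 1 \<le> V * s" using V0 s by (intro mult_left_mono) auto
        then show ?thesis using Q0 by (intro mult_left_mono) auto
      qed
      finally have t2: "cmod (H \<xi>) \<le> Q * exp (3 * V * s)" .
      have "cmod (g \<xi>) \<le> cmod (S \<xi>) + cmod (\<Phi> \<xi> * H \<xi>)"
        unfolding g_eq by (rule norm_triangle_ineq4)
      also have "\<dots> \<le> Q * exp (V * s) + (B * exp (\<theta> (p * x))) * (Q * exp (3 * V * s))"
        unfolding norm_mult[of "\<Phi> \<xi>"] using growth[of \<xi>] t1 t2 B
        by (intro add_mono mult_mono) (auto simp: x_def)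
      also have "\<dots> \<le> 2 * B * (Q * exp (\<theta> (p * x)) * exp (3 * V * s))"
      proof -
        have "exp (V * s) \<le> exp (3 * V * s)" using V0 s by simp
        also have "\<dots> \<le> B * (exp (\<theta> (p * x)) * exp (3 * V * s))"
        proof -
          have "1 * (1 * exp (3 * V * s)) \<le> B * (exp (\<theta> (p * x)) * exp (3 * V * s))"
            using B x p by (intro mult_mono) auto
          then show ?thesis by simp
        qed
        finally have "Q * exp (V * s) \<le> Q * (B * (exp (\<theta> (p * x)) * exp (3 * V * s)))"
          using Q0 by (intro mult_left_mono) auto
        then show ?thesis by (simp add: mult_ac)
      qed
      also have "\<dots> \<le> 2 * B * (Q * exp (- \<theta> (r * a)) * exp (offset + \<theta> (P * x)))"
      proof -
        \<comment> \<open>The decay \<theta>(r a) \<le> V is charged as a fourth V s. Then 4 s V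
          splits into 4 s c \<le> 8 c x and 4 s \<theta>(c a) \<le> \<theta>(32 c x), which explains
          the 40 = 8 + 32 in \<open>P\<close>.\<close>
        have "\<theta> (r * a) + \<theta> (p * x) + 3 * V * s \<le> offset + \<theta> (P * x)"
        proof -
          have "V * 1 \<le> V * s" using V0 s by (intro mult_left_mono) auto
          then have "\<theta> (r * a) + 3 * V * s \<le> 4 * V * s" using rV by simp
          also have "\<dots> = 4 * s * c + (4 * s) * \<theta> (c * a)" by (simp add: V_def algebra_simps)
          also have "\<dots> \<le> 8 * c * x + \<theta> (32 * c * x)"
          proof (rule add_mono)
            have "4 * c * s \<le> 4 * c * (2 * x)" using cpos s by (intro mult_left_mono) auto
            then show "4 * s * c \<le> 8 * c * x" by (simp add: mult_ac)
            have "(4 * s) * \<theta> (c * a) \<le> \<theta> ((4 * s) * (c * a))"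
              using s cpos a by (intro theta_scale) auto
            also have "(4 * s) * (c * a) = 32 * c * x" by (subst xs) simp
            finally show "4 * s * \<theta> (c * a) \<le> \<theta> (32 * c * x)" .
          qed
          also have "\<dots> \<le> offset + \<theta> (8 * c * x) + \<theta> (32 * c * x)"
            using theta_lower[of "8 * c * x"] cpos x by simp
          also have "\<dots> \<le> offset + \<theta> (8 * c * x + 32 * c * x)"
            using theta_superadd[of "8 * c * x" "32 * c * x"] cpos x by simp
          finally have "\<theta> (r * a) + \<theta> (p * x) + 3 * V * s \<le> offset + (\<theta> (p * x) + \<theta> (8 * c * x + 32 * c * x))" by simp
          also have "\<dots> \<le> offset + \<theta> (p * x + (8 * c * x + 32 * c * x))"
            using theta_superadd[of "p * x" "8 * c * x + 32 * c * x"] cpos x p by simp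
          also have "p * x + (8 * c * x + 32 * c * x) = P * x" by (simp add: P_def algebra_simps)
          finally show ?thesis .
        qed
        then have "exp (\<theta> (p * x) + 3 * V * s) \<le> exp (- \<theta> (r * a) + (offset + \<theta> (P * x)))" by simp
        then have "Q * (exp (\<theta> (p * x)) * exp (3 * V * s)) \<le> Q * (exp (- \<theta> (r * a)) * exp (offset + \<theta> (P * x)))"
          unfolding mult_exp_exp using Q0 by (intro mult_left_mono) auto
        then show ?thesis using B by (simp add: mult.assoc)
      qed
      also have "\<dots> = Q * exp (- \<theta> (r * a)) * E * exp (\<theta> (P * cmod \<xi>))"
        by (simp add: E_def x_def exp_add)
      finally show ?thesis .
    qed
    have "coeff_growth (Q * exp (- \<theta> (r * a)) * E) P g"
      by (rule coeff_growth_if_le[OF gclass_entire[OF gg] P g_le])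
    from pair_le[OF this f] have "cmod (pair S f) \<le> Q * exp (- \<theta> (r * a)) * (E * wnorm P f)"
      by (simp add: pair_eq mult_ac)
    also have "\<dots> \<le> Q * exp (- \<theta> (r * a)) * (E * wnorm P f + 1)"
      using Q0 by (intro mult_left_mono) auto
    finally show "cmod (pair S f) \<le> (E * wnorm P f + 1) * A * (a + 1) ^ d * exp (- \<theta> (r * a))"
      by (simp add: Q_def mult_ac)
  qed
qed

end

section \<open>Newton interpolation\<close>

text \<open>The transform of the functional S_{k,l}; with \<open>Suc l\<close> in place of
  \<open>l\<close> it is the denominator Q of the overview.\<close>

definition newton :: "(nat \<Rightarrow> complex) \<Rightarrow> (nat \<Rightarrow> nat) \<Rightarrow> nat \<Rightarrow> nat \<Rightarrow> complex \<Rightarrow> complex" where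
  "newton \<alpha> m k l \<xi> = (\<xi> - \<alpha> k) ^ l * (\<Prod>n<k. (\<xi> - \<alpha> n) ^ m n)"

definition newton_degree :: "(nat \<Rightarrow> nat) \<Rightarrow> nat \<Rightarrow> nat \<Rightarrow> nat" where
  "newton_degree m k l = (\<Sum>n<k. m n) + l"

definition newton_dual :: "(nat \<Rightarrow> complex) \<Rightarrow> (nat \<Rightarrow> nat) \<Rightarrow> nat \<Rightarrow> nat \<Rightarrow> complex \<Rightarrow> complex" where
  "newton_dual \<alpha> m k l z = (\<Sum>j\<le>k. exp (z * \<alpha> j) * P_kjl \<alpha> m k j l z)"

definition circle_mean :: "real \<Rightarrow> (complex \<Rightarrow> complex) \<Rightarrow> (complex \<Rightarrow> complex) \<Rightarrow> complex" where
  "circle_mean R Q g = contour_integral (circlepath 0 R) (\<lambda>w. g w / Q w) / (2 * of_real pi * \<i>)"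

lemma newton_Suc_block: "newton \<alpha> m k (m k) = newton \<alpha> m (Suc k) 0"
  by (simp add: newton_def fun_eq_iff mult.commute)

lemma newton_add: "newton \<alpha> m k (l + s) \<xi> = newton \<alpha> m k l \<xi> * (\<xi> - \<alpha> k) ^ s"
  by (simp add: newton_def power_add mult_ac)

lemma entire_newton: "newton \<alpha> m k l holomorphic_on A"
  unfolding newton_def[abs_def] by (intro holomorphic_intros)

lemma newton_eq_0_iff: "newton \<alpha> m k l \<xi> = 0 \<longleftrightarrow> (\<xi> = \<alpha> k \<and> 0 < l) \<or> (\<exists>n<k. \<xi> = \<alpha> n \<and> 0 < m n)"
  by (auto simp: newton_def)

text \<open>For \<open>l = 0\<close> the node \<open>\<alpha> k\<close> does not occur in the
  product; it may then lie outside the disc or, past the last zero, be arbitrary. Hence the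
  disjunction.\<close>

context
  fixes \<alpha> :: "nat \<Rightarrow> complex" and k l :: nat and a :: real
  assumes \<alpha>: "\<And>n. n < k \<Longrightarrow> cmod (\<alpha> n) \<le> a" and \<alpha>k: "l = 0 \<or> cmod (\<alpha> k) \<le> a"
begin

lemma newton_lower:
  assumes "a \<le> cmod \<xi>"
  shows "(cmod \<xi> - a) ^ newton_degree m k l \<le> cmod (newton \<alpha> m k l \<xi>)"
proof -
  have le: "cmod \<xi> - a \<le> cmod (\<xi> - \<alpha> n)" if "cmod (\<alpha> n) \<le> a" for n
    using norm_triangle_ineq2[of \<xi> "\<alpha> n"] that by linarith
  have "(cmod \<xi> - a) ^ l \<le> cmod ((\<xi> - \<alpha> k) ^ l)"
    using \<alpha>k le[of k] assms by (cases "l = 0") (auto simp: norm_power intro!: power_mono)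
  moreover have "(\<Prod>n<k. (cmod \<xi> - a) ^ m n) \<le> (\<Prod>n<k. cmod ((\<xi> - \<alpha> n) ^ m n))"
    using \<alpha> le assms by (intro prod_mono) (auto simp: norm_power intro!: power_mono)
  ultimately have "(cmod \<xi> - a) ^ l * (\<Prod>n<k. (cmod \<xi> - a) ^ m n)
      \<le> cmod ((\<xi> - \<alpha> k) ^ l) * (\<Prod>n<k. cmod ((\<xi> - \<alpha> n) ^ m n))"
    using assms by (intro mult_mono) (auto intro: prod_nonneg)
  then show ?thesis
    by (simp add: newton_def newton_degree_def norm_mult power_add power_sum mult.commute flip: prod_norm)
qed

lemma newton_upper: "cmod (newton \<alpha> m k l \<xi>) \<le> (cmod \<xi> + a) ^ newton_degree m k l"
proof -
  have le: "cmod (\<xi> - \<alpha> n) \<le> cmod \<xi> + a" if "cmod (\<alpha> n) \<le> a" for n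
    using norm_triangle_ineq4[of \<xi> "\<alpha> n"] that by linarith
  have l: "cmod ((\<xi> - \<alpha> k) ^ l) \<le> (cmod \<xi> + a) ^ l"
    using \<alpha>k le[of k] by (cases "l = 0") (auto simp: norm_power intro!: power_mono)
  moreover have "(\<Prod>n<k. cmod ((\<xi> - \<alpha> n) ^ m n)) \<le> (\<Prod>n<k. (cmod \<xi> + a) ^ m n)"
    using \<alpha> le by (intro prod_mono) (auto simp: norm_power intro!: power_mono)
  ultimately have "cmod ((\<xi> - \<alpha> k) ^ l) * (\<Prod>n<k. cmod ((\<xi> - \<alpha> n) ^ m n))
      \<le> (cmod \<xi> + a) ^ l * (\<Prod>n<k. (cmod \<xi> + a) ^ m n)"
    using order_trans[OF norm_ge_zero l] by (intro mult_mono) (auto intro: prod_nonneg)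
  then show ?thesis
    by (simp add: newton_def newton_degree_def norm_mult power_add power_sum mult.commute flip: prod_norm)
qed

end

section \<open>Contour integrals over circles and residues\<close>

lemma circle_integrable:
  assumes "continuous_on (sphere 0 R) g" "continuous_on (sphere 0 R) Q" "0 < R" "\<And>w. cmod w = R \<Longrightarrow> Q w \<noteq> 0"
  shows "(\<lambda>w. g w / Q w) contour_integrable_on circlepath 0 R"
  using assms by (intro contour_integrable_continuous_circlepath continuous_intros) auto

lemma circle_mean_le:
  assumes "continuous_on (sphere 0 R) g" "continuous_on (sphere 0 R) Q" "0 < R" "0 < D"
    and Q: "\<And>w. cmod w = R \<Longrightarrow> D \<le> cmod (Q w)" and g: "\<And>w. cmod w = R \<Longrightarrow> cmod (g w) \<le> B"
  shows "cmod (circle_mean R Q g) \<le> B * R / D"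
proof -
  have B: "0 \<le> B" using order_trans[OF norm_ge_zero g[of "of_real R"]] assms by simp
  have nz: "Q w \<noteq> 0" if "cmod w = R" for w using Q[OF that] assms by auto
  have "cmod (contour_integral (circlepath 0 R) (\<lambda>w. g w / Q w)) \<le> (B / D) * (2 * pi * R)"
  proof (rule has_contour_integral_bound_circlepath)
    show "((\<lambda>w. g w / Q w) has_contour_integral contour_integral (circlepath 0 R) (\<lambda>w. g w / Q w)) (circlepath 0 R)"
      by (intro has_contour_integral_integral circle_integrable[OF assms(1-3) nz])
    fix w :: complex assume "cmod (w - 0) = R"
    then show "cmod (g w / Q w) \<le> B / D"
      using Q[of w] g[of w] assms B by (auto simp: norm_divide intro!: frac_le)
  qed (use assms B in auto)
  then show ?thesis by (simp add: circle_mean_def norm_divide norm_mult field_simps)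
qed

text \<open>The tails of the power series are uniformly small on the circle, so it may be integrated
  term by term.\<close>

lemma circle_mean_sums:
  assumes sums: "\<And>w. (\<lambda>i. c i * w ^ i) sums g w" and gc: "continuous_on (sphere 0 R) g"
    and Q: "continuous_on (sphere 0 R) Q" "0 < R" "0 < D" "\<And>w. cmod w = R \<Longrightarrow> D \<le> cmod (Q w)"
  shows "(\<lambda>i. c i * circle_mean R Q (\<lambda>w. w ^ i)) sums circle_mean R Q g"
proof -
  have nz: "Q w \<noteq> 0" if "cmod w = R" for w using Q(4)[OF that] Q(3) by auto
  have sm: "summable (\<lambda>i. cmod (c i) * R ^ i)"
    using powser_insidea[of c "of_real (R + 1)" "of_real R"] sums_summable[OF sums] Q(2)
    by (simp add: norm_mult norm_power)
  define t where "t = (\<lambda>n. (\<Sum>i. cmod (c i) * R ^ i) - (\<Sum>i<n. cmod (c i) * R ^ i))"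
  have t0: "t \<longlonglongrightarrow> 0"
    using tendsto_diff[OF tendsto_const[of "\<Sum>i. cmod (c i) * R ^ i"] summable_LIMSEQ[OF sm]] by (simp add: t_def)
  have part: "circle_mean R Q (\<lambda>w. g w - (\<Sum>i<n. c i * w ^ i))
      = circle_mean R Q g - (\<Sum>i<n. c i * circle_mean R Q (\<lambda>w. w ^ i))" for n
  proof -
    have i1: "(\<lambda>w. g w / Q w) contour_integrable_on circlepath 0 R"
      by (rule circle_integrable[OF gc Q(1,2) nz])
    have i2: "(\<lambda>w. w ^ i / Q w) contour_integrable_on circlepath 0 R" for i
      by (rule circle_integrable[OF _ Q(1,2) nz]) (auto intro: continuous_intros)
    have "((\<lambda>w. g w / Q w - (\<Sum>i<n. c i * (w ^ i / Q w))) has_contour_integral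
        contour_integral (circlepath 0 R) (\<lambda>w. g w / Q w)
        - (\<Sum>i<n. c i * contour_integral (circlepath 0 R) (\<lambda>w. w ^ i / Q w))) (circlepath 0 R)"
      by (intro has_contour_integral_diff has_contour_integral_sum has_contour_integral_lmul
          has_contour_integral_integral i1 i2) auto
    then have "contour_integral (circlepath 0 R) (\<lambda>w. (g w - (\<Sum>i<n. c i * w ^ i)) / Q w)
        = contour_integral (circlepath 0 R) (\<lambda>w. g w / Q w)
        - (\<Sum>i<n. c i * contour_integral (circlepath 0 R) (\<lambda>w. w ^ i / Q w))"
      by (simp add: diff_divide_distrib sum_divide_distrib contour_integral_unique)
    then show ?thesis by (simp add: circle_mean_def diff_divide_distrib sum_divide_distrib)
  qed
  have "cmod (circle_mean R Q g - (\<Sum>i<n. c i * circle_mean R Q (\<lambda>w. w ^ i))) \<le> t n * R / D" for n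
    unfolding part[symmetric]
  proof (rule circle_mean_le[OF _ Q])
    show "continuous_on (sphere 0 R) (\<lambda>w. g w - (\<Sum>i<n. c i * w ^ i))"
      by (intro continuous_intros gc)
    fix w :: complex assume w: "cmod w = R"
    have "(\<lambda>i. c (i + n) * w ^ (i + n)) sums (g w - (\<Sum>i<n. c i * w ^ i))"
      by (rule sums_split_initial_segment[OF sums])
    moreover have "(\<lambda>i. cmod (c (i + n)) * R ^ (i + n)) sums t n"
      unfolding t_def by (rule sums_split_initial_segment[OF summable_sums[OF sm]])
    ultimately show "cmod (g w - (\<Sum>i<n. c i * w ^ i)) \<le> t n"
      using norm_suminf_le[of "\<lambda>i. c (i + n) * w ^ (i + n)" "\<lambda>i. cmod (c (i + n)) * R ^ (i + n)"] w
      by (simp add: sums_iff norm_mult norm_power)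
  qed auto
  moreover have "(\<lambda>n. t n * R / D) \<longlonglongrightarrow> 0"
    using tendsto_mult_left_zero[OF t0, of "R / D"] by simp
  ultimately have "(\<lambda>n. circle_mean R Q g - (\<Sum>i<n. c i * circle_mean R Q (\<lambda>w. w ^ i))) \<longlonglongrightarrow> 0"
    by (rule Lim_null_comparison[OF always_eventually, OF allI])
  from tendsto_diff[OF tendsto_const[of "circle_mean R Q g"] this]
  show ?thesis by (simp add: sums_def)
qed

text \<open>The residue is a Taylor coefficient of a product, and the Leibniz rule with the
  derivatives z^i e^(z w) of the exponential yields the polynomial in z that defines
  \<open>P_kjl\<close>.\<close>

lemma residue_exp_over_power:
  assumes "open A" "z0 \<in> A" "g holomorphic_on A"
  shows "residue (\<lambda>w. exp (z * w) * g w / (w - z0) ^ Suc n) z0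
    = exp (z * z0) * (\<Sum>i\<le>n. z ^ i / fact i * taylor_coeff (n - i) g z0)"
proof -
  have de: "(deriv ^^ i) (\<lambda>w. exp (z * w)) = (\<lambda>w. z ^ i * exp (z * w))" for i
  proof (induction i)
    case (Suc i)
    have "deriv (\<lambda>w. z ^ i * exp (z * w)) = (\<lambda>w. z ^ Suc i * exp (z * w))"
      by (rule ext, rule DERIV_imp_deriv) (auto intro!: derivative_eq_intros)
    then show ?case using Suc by simp
  qed simp
  have "residue (\<lambda>w. exp (z * w) * g w / (w - z0) ^ Suc n) z0
      = (deriv ^^ n) (\<lambda>w. exp (z * w) * g w) z0 / fact n"
    by (rule residue_holomorphic_over_power[OF assms(1,2)]) (intro holomorphic_intros assms(3))
  also have "(deriv ^^ n) (\<lambda>w. exp (z * w) * g w) z0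
      = (\<Sum>i=0..n. of_nat (n choose i) * (deriv ^^ i) (\<lambda>w. exp (z * w)) z0 * (deriv ^^ (n - i)) g z0)"
    by (rule higher_deriv_mult[OF _ assms(3,1,2)]) (intro holomorphic_intros)
  also have "\<dots> / fact n = (\<Sum>i\<le>n. exp (z * z0) * (z ^ i / fact i * taylor_coeff (n - i) g z0))"
    unfolding sum_divide_distrib atLeast0AtMost de
    by (intro sum.cong refl) (simp add: taylor_coeff_def binomial_fact field_simps)
  finally show ?thesis by (simp add: sum_distrib_left)
qed

text \<open>The integrand has at \<open>\<alpha> j\<close> a pole of order \<open>m j\<close> for j
  < k and \<open>Suc l\<close> for j = k, which accounts for the two branches of
  \<open>P_kjl\<close>. Positive multiplicities make \<open>m j - 1\<close> a genuine
  predecessor.\<close>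

lemma newton_dual_eq_circle_mean:
  assumes inj: "inj_on \<alpha> {..k}" and m: "\<And>n. n < k \<Longrightarrow> 0 < m n"
    and R: "\<And>n. n \<le> k \<Longrightarrow> cmod (\<alpha> n) < R" "0 < R"
  shows "newton_dual \<alpha> m k l z = circle_mean R (newton \<alpha> m k (Suc l)) (\<lambda>w. exp (z * w))"
proof -
  define f where "f = (\<lambda>w. exp (z * w) / newton \<alpha> m k (Suc l) w)"
  have "contour_integral (circlepath 0 R) f
      = 2 * pi * \<i> * (\<Sum>p\<in>\<alpha> ` {..k}. winding_number (circlepath 0 R) p * residue f p)"
  proof (rule Residue_theorem[of UNIV])
    show "f holomorphic_on UNIV - \<alpha> ` {..k}"
      unfolding f_def by (intro holomorphic_intros entire_newton) (auto simp: newton_eq_0_iff)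
    show "path_image (circlepath 0 R) \<subseteq> UNIV - \<alpha> ` {..k}" using R by fastforce
  qed auto
  also have "(\<Sum>p\<in>\<alpha> ` {..k}. winding_number (circlepath 0 R) p * residue f p) = (\<Sum>p\<in>\<alpha> ` {..k}. residue f p)"
    using R by (intro sum.cong refl) (auto simp: winding_number_circlepath)
  also have "\<dots> = (\<Sum>j\<le>k. residue f (\<alpha> j))" using inj by (simp add: sum.reindex)
  also have "\<dots> = newton_dual \<alpha> m k l z"
    unfolding newton_dual_def
  proof (rule sum.cong[OF refl])
    fix j assume "j \<in> {..k}"
    then have j: "j \<le> k" by simp
    \<comment> \<open>The complement of the other nodes, on which the cofactor of the pole at
      \<open>\<alpha> j\<close> is holomorphic.\<close>
    define A where "A = - (\<alpha> ` ({..k} - {j}))"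
    have A: "open A" "\<alpha> j \<in> A"
      using inj j by (auto simp: A_def open_Compl finite_imp_closed dest: inj_onD)
    have inv: "inverse (\<Prod>n\<in>B. (w - \<alpha> n) ^ m n) = (\<Prod>n\<in>B. inverse ((w - \<alpha> n) ^ m n))" for B w
      using prod_inversef[of "\<lambda>n. (w - \<alpha> n) ^ m n" B] by (simp add: comp_def)
    have nA: "w - \<alpha> n \<noteq> 0" if "w \<in> A" "n \<le> k" "n \<noteq> j" for w n using that by (auto simp: A_def)
    show "residue f (\<alpha> j) = exp (z * \<alpha> j) * P_kjl \<alpha> m k j l z"
    proof (cases "j < k")
      case True
      define g where "g = (\<lambda>w. (\<Prod>n\<in>{..<k} - {j}. inverse ((w - \<alpha> n) ^ m n)) * inverse ((w - \<alpha> k) ^ (l + 1)))"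
      have mj: "Suc (m j - 1) = m j" using m[OF True] by simp
      have "f = (\<lambda>w. exp (z * w) * g w / (w - \<alpha> j) ^ Suc (m j - 1))"
      proof
        fix w
        have pr: "(\<Prod>n<k. (w - \<alpha> n) ^ m n) = (w - \<alpha> j) ^ m j * (\<Prod>n\<in>{..<k} - {j}. (w - \<alpha> n) ^ m n)"
          using True by (intro prod.remove) auto
        show "f w = exp (z * w) * g w / (w - \<alpha> j) ^ Suc (m j - 1)"
          unfolding f_def g_def newton_def pr mj by (simp add: divide_inverse inv mult_ac)
      qed
      moreover have "g holomorphic_on A"
        unfolding g_def using nA True by (intro holomorphic_intros) auto
      ultimately have "residue f (\<alpha> j)
          = exp (z * \<alpha> j) * (\<Sum>i\<le>m j - 1. z ^ i / fact i * taylor_coeff (m j - 1 - i) g (\<alpha> j))"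
        using residue_exp_over_power[OF A] by simp
      moreover have "{..m j - 1} = {..<m j}" using m[OF True] by auto
      ultimately show ?thesis using True by (simp add: P_kjl_def g_def)
    next
      case False
      then have jk: "j = k" using j by simp
      define g where "g = (\<lambda>w. \<Prod>n<k. inverse ((w - \<alpha> n) ^ m n))"
      have "f = (\<lambda>w. exp (z * w) * g w / (w - \<alpha> k) ^ Suc l)"
        by (rule ext) (simp add: f_def g_def newton_def divide_inverse inv mult_ac)
      moreover have "g holomorphic_on A"
        unfolding g_def using nA jk by (intro holomorphic_intros) auto
      ultimately have "residue f (\<alpha> k)
          = exp (z * \<alpha> k) * (\<Sum>i\<le>l. z ^ i / fact i * taylor_coeff (l - i) g (\<alpha> k))"
        using residue_exp_over_power[OF A] jk by simp
      then show ?thesis using jk by (simp add: P_kjl_def g_def)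
    qed
  qed
  finally show ?thesis by (simp add: circle_mean_def f_def)
qed

text \<open>The exponential e^(z w) is expanded in powers of z under the integral, so the jets are
  moments of 1 / Q on the circle.\<close>

lemma
  assumes inj: "inj_on \<alpha> {..k}" and m: "\<And>n. n < k \<Longrightarrow> 0 < m n"
    and R: "\<And>n. n \<le> k \<Longrightarrow> cmod (\<alpha> n) \<le> a" "a < R"
  shows jet_newton_dual: "jet (newton_dual \<alpha> m k l) i = circle_mean R (newton \<alpha> m k (Suc l)) (\<lambda>w. w ^ i)"
    and entire_newton_dual: "newton_dual \<alpha> m k l holomorphic_on UNIV"
proof -
  have a: "0 \<le> a" using order_trans[OF norm_ge_zero R(1)[of 0]] by simp
  define D where "D = (R - a) ^ newton_degree m k (Suc l)"
  have D: "0 < D" using R by (simp add: D_def)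
  have Q: "D \<le> cmod (newton \<alpha> m k (Suc l) w)" if "cmod w = R" for w
    unfolding D_def using newton_lower[of k \<alpha> a "Suc l" w m] R that by auto
  have s: "(\<lambda>i. circle_mean R (newton \<alpha> m k (Suc l)) (\<lambda>w. w ^ i) / fact i * z ^ i) sums newton_dual \<alpha> m k l z" for z
  proof -
    have Rlt: "cmod (\<alpha> n) < R" if "n \<le> k" for n using R(1)[OF that] R(2) by linarith
    have "(\<lambda>i. z ^ i / fact i * circle_mean R (newton \<alpha> m k (Suc l)) (\<lambda>w. w ^ i))
        sums circle_mean R (newton \<alpha> m k (Suc l)) (\<lambda>w. exp (z * w))"
    proof (rule circle_mean_sums[OF _ _ _ _ D Q])
      show "(\<lambda>i. z ^ i / fact i * w ^ i) sums exp (z * w)" for w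
        using exp_converges[of "z * w"] by (simp add: scaleR_conv_of_real power_mult_distrib field_simps)
      show "continuous_on (sphere 0 R) (newton \<alpha> m k (Suc l))"
        by (rule holomorphic_on_imp_continuous_on[OF entire_newton])
    qed (use R a in \<open>auto intro!: continuous_intros\<close>)
    then show ?thesis using a R Rlt
      by (subst newton_dual_eq_circle_mean[OF inj m Rlt]) (auto simp: mult.commute)
  qed
  show "jet (newton_dual \<alpha> m k l) i = circle_mean R (newton \<alpha> m k (Suc l)) (\<lambda>w. w ^ i)" by (rule jet_eqI[OF s])
  show "newton_dual \<alpha> m k l holomorphic_on UNIV" by (rule entire_if_jet_sums[OF s])
qed

text \<open>Integrated against $p(w)$ over a circle, this expansion of the Cauchy kernel is Newton's
  interpolation formula for $p$.\<close>

lemma newton_kernel: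
  assumes "\<And>n. n < N \<Longrightarrow> w \<noteq> \<alpha> n" "w \<noteq> \<xi>"
  shows "1 / (w - \<xi>) = (\<Sum>k<N. \<Sum>l<m k. newton \<alpha> m k l \<xi> / newton \<alpha> m k (Suc l) w)
    + newton \<alpha> m N 0 \<xi> / (newton \<alpha> m N 0 w * (w - \<xi>))"
  using assms(1)
proof (induction N)
  case 0
  then show ?case by (simp add: newton_def)
next
  case (Suc N)
  have nz: "newton \<alpha> m N l w \<noteq> 0" for l
    unfolding newton_eq_0_iff using Suc.prems less_Suc_eq by blast
  have wN: "w - \<alpha> N \<noteq> 0" using Suc.prems by simp
  \<comment> \<open>Within the block of the node b = \<open>\<alpha> N\<close>, each step applies 1
    / (w - \<xi>) = 1 / (w - b) + (\<xi> - b) / ((w - b) (w - \<xi>)) to the remainder.\<close>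
  have inner: "newton \<alpha> m N 0 \<xi> / (newton \<alpha> m N 0 w * (w - \<xi>))
      = (\<Sum>l<L. newton \<alpha> m N l \<xi> / newton \<alpha> m N (Suc l) w) + newton \<alpha> m N L \<xi> / (newton \<alpha> m N L w * (w - \<xi>))" for L
  proof (induction L)
    case (Suc L)
    have e: "newton \<alpha> m N (Suc L) u = newton \<alpha> m N L u * (u - \<alpha> N)" for u
      using newton_add[of \<alpha> m N L 1 u] by simp
    have "newton \<alpha> m N L \<xi> / (newton \<alpha> m N L w * (w - \<xi>))
        = newton \<alpha> m N L \<xi> / newton \<alpha> m N (Suc L) w + newton \<alpha> m N (Suc L) \<xi> / (newton \<alpha> m N (Suc L) w * (w - \<xi>))"
      using nz[of L] wN assms(2) unfolding e by (simp add: divide_simps) (simp add: algebra_simps)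
    then show ?case using Suc by simp
  qed simp
  show ?case using Suc.IH Suc.prems inner[of "m N"] by (simp add: newton_Suc_block)
qed

text \<open>The remainder comes out as \<open>newton \<alpha> m N 0 \<xi>\<close> times a Cauchy
  integral, thus already in the factored form N q that \<open>key_estimate\<close> asks for.\<close>

lemma newton_interpolation:
  assumes R: "\<And>n. n < N \<Longrightarrow> cmod (\<alpha> n) < R" and \<xi>: "cmod \<xi> < R" and p: "p holomorphic_on UNIV"
  shows "p \<xi> = (\<Sum>k<N. \<Sum>l<m k. newton \<alpha> m k l \<xi> * circle_mean R (newton \<alpha> m k (Suc l)) p)
    + newton \<alpha> m N 0 \<xi> * circle_mean R (\<lambda>w. newton \<alpha> m N 0 w * (w - \<xi>)) p"
proof -
  have R0: "0 < R" using norm_ge_zero[of \<xi>] \<xi> by linarith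
  have wn: "w \<noteq> \<alpha> n" if "cmod w = R" "n < N" for w n using R[OF that(2)] that(1) by auto
  have w\<xi>: "w \<noteq> \<xi>" if "cmod w = R" for w using \<xi> that by auto
  have pc: "continuous_on (sphere 0 R) p"
    using p by (auto intro: holomorphic_on_imp_continuous_on holomorphic_on_subset)
  have nc: "continuous_on (sphere 0 R) (newton \<alpha> m k l)" for k l
    by (rule holomorphic_on_imp_continuous_on[OF entire_newton])
  have i1: "(\<lambda>w. p w / newton \<alpha> m k (Suc l) w) contour_integrable_on circlepath 0 R" if "k < N" for k l
    by (rule circle_integrable[OF pc nc R0]) (metis newton_eq_0_iff wn that less_trans)
  have i2: "(\<lambda>w. p w / (newton \<alpha> m N 0 w * (w - \<xi>))) contour_integrable_on circlepath 0 R"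
    by (rule circle_integrable[OF pc _ R0]) (use wn w\<xi> nc in \<open>auto simp: newton_eq_0_iff intro!: continuous_intros\<close>)
  have hc: "((\<lambda>w. p w / newton \<alpha> m k (Suc l) w) has_contour_integral
      2 * of_real pi * \<i> * circle_mean R (newton \<alpha> m k (Suc l)) p) (circlepath 0 R)" if "k < N" for k l
    using has_contour_integral_integral[OF i1[OF that]] by (simp add: circle_mean_def)
  have hc2: "((\<lambda>w. p w / (newton \<alpha> m N 0 w * (w - \<xi>))) has_contour_integral
      2 * of_real pi * \<i> * circle_mean R (\<lambda>w. newton \<alpha> m N 0 w * (w - \<xi>)) p) (circlepath 0 R)"
    using has_contour_integral_integral[OF i2] by (simp add: circle_mean_def)
  have "((\<lambda>w. (\<Sum>k<N. \<Sum>l<m k. newton \<alpha> m k l \<xi> * (p w / newton \<alpha> m k (Suc l) w))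
        + newton \<alpha> m N 0 \<xi> * (p w / (newton \<alpha> m N 0 w * (w - \<xi>)))) has_contour_integral
      (\<Sum>k<N. \<Sum>l<m k. newton \<alpha> m k l \<xi> * (2 * of_real pi * \<i> * circle_mean R (newton \<alpha> m k (Suc l)) p))
        + newton \<alpha> m N 0 \<xi> * (2 * of_real pi * \<i> * circle_mean R (\<lambda>w. newton \<alpha> m N 0 w * (w - \<xi>)) p)) (circlepath 0 R)"
    by (intro has_contour_integral_add has_contour_integral_sum has_contour_integral_lmul hc hc2) auto
  then have "((\<lambda>w. p w / (w - \<xi>)) has_contour_integral
      (\<Sum>k<N. \<Sum>l<m k. newton \<alpha> m k l \<xi> * (2 * of_real pi * \<i> * circle_mean R (newton \<alpha> m k (Suc l)) p))
        + newton \<alpha> m N 0 \<xi> * (2 * of_real pi * \<i> * circle_mean R (\<lambda>w. newton \<alpha> m N 0 w * (w - \<xi>)) p)) (circlepath 0 R)"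
  proof (rule has_contour_integral_eq)
    fix w assume "w \<in> path_image (circlepath 0 R)"
    then have w: "cmod w = R" using R0 by simp
    have "p w / (w - \<xi>) = p w * (1 / (w - \<xi>))" by simp
    also have "\<dots> = (\<Sum>k<N. \<Sum>l<m k. newton \<alpha> m k l \<xi> * (p w / newton \<alpha> m k (Suc l) w))
        + newton \<alpha> m N 0 \<xi> * (p w / (newton \<alpha> m N 0 w * (w - \<xi>)))"
      by (subst newton_kernel[where N = N and m = m and \<alpha> = \<alpha>])
        (use wn[OF w] w\<xi>[OF w] in \<open>auto simp: distrib_left sum_distrib_left mult_ac\<close>)
    finally show "(\<Sum>k<N. \<Sum>l<m k. newton \<alpha> m k l \<xi> * (p w / newton \<alpha> m k (Suc l) w))
        + newton \<alpha> m N 0 \<xi> * (p w / (newton \<alpha> m N 0 w * (w - \<xi>))) = p w / (w - \<xi>)" by simp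
  qed
  moreover have "((\<lambda>w. p w / (w - \<xi>)) has_contour_integral (2 * of_real pi * \<i> * p \<xi>)) (circlepath 0 R)"
    by (rule Cauchy_integral_circlepath_simple) (use p \<xi> in \<open>auto intro: holomorphic_on_subset\<close>)
  ultimately have "2 * of_real pi * \<i> * p \<xi> =
      (\<Sum>k<N. \<Sum>l<m k. newton \<alpha> m k l \<xi> * (2 * of_real pi * \<i> * circle_mean R (newton \<alpha> m k (Suc l)) p))
        + newton \<alpha> m N 0 \<xi> * (2 * of_real pi * \<i> * circle_mean R (\<lambda>w. newton \<alpha> m N 0 w * (w - \<xi>)) p)"
    by (simp add: has_contour_integral_unique)
  also have "\<dots> = 2 * of_real pi * \<i> * ((\<Sum>k<N. \<Sum>l<m k. newton \<alpha> m k l \<xi> * circle_mean R (newton \<alpha> m k (Suc l)) p)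
    + newton \<alpha> m N 0 \<xi> * circle_mean R (\<lambda>w. newton \<alpha> m N 0 w * (w - \<xi>)) p)"
    by (simp add: distrib_left sum_distrib_left mult_ac)
  finally show ?thesis by simp
qed

lemma circle_mean_cauchy_holomorphic:
  assumes "continuous_on (sphere 0 R) p" "continuous_on (sphere 0 R) Q" "0 < R" "\<And>w. cmod w = R \<Longrightarrow> Q w \<noteq> 0"
  shows "(\<lambda>\<xi>. circle_mean R (\<lambda>w. Q w * (w - \<xi>)) p) holomorphic_on ball 0 R"
proof -
  define F where "F = (\<lambda>\<xi>. contour_integral (circlepath 0 R) (\<lambda>w. p w / (Q w * (w - \<xi>))))"
  have "((\<lambda>w. (p w / Q w) / (w - \<xi>) ^ 1) has_contour_integral F \<xi>) (circlepath 0 R)" if "\<xi> \<in> ball 0 R" for \<xi>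
  proof -
    have "(\<lambda>w. p w / (Q w * (w - \<xi>))) contour_integrable_on circlepath 0 R"
      by (rule circle_integrable[OF assms(1) _ assms(3)]) (use that assms in \<open>auto intro!: continuous_intros\<close>)
    from has_contour_integral_integral[OF this] show ?thesis by (simp add: F_def)
  qed
  moreover have "continuous_on (sphere 0 R) (\<lambda>w. p w / Q w)"
    using assms by (intro continuous_intros) auto
  ultimately have "(F has_field_derivative (1 * contour_integral (circlepath 0 R) (\<lambda>w. (p w / Q w) / (w - \<xi>) ^ Suc 1))) (at \<xi>)"
    if "\<xi> \<in> ball 0 R" for \<xi>
    using Cauchy_next_derivative_circlepath(2)[of 0 R "\<lambda>w. p w / Q w" 1 F \<xi>] that assms(3) by simp
  then have "F holomorphic_on ball 0 R"
    unfolding holomorphic_on_open[OF open_ball] by blast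
  then show ?thesis unfolding circle_mean_def F_def by (intro holomorphic_intros) auto
qed

context growth_weight
begin

section \<open>Absolutely convergent series in the space of entire functions\<close>

lemma
  assumes t: "\<And>k. t k \<in> F_space \<theta>" and s: "\<And>q. 0 < q \<Longrightarrow> summable (\<lambda>k. wnorm q (t k))"
    and q: "0 < q"
  shows series_jet_summable: "summable (\<lambda>k. cmod (jet (t k) i))"
    and series_tail_le: "summable (\<lambda>i. cmod (\<Sum>k. jet (t (k + n)) i) * q ^ i / peak i)"
      "(\<Sum>i. cmod (\<Sum>k. jet (t (k + n)) i) * q ^ i / peak i) \<le> (\<Sum>k. wnorm q (t (k + n)))"
proof -
  define u where "u = (\<lambda>n k i. cmod (jet (t (k + n)) i) * q ^ i / peak i)"
  have w: "0 < q ^ i / peak i" for i using q by simp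
  have u0: "0 \<le> u n k i" for n k i using q by (simp add: u_def)
  have nu: "norm (u n k i) = u n k i" for n k i using u0[of n k i] by simp
  have 1: "summable (\<lambda>i. norm (u n k i))" for n k
    using F_wsummable[OF t q, of "k + n"] unfolding nu by (simp add: u_def wsummable_def)
  have 2: "(\<Sum>i. norm (u n k i)) = wnorm q (t (k + n))" for n k
    unfolding nu by (simp add: u_def wnorm_def)
  have 3: "summable (\<lambda>k. \<Sum>i. norm (u n k i))" for n
    unfolding 2 by (rule summable_ignore_initial_segment[OF s[OF q]])
  have jets: "summable (\<lambda>k. cmod (jet (t (k + n)) i))" for n i
  proof -
    have "summable (\<lambda>k. u n k i / (q ^ i / peak i))"
      using double_series_summable[OF 1 3, of n i] unfolding nu by (rule summable_divide)
    then show ?thesis using q by (simp add: u_def)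
  qed
  show "summable (\<lambda>k. cmod (jet (t k) i))" using jets[of 0 i] by simp
  have sw: "(\<lambda>i. \<Sum>k. u n k i) sums (\<Sum>k. wnorm q (t (k + n)))" for n
    using double_series_swap[OF 1 3, of n] 2[of n] unfolding nu by simp
  \<comment> \<open>The norm of the coefficientwise tail is at most the tail of the norms: the
    triangle inequality in k, followed by the interchange \<open>sw\<close> of the sums over i and
    k.\<close>
  have le: "cmod (\<Sum>k. jet (t (k + n)) i) * q ^ i / peak i \<le> (\<Sum>k. u n k i)" for n i
  proof -
    have "cmod (\<Sum>k. jet (t (k + n)) i) * (q ^ i / peak i) \<le> (\<Sum>k. cmod (jet (t (k + n)) i)) * (q ^ i / peak i)"
      using w by (intro mult_right_mono summable_norm jets) (auto intro: less_imp_le)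
    also have "\<dots> = (\<Sum>k. cmod (jet (t (k + n)) i) * (q ^ i / peak i))"
      by (rule suminf_mult2[OF jets])
    finally show ?thesis by (simp add: u_def)
  qed
  show sm: "summable (\<lambda>i. cmod (\<Sum>k. jet (t (k + n)) i) * q ^ i / peak i)"
    by (rule summable_comparison_test'[OF sums_summable[OF sw[of n]]]) (use le q in auto)
  show "(\<Sum>i. cmod (\<Sum>k. jet (t (k + n)) i) * q ^ i / peak i) \<le> (\<Sum>k. wnorm q (t (k + n)))"
    using suminf_le[OF le sm sums_summable[OF sw]] sums_unique[OF sw] by simp
qed

text \<open>Completeness along series. The limit is built from the coefficient sums A i, whose decay
  makes the power series converge everywhere because \<open>peak i\<close> is at most a constant
  times i!.\<close>

lemma series_in_F:
  assumes t: "\<And>k. t k \<in> F_space \<theta>" and s: "\<And>q. 0 < q \<Longrightarrow> summable (\<lambda>k. wnorm q (t k))"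
  obtains f where "f \<in> F_space \<theta>" "\<And>i. (\<lambda>k. jet (t k) i) sums jet f i"
proof -
  define A where "A = (\<lambda>i. \<Sum>k. jet (t k) i)"
  define f where "f = (\<lambda>z. \<Sum>i. A i / fact i * z ^ i)"
  have A: "summable (\<lambda>i. cmod (A i) * q ^ i / peak i)" if "0 < q" for q
    using series_tail_le(1)[OF t s that, of 0] by (simp add: A_def)
  have pk: "peak i \<le> fact i * exp offset" for i by (rule peak_least[OF peak_bound])
  have fs: "(\<lambda>i. A i / fact i * z ^ i) sums f z" for z
  proof -
    define q where "q = cmod z + 1"
    have q: "0 < q" by (simp add: q_def add_nonneg_pos)
    have "summable (\<lambda>i. A i / fact i * z ^ i)"
    proof (rule summable_comparison_test'[OF summable_mult[OF A[OF q], of "exp offset"], of 0])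
      fix i
      have "cmod (A i / fact i * z ^ i) \<le> cmod (A i) * (q ^ i / fact i)"
        by (auto simp: norm_mult norm_divide norm_power q_def intro!: mult_left_mono divide_right_mono power_mono)
      also have "\<dots> \<le> cmod (A i) * (exp offset * q ^ i / peak i)"
        using pk[of i] q by (intro mult_left_mono) (auto simp: field_simps)
      finally show "norm (A i / fact i * z ^ i) \<le> exp offset * (cmod (A i) * q ^ i / peak i)"
        by (simp add: mult_ac)
    qed
    then show ?thesis by (simp add: f_def summable_sums)
  qed
  have jf: "jet f i = A i" for i by (rule jet_eqI[OF fs])
  have "f \<in> F_space \<theta>"
    using entire_if_jet_sums[OF fs] A by (simp add: F_space_iff wsummable_def jf)
  moreover have "(\<lambda>k. jet (t k) i) sums jet f i" for i
    unfolding jf A_def by (rule summable_sums[OF summable_norm_cancel[OF series_jet_summable[OF t s zero_less_one]]])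
  ultimately show ?thesis using that by blast
qed

lemma series_wnorm_tendsto:
  assumes t: "\<And>k. t k \<in> F_space \<theta>" and s: "\<And>q. 0 < q \<Longrightarrow> summable (\<lambda>k. wnorm q (t k))"
    and f: "f \<in> F_space \<theta>" "\<And>i. (\<lambda>k. jet (t k) i) sums jet f i" and q: "0 < q"
  shows "(\<lambda>n. wnorm q (\<lambda>z. (\<Sum>k<n. t k z) - f z)) \<longlonglongrightarrow> 0"
proof -
  have sF: "(\<lambda>z. \<Sum>k<n. t k z) \<in> F_space \<theta>" for n by (intro F_sum t) auto
  have jt: "cmod (jet (\<lambda>z. (\<Sum>k<n. t k z) - f z) i) = cmod (\<Sum>k. jet (t (k + n)) i)" for n i
  proof -
    have "jet (\<lambda>z. (\<Sum>k<n. t k z) - f z) i = (\<Sum>k<n. jet (t k) i) - jet f i"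
      by (simp add: jet_diff[OF F_entire[OF sF] F_entire[OF f(1)]] jet_sum[OF F_entire[OF t]])
    moreover have "(\<Sum>k. jet (t (k + n)) i) = jet f i - (\<Sum>k<n. jet (t k) i)"
      using sums_split_initial_segment[OF f(2)] by (simp add: sums_iff)
    ultimately show ?thesis by (simp add: norm_minus_commute)
  qed
  have le: "norm (wnorm q (\<lambda>z. (\<Sum>k<n. t k z) - f z)) \<le> (\<Sum>k. wnorm q (t (k + n)))" for n
    using series_tail_le(2)[OF t s q, of n] wnorm_nonneg[OF _ F_wsummable[OF F_diff[OF sF[of n] f(1)] q]] q
    by (simp add: wnorm_def jt)
  have "(\<lambda>n. \<Sum>k. wnorm q (t (k + n))) \<longlonglongrightarrow> 0"
    by (rule suminf_exist_split2[OF s[OF q]])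
  then show ?thesis by (rule Lim_null_comparison[OF always_eventually, OF allI, OF le])
qed

lemma dual_series:
  assumes S: "S \<in> F_dual \<theta>" and t: "\<And>k. t k \<in> F_space \<theta>"
    and s: "\<And>q. 0 < q \<Longrightarrow> summable (\<lambda>k. wnorm q (t k))"
    and f: "f \<in> F_space \<theta>" "\<And>i. (\<lambda>k. jet (t k) i) sums jet f i"
  shows "(\<lambda>k. S (t k)) sums S f"
proof -
  obtain C q where Cq: "0 < C" "0 < q" "\<And>f. f \<in> F_space \<theta> \<Longrightarrow> cmod (S f) \<le> C * wnorm q f"
    using dual_bound[OF S] by blast
  have sF: "(\<lambda>z. \<Sum>k<n. t k z) \<in> F_space \<theta>" for n by (intro F_sum t) auto
  have "norm ((\<Sum>k<n. S (t k)) - S f) \<le> C * wnorm q (\<lambda>z. (\<Sum>k<n. t k z) - f z)" for n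
  proof -
    have "(\<Sum>k<n. S (t k)) = S (\<lambda>z. ((\<Sum>k<n. t k z) - f z) + f z)" using dual_sum[OF S, of "{..<n}" t] t by simp
    also have "\<dots> = S (\<lambda>z. (\<Sum>k<n. t k z) - f z) + S f" by (rule dual_add[OF S F_diff[OF sF f(1)] f(1)])
    finally show ?thesis using Cq(3)[OF F_diff[OF sF f(1)]] by simp
  qed
  moreover have "(\<lambda>n. C * wnorm q (\<lambda>z. (\<Sum>k<n. t k z) - f z)) \<longlonglongrightarrow> 0"
    using tendsto_mult_right_zero[OF series_wnorm_tendsto[OF t s f Cq(2)]] by simp
  ultimately have "(\<lambda>n. (\<Sum>k<n. S (t k)) - S f) \<longlonglongrightarrow> 0"
    by (rule Lim_null_comparison[OF always_eventually, OF allI])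
  then show ?thesis unfolding sums_def by (rule LIM_zero_cancel)
qed

text \<open>On the circle of radius 2 a + 1 each of the \<open>newton_degree m k l + 1\<close>
  linear factors of the denominator is at least a + 1. One of them compensates the length of the
  circle; the remaining power is the weight in the condition on the coefficients.\<close>

lemma
  assumes inj: "inj_on \<alpha> {..k}" and m: "\<And>n. n < k \<Longrightarrow> 0 < m n"
    and a: "\<And>n. n \<le> k \<Longrightarrow> cmod (\<alpha> n) \<le> a"
  shows newton_dual_in_F: "newton_dual \<alpha> m k l \<in> F_space \<theta>"
    and wnorm_newton_dual_le: "0 < q \<Longrightarrow> wnorm q (newton_dual \<alpha> m k l)
      \<le> 4 * exp (\<theta> (4 * q)) * exp (\<theta> (8 * q * a)) / (a + 1) ^ newton_degree m k l"
    and pair_newton_dual: "g holomorphic_on UNIV \<Longrightarrow> a < R \<Longrightarrow>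
      pair g (newton_dual \<alpha> m k l) = circle_mean R (newton \<alpha> m k (Suc l)) g"
proof -
  have a0: "0 \<le> a" using order_trans[OF norm_ge_zero a[of 0]] by simp
  let ?d = "newton_degree m k l"
  have dS: "newton_degree m k (Suc l) = Suc ?d" by (simp add: newton_degree_def)
  have nc: "continuous_on (sphere 0 R) (newton \<alpha> m k (Suc l))" for R
    by (rule holomorphic_on_imp_continuous_on[OF entire_newton])
  have lower: "(R - a) ^ Suc ?d \<le> cmod (newton \<alpha> m k (Suc l) w)" if "cmod w = R" "a < R" for w R
    using newton_lower[of k \<alpha> a "Suc l" w m] a that by (auto simp: dS)
  have jt: "jet (newton_dual \<alpha> m k l) i = circle_mean R (newton \<alpha> m k (Suc l)) (\<lambda>w. w ^ i)" if "a < R" for i R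
    by (rule jet_newton_dual[OF inj m a that])
  have hol: "newton_dual \<alpha> m k l holomorphic_on UNIV"
    by (rule entire_newton_dual[OF inj m a, where R = "a + 1"]) auto
  have jb: "cmod (jet (newton_dual \<alpha> m k l) i) \<le> 2 * (2 * a + 1) ^ i / (a + 1) ^ ?d" for i
  proof -
    have "cmod (jet (newton_dual \<alpha> m k l) i) \<le> (2 * a + 1) ^ i * (2 * a + 1) / (a + 1) ^ Suc ?d"
    proof (subst jt[of "2 * a + 1"])
      show "cmod (circle_mean (2 * a + 1) (newton \<alpha> m k (Suc l)) (\<lambda>w. w ^ i))
          \<le> (2 * a + 1) ^ i * (2 * a + 1) / (a + 1) ^ Suc ?d"
      proof (rule circle_mean_le[OF _ nc])
        fix w :: complex assume "cmod w = 2 * a + 1"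
        then show "(a + 1) ^ Suc ?d \<le> cmod (newton \<alpha> m k (Suc l) w)" using lower[of w "2 * a + 1"] a0 by simp
      qed (use a0 in \<open>auto simp: norm_power intro!: continuous_intros\<close>)
    qed (use a0 in auto)
    also have "\<dots> \<le> (2 * a + 1) ^ i * (2 * (a + 1)) / (a + 1) ^ Suc ?d"
      using a0 by (intro divide_right_mono mult_left_mono) auto
    also have "\<dots> = 2 * (2 * a + 1) ^ i / (a + 1) ^ ?d"
    proof -
      have "x * (2 * c) / c ^ Suc n = 2 * x / c ^ n" if "c \<noteq> 0" for x c :: real and n using that by simp
      then show ?thesis using a0 by (metis add_nonneg_pos less_numeral_extra(1,3))
    qed
    finally show ?thesis .
  qed
  have main: "wsummable q (newton_dual \<alpha> m k l) \<and> wnorm q (newton_dual \<alpha> m k l)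
      \<le> 4 * exp (\<theta> (4 * q)) * exp (\<theta> (8 * q * a)) / (a + 1) ^ ?d" if q: "0 < q" for q
  proof -
    define x where "x = q * (2 * a + 1)"
    have x: "0 \<le> x" using q a0 by (simp add: x_def)
    have le: "cmod (jet (newton_dual \<alpha> m k l) i) * q ^ i / peak i \<le> 2 / (a + 1) ^ ?d * (x ^ i / peak i)" for i
    proof -
      have "cmod (jet (newton_dual \<alpha> m k l) i) * (q ^ i / peak i) \<le> 2 * (2 * a + 1) ^ i / (a + 1) ^ ?d * (q ^ i / peak i)"
        using q by (intro mult_right_mono jb) auto
      then show ?thesis by (simp add: x_def power_mult_distrib mult_ac)
    qed
    have g: "summable (\<lambda>i. 2 / (a + 1) ^ ?d * (x ^ i / peak i))" by (intro summable_mult peak_series_summable x)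
    have w: "wsummable q (newton_dual \<alpha> m k l)" unfolding wsummable_def
      by (rule summable_comparison_test'[OF g, of 0]) (use le q in auto)
    have "wnorm q (newton_dual \<alpha> m k l) \<le> 2 / (a + 1) ^ ?d * (\<Sum>i. x ^ i / peak i)"
      unfolding wnorm_def suminf_mult[OF peak_series_summable[OF x], symmetric]
      by (rule suminf_le[OF le w[unfolded wsummable_def] g])
    also have "\<dots> \<le> 2 / (a + 1) ^ ?d * (2 * exp (\<theta> (2 * x)))"
      using a0 by (intro mult_left_mono peak_series_le x) auto
    also have "\<dots> \<le> 2 / (a + 1) ^ ?d * (2 * exp (\<theta> (4 * q) + \<theta> (8 * q * a)))"
    proof -
      \<comment> \<open>Superadditivity bounds \<theta> of a sum only from below. So the summands 4
        q a and 2 q of 2 x are compared, and twice the larger one is taken.\<close>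
      have "\<theta> (2 * x) \<le> \<theta> (4 * q) + \<theta> (8 * q * a)"
      proof (cases "1 \<le> 2 * a")
        case True
        have "2 * x \<le> 8 * q * a" using mult_left_mono[OF True, of "2 * q"] q by (simp add: x_def algebra_simps)
        then have "\<theta> (2 * x) \<le> \<theta> (8 * q * a)" using x by (intro theta_mono) auto
        then show ?thesis using q theta_nonneg[of "4 * q"] by linarith
      next
        case False
        have "2 * x \<le> 4 * q" using mult_left_mono[of "2 * a" 1 "2 * q"] False q by (simp add: x_def algebra_simps)
        then have "\<theta> (2 * x) \<le> \<theta> (4 * q)" using x by (intro theta_mono) auto
        moreover have "0 \<le> \<theta> (8 * q * a)" using q a0 by (intro theta_nonneg) auto
        ultimately show ?thesis by linarith
      qed
      then show ?thesis using a0 by (intro mult_left_mono) auto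
    qed
    finally show ?thesis using w by (simp add: exp_add mult_ac)
  qed
  show "newton_dual \<alpha> m k l \<in> F_space \<theta>" using hol main by (simp add: F_space_iff)
  show "0 < q \<Longrightarrow> wnorm q (newton_dual \<alpha> m k l)
      \<le> 4 * exp (\<theta> (4 * q)) * exp (\<theta> (8 * q * a)) / (a + 1) ^ ?d" using main by blast
  show "pair g (newton_dual \<alpha> m k l) = circle_mean R (newton \<alpha> m k (Suc l)) g"
    if "g holomorphic_on UNIV" "a < R"
  proof -
    have "(\<lambda>i. jet g i / fact i * circle_mean R (newton \<alpha> m k (Suc l)) (\<lambda>w. w ^ i))
        sums circle_mean R (newton \<alpha> m k (Suc l)) g"
      by (rule circle_mean_sums[OF jet_sums[OF that(1)] _ nc, where D = "(R - a) ^ Suc ?d"])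
        (use that a0 lower in \<open>auto intro: holomorphic_on_imp_continuous_on holomorphic_on_subset\<close>)
    then show ?thesis by (simp add: shift_pair_def jt[OF that(2)] sums_iff)
  qed
qed

lemma gclass_newton: "gclass (newton \<alpha> m k l)"
  unfolding newton_def[abs_def]
  by (intro gclass_mult gclass_prod gclass_power gclass_diff gclass_id gclass_const) auto

end

text \<open>Zeros are divided out one at a time. Near the new zero z the quotient is g / N, with g
  the local zero-free factor of \<Phi> and N the product over the earlier zeros, which does not
  vanish there; away from z it is a plain quotient, and the two expressions glue.\<close>

lemma zero_enumeration_factor:
  assumes hol: "\<Phi> holomorphic_on UNIV" and nz: "\<exists>z. \<Phi> z \<noteq> 0"
    and Z: "zero_enumeration \<Phi> K \<alpha> m" and N: "{..<N} \<subseteq> K"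
  obtains G where "G holomorphic_on UNIV" "\<And>\<xi>. \<Phi> \<xi> = newton \<alpha> m N 0 \<xi> * G \<xi>"
    "\<And>\<xi>. G \<xi> = 0 \<Longrightarrow> \<exists>k\<in>K. N \<le> k \<and> \<xi> = \<alpha> k"
proof -
  have inj: "inj_on \<alpha> K" and im: "\<alpha> ` K = {\<xi>. \<Phi> \<xi> = 0}" and mk: "\<And>k. k \<in> K \<Longrightarrow> m k = nat (zorder \<Phi> (\<alpha> k))"
    using Z by (auto simp: zero_enumeration_def bij_betw_def)
  have "\<exists>G. G holomorphic_on UNIV \<and> (\<forall>\<xi>. \<Phi> \<xi> = newton \<alpha> m N 0 \<xi> * G \<xi>) \<and> (\<forall>j<N. G (\<alpha> j) \<noteq> 0)"
    using N
  proof (induction N)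
    case 0
    show ?case using hol by (intro exI[of _ \<Phi>]) (auto simp: newton_def)
  next
    case (Suc N)
    then obtain G where G: "G holomorphic_on UNIV" "\<And>\<xi>. \<Phi> \<xi> = newton \<alpha> m N 0 \<xi> * G \<xi>"
      "\<And>j. j < N \<Longrightarrow> G (\<alpha> j) \<noteq> 0" by (auto simp: lessThan_Suc)
    define z where "z = \<alpha> N"
    have NK: "N \<in> K" using Suc.prems by auto
    have \<Phi>z: "\<Phi> z = 0" using im NK by (auto simp: z_def)
    have dist: "\<alpha> j \<noteq> z" if "j < N" for j
    proof -
      have "j \<in> K" using that Suc.prems by auto
      then show ?thesis using inj_onD[OF inj, of j N] that NK by (auto simp: z_def)
    qed
    define g where "g = zor_poly \<Phi> z"
    obtain r where zo: "0 < zorder \<Phi> z" and r: "0 < r" "g holomorphic_on cball z r"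
      "\<And>w. w \<in> cball z r \<Longrightarrow> \<Phi> w = g w * (w - z) ^ m N \<and> g w \<noteq> 0"
    proof -
      have "0 < zorder \<Phi> z \<and> (\<exists>r>0. g holomorphic_on cball z r
          \<and> (\<forall>w\<in>cball z r. \<Phi> w = g w * (w - z) ^ nat (zorder \<Phi> z) \<and> g w \<noteq> 0))"
        using zorder_exist_zero[OF hol open_UNIV connected_UNIV UNIV_I, of z] nz \<Phi>z by (simp add: g_def)
      then show ?thesis using that mk[OF NK] by (auto simp: z_def)
    qed
    have mN: "0 < m N" using zo mk[OF NK] by (simp add: z_def)
    have Nz: "newton \<alpha> m N 0 z \<noteq> 0" using dist by (auto simp: newton_eq_0_iff)
    have Nw: "newton \<alpha> m N 0 w \<noteq> 0" if "w \<in> cball z r" for w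
    proof (cases "w = z")
      case False
      then have "\<Phi> w \<noteq> 0" using r(3)[OF that] by simp
      then show ?thesis using G(2)[of w] by auto
    qed (use Nz in simp)
    define G' where "G' = (\<lambda>w. if w = z then g z / newton \<alpha> m N 0 z else G w / (w - z) ^ m N)"
    have "G' holomorphic_on (UNIV - {z}) \<union> ball z r"
    proof (rule holomorphic_on_Un)
      have "(\<lambda>w. G w / (w - z) ^ m N) holomorphic_on UNIV - {z}"
        by (intro holomorphic_intros holomorphic_on_subset[OF G(1)]) auto
      then show "G' holomorphic_on UNIV - {z}"
        by (rule holomorphic_transform) (auto simp: G'_def)
      have "(\<lambda>w. g w / newton \<alpha> m N 0 w) holomorphic_on ball z r"
        using Nw by (intro holomorphic_intros entire_newton holomorphic_on_subset[OF r(2)]) auto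
      then show "G' holomorphic_on ball z r"
      proof (rule holomorphic_transform)
        fix w assume w: "w \<in> ball z r"
        show "g w / newton \<alpha> m N 0 w = G' w"
        proof (cases "w = z")
          case False
          have "newton \<alpha> m N 0 w * G w = g w * (w - z) ^ m N" using G(2)[of w] r(3)[of w] w by simp
          then show ?thesis using Nw[of w] w False by (simp add: G'_def field_simps)
        qed (simp add: G'_def)
      qed
    qed auto
    moreover have "(UNIV - {z}) \<union> ball z r = UNIV" using r(1) by auto
    moreover have "\<Phi> \<xi> = newton \<alpha> m (Suc N) 0 \<xi> * G' \<xi>" for \<xi>
    proof (cases "\<xi> = z")
      case True
      then show ?thesis using \<Phi>z mN by (simp add: newton_def z_def)
    next
      case False
      then show ?thesis unfolding G(2)[of \<xi>] by (simp add: newton_def G'_def z_def)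
    qed
    moreover have "G' (\<alpha> j) \<noteq> 0" if "j < Suc N" for j
    proof (cases "j = N")
      case True
      then show ?thesis using r(3)[of z] r(1) Nz by (simp add: G'_def z_def)
    next
      case False
      then show ?thesis using that dist[of j] G(3)[of j] by (simp add: G'_def)
    qed
    ultimately show ?case by (intro exI[of _ G']) auto
  qed
  then obtain G where G: "G holomorphic_on UNIV" "\<And>\<xi>. \<Phi> \<xi> = newton \<alpha> m N 0 \<xi> * G \<xi>"
    "\<And>j. j < N \<Longrightarrow> G (\<alpha> j) \<noteq> 0" by blast
  have "\<exists>k\<in>K. N \<le> k \<and> \<xi> = \<alpha> k" if "G \<xi> = 0" for \<xi>
  proof -
    have "\<xi> \<in> \<alpha> ` K" using im G(2)[of \<xi>] that by auto
    then obtain k where "k \<in> K" "\<xi> = \<alpha> k" by blast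
    then show ?thesis using G(3)[of k] that by (metis not_le)
  qed
  with G that show ?thesis by blast
qed

section \<open>The expansion\<close>

locale conv_equation = growth_weight +
  fixes T :: "(complex \<Rightarrow> complex) \<Rightarrow> complex" and \<Phi> :: "complex \<Rightarrow> complex"
    and K :: "nat set" and \<alpha> :: "nat \<Rightarrow> complex" and m :: "nat \<Rightarrow> nat"
  assumes T: "T \<in> F_dual \<theta>" and T_nonzero: "\<exists>f\<in>F_space \<theta>. T f \<noteq> 0"
    and \<Phi>: "\<Phi> = fourier_borel T" and zeros: "zero_enumeration \<Phi> K \<alpha> m"
begin

lemma gclass_\<Phi>: "gclass \<Phi>"
  unfolding \<Phi> gclass_def using coeff_growth_fourier_borel[OF T] by blast

lemma ex_\<Phi>_base: "\<exists>z. cmod z \<le> 1 \<and> \<Phi> z \<noteq> 0"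
proof -
  obtain f where f: "f \<in> F_space \<theta>" "T f \<noteq> 0" using T_nonzero by blast
  have "\<exists>i. jet \<Phi> i \<noteq> 0"
  proof (rule ccontr)
    assume "\<not> ?thesis"
    then have "T f = 0" using dual_eq_pair[OF T f(1)] by (simp add: \<Phi> shift_pair_def)
    with f(2) show False by simp
  qed
  then show ?thesis using ex_base_point[OF gclass_entire[OF gclass_\<Phi>]] by metis
qed

lemma K_cases: "K = UNIV \<or> (\<exists>N. K = {..<N})"
  and inj_\<alpha>: "inj_on \<alpha> K"
  and zeros_image: "\<alpha> ` K = {\<xi>. \<Phi> \<xi> = 0}"
  and \<alpha>_mono: "k \<in> K \<Longrightarrow> j \<le> k \<Longrightarrow> cmod (\<alpha> j) \<le> cmod (\<alpha> k)"
  using zeros by (auto simp: zero_enumeration_def bij_betw_def)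

lemma K_down: "k \<in> K \<Longrightarrow> j \<le> k \<Longrightarrow> j \<in> K"
  using K_cases by auto

lemma inj_below: "k \<in> K \<Longrightarrow> inj_on \<alpha> {..k}"
  using inj_\<alpha> K_down by (auto simp: inj_on_def)

lemma m_pos: "k \<in> K \<Longrightarrow> 0 < m k"
proof -
  assume k: "k \<in> K"
  then have "\<Phi> (\<alpha> k) = 0" using zeros_image by auto
  then have "0 < zorder \<Phi> (\<alpha> k)"
    using zorder_exist_zero[OF gclass_entire[OF gclass_\<Phi>] open_UNIV connected_UNIV UNIV_I, of "\<alpha> k"] ex_\<Phi>_base by auto
  then show ?thesis using zeros k by (simp add: zero_enumeration_def)
qed

lemma factor:
  assumes "{..<N} \<subseteq> K"
  obtains G where "G holomorphic_on UNIV" "\<And>\<xi>. \<Phi> \<xi> = newton \<alpha> m N 0 \<xi> * G \<xi>"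
    "\<And>\<xi>. G \<xi> = 0 \<Longrightarrow> \<exists>k\<in>K. N \<le> k \<and> \<xi> = \<alpha> k"
  using zero_enumeration_factor[OF gclass_entire[OF gclass_\<Phi>] _ zeros assms] ex_\<Phi>_base by metis

text \<open>A form of Jensen's inequality, counting multiplicities: \<open>cofactor_count\<close>
  gives 2^n \<le> M / |\<Phi>(z0)|, and ln M is at most a constant plus \<theta>(4 p a).\<close>

lemma zero_count:
  obtains c where "0 \<le> c"
    "\<And>N a. {..<N} \<subseteq> K \<Longrightarrow> 0 \<le> a \<Longrightarrow> (\<And>n. n < N \<Longrightarrow> cmod (\<alpha> n) \<le> a) \<Longrightarrow> dominated c a (\<Sum>n<N. m n)"
proof -
  obtain z0 where z0: "cmod z0 \<le> 1" "\<Phi> z0 \<noteq> 0" using ex_\<Phi>_base by blast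
  obtain B0 p where B0: "0 < B0" and p: "0 < p"
    and growth0: "\<And>\<xi>. cmod (\<Phi> \<xi>) \<le> B0 * exp (\<theta> (p * cmod \<xi>))"
    using gclassE[OF gclass_\<Phi>] by blast
  define B where "B = max B0 1"
  have B: "1 \<le> B" by (simp add: B_def)
  define c1 where "c1 = ln B + \<theta> (8 * p) + \<bar>ln (cmod (\<Phi> z0))\<bar>"
  have c1: "0 \<le> c1" using B p by (simp add: c1_def)
  define c where "c = 2 * c1 + 8 * p"
  show ?thesis
  proof (rule that[of c])
    show "0 \<le> c" using c1 p by (simp add: c_def)
    fix N a assume N: "{..<N} \<subseteq> K" and a: "0 \<le> a" and \<alpha>a: "\<And>n. n < N \<Longrightarrow> cmod (\<alpha> n) \<le> a"
    obtain G where G: "G holomorphic_on UNIV" "\<And>\<xi>. \<Phi> \<xi> = newton \<alpha> m N 0 \<xi> * G \<xi>"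
      by (rule factor[OF N]) (rule that)
    define n where "n = newton_degree m N 0"
    define M where "M = B * exp (\<theta> (8 * p) + \<theta> (4 * p * a))"
    have "cmod (\<Phi> \<xi>) \<le> M" if "cmod \<xi> \<le> 3 * a + 2" for \<xi>
    proof -
      \<comment> \<open>As a may be small here, two cases are needed: |\<xi>| \<le> 3 a + 2 implies
        |\<xi>| \<le> 8 or |\<xi>| \<le> 4 a.\<close>
      have "\<theta> (p * cmod \<xi>) \<le> \<theta> (8 * p) + \<theta> (4 * p * a)"
      proof (cases "cmod \<xi> \<le> 8")
        case True
        then have "\<theta> (p * cmod \<xi>) \<le> \<theta> (p * 8)" using p by (intro theta_mono mult_left_mono) auto
        moreover have "0 \<le> \<theta> (4 * p * a)" using p a by (intro theta_nonneg) auto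
        ultimately show ?thesis by (simp add: mult.commute)
      next
        case False
        then have "cmod \<xi> \<le> 4 * a" using that by simp
        then have "\<theta> (p * cmod \<xi>) \<le> \<theta> (p * (4 * a))" using p by (intro theta_mono mult_left_mono) auto
        moreover have "0 \<le> \<theta> (8 * p)" using p by (intro theta_nonneg) auto
        ultimately show ?thesis by (simp add: mult_ac)
      qed
      then have "B0 * exp (\<theta> (p * cmod \<xi>)) \<le> M"
        unfolding M_def B_def using B0 by (intro mult_mono) auto
      then show ?thesis using growth0 order_trans by blast
    qed
    then have "cmod (\<Phi> z0) * 2 ^ n \<le> M"
      using cofactor_count[OF G newton_lower[of N \<alpha> a 0 _ m, folded n_def] newton_upper[of N \<alpha> a 0 m, folded n_def] a _ z0] \<alpha>a by blast
    then have "ln (cmod (\<Phi> z0) * 2 ^ n) \<le> ln M" using z0 B by (subst ln_le_cancel_iff) (auto simp: M_def)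
    then have "ln (cmod (\<Phi> z0)) + n * ln 2 \<le> ln B + \<theta> (8 * p) + \<theta> (4 * p * a)"
      using z0 B by (simp add: ln_mult ln_realpow M_def)
    then have "n * ln 2 \<le> c1 + \<theta> (4 * p * a)" by (simp add: c1_def)
    moreover have "1/2 \<le> ln (2::real)" by (rule order_trans[OF _ ln2_ge_two_thirds]) simp
    then have "real n * (1/2) \<le> n * ln 2" by (intro mult_left_mono) auto
    ultimately have "n \<le> 2 * c1 + 2 * \<theta> (4 * p * a)" by simp
    also have "\<dots> \<le> 2 * c1 + \<theta> (8 * p * a)" using theta_scale[of 2 "4 * p * a"] p a by (simp add: mult_ac)
    finally have n_le: "n \<le> 2 * c1 + \<theta> (8 * p * a)" .
    have "dominated (2 * c1 + 8 * p) a (2 * c1 + \<theta> (8 * p * a))"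
      by (rule dominated_add[OF dominated_const dominated_theta]) (use c1 p a in auto)
    with n_le have "dominated (2 * c1 + 8 * p) a n" unfolding dominated_def by linarith
    then show "dominated c a (\<Sum>n<N. m n)" by (simp add: c_def n_def newton_degree_def)
  qed
qed

section \<open>Convergence of the series under the coefficient condition, and its sum as a
  solution\<close>

lemma expansion_term_eq: "expansion_term \<alpha> m c k = (\<lambda>z. \<Sum>l<m k. c k l * newton_dual \<alpha> m k l z)"
  by (simp add: expansion_term_def newton_dual_def fun_eq_iff)

definition weighted_coeff :: "real \<Rightarrow> (nat \<Rightarrow> nat \<Rightarrow> complex) \<Rightarrow> nat \<Rightarrow> real" where
  "weighted_coeff r c k = exp (\<theta> (r * cmod (\<alpha> k))) *
     (\<Sum>l<m k. cmod (c k l) / (cmod (\<alpha> k) + 1) ^ newton_degree m k l)"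

lemma weighted_coeff_nonneg: "0 \<le> weighted_coeff r c k"
  by (auto simp: weighted_coeff_def intro!: mult_nonneg_nonneg sum_nonneg)

text \<open>For non-negative terms, unordered summability over K is the same as convergence of the
  series padded by zero outside K.\<close>

lemma coeff_condition_iff:
  "coeff_condition \<theta> K \<alpha> m c \<longleftrightarrow> (\<forall>r>0. summable (\<lambda>k. if k \<in> K then weighted_coeff r c k else 0))"
proof -
  have "weighted_coeff r c summable_on K \<longleftrightarrow> summable (\<lambda>k. if k \<in> K then weighted_coeff r c k else 0)" for r
  proof -
    have "weighted_coeff r c summable_on K \<longleftrightarrow> (\<lambda>k. if k \<in> K then weighted_coeff r c k else 0) summable_on UNIV"
      by (rule summable_on_cong_neutral) auto
    then show ?thesis by (simp add: summable_on_UNIV_nonneg_real_iff weighted_coeff_nonneg)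
  qed
  then show ?thesis unfolding coeff_condition_def weighted_coeff_def[abs_def] newton_degree_def by simp
qed

text \<open>Padding by the zero function turns finite and infinite enumerations of zeros into one
  kind of series over the naturals.\<close>

definition term_fun :: "(nat \<Rightarrow> nat \<Rightarrow> complex) \<Rightarrow> nat \<Rightarrow> complex \<Rightarrow> complex" where
  "term_fun c k = (if k \<in> K then expansion_term \<alpha> m c k else (\<lambda>z. 0))"

lemma newton_dual_K: "k \<in> K \<Longrightarrow> newton_dual \<alpha> m k l \<in> F_space \<theta>"
  using newton_dual_in_F[OF inj_below, of k m "cmod (\<alpha> k)" l] m_pos K_down \<alpha>_mono by (simp add: less_imp_le)

lemma term_fun_in_F: "term_fun c k \<in> F_space \<theta>"
  by (auto simp: term_fun_def expansion_term_eq F_zero intro!: F_sum F_cmult newton_dual_K)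

lemma jet_term_fun:
  "jet (term_fun c k) i = (if k \<in> K then \<Sum>l<m k. c k l * jet (newton_dual \<alpha> m k l) i else 0)"
proof (cases "k \<in> K")
  case True
  have h: "newton_dual \<alpha> m k l holomorphic_on UNIV" for l by (rule F_entire[OF newton_dual_K[OF True]])
  show ?thesis using True
    by (simp add: term_fun_def expansion_term_eq jet_sum jet_cmult[OF h] holomorphic_intros h)
qed (simp add: term_fun_def jet_zero)

lemma partial_sum_eq: "(\<lambda>z. \<Sum>k\<in>K \<inter> {..<n}. expansion_term \<alpha> m c k z) = (\<lambda>z. \<Sum>k<n. term_fun c k z)"
proof
  fix z
  have "(\<Sum>k<n. term_fun c k z) = (\<Sum>k\<in>{..<n}. if k \<in> K then expansion_term \<alpha> m c k z else 0)"
    by (intro sum.cong) (auto simp: term_fun_def)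
  also have "\<dots> = (\<Sum>k\<in>{..<n} \<inter> K. expansion_term \<alpha> m c k z)" by (rule sum.inter_restrict[symmetric]) simp
  finally show "(\<Sum>k\<in>K \<inter> {..<n}. expansion_term \<alpha> m c k z) = (\<Sum>k<n. term_fun c k z)"
    by (simp add: Int_commute)
qed

text \<open>By \<open>wnorm_newton_dual_le\<close> the coefficient condition with dilation 8 q
  controls \<open>wnorm q\<close> of the terms.\<close>

lemma summable_wnorm_term_fun:
  assumes c: "coeff_condition \<theta> K \<alpha> m c" and q: "0 < q"
  shows "summable (\<lambda>k. wnorm q (term_fun c k))"
proof -
  let ?v = "\<lambda>k. if k \<in> K then weighted_coeff (8 * q) c k else 0"
  have "summable ?v" using c q by (simp add: coeff_condition_iff)
  then have sm: "summable (\<lambda>k. 4 * exp (\<theta> (4 * q)) * ?v k)" by (rule summable_mult)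
  have wsum: "wnorm q (\<lambda>z. \<Sum>l\<in>A. g l z) \<le> (\<Sum>l\<in>A. wnorm q (g l))"
    if "finite A" "\<And>l. l \<in> A \<Longrightarrow> g l \<in> F_space \<theta>" for A :: "nat set" and g
    using that
  proof (induction A)
    case empty
    then show ?case by (simp add: wnorm_def jet_zero)
  next
    case (insert l A)
    have gF: "g l \<in> F_space \<theta>" "(\<lambda>z. \<Sum>l\<in>A. g l z) \<in> F_space \<theta>" "(\<lambda>z. - 1 * (\<Sum>l\<in>A. g l z)) \<in> F_space \<theta>"
      using insert F_sum[of A g] F_cmult by blast+
    have "wnorm q (\<lambda>z. \<Sum>l\<in>insert l A. g l z) = wnorm q (\<lambda>z. g l z - - 1 * (\<Sum>l\<in>A. g l z))"
      using insert by simp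
    also have "\<dots> \<le> wnorm q (g l) + wnorm q (\<lambda>z. - 1 * (\<Sum>l\<in>A. g l z))"
      by (rule wsummable_diff(2)) (use gF F_entire F_wsummable q in auto)
    also have "wnorm q (\<lambda>z. - 1 * (\<Sum>l\<in>A. g l z)) = cmod (- 1) * wnorm q (\<lambda>z. \<Sum>l\<in>A. g l z)"
      by (rule wsummable_cmult(2)[OF F_entire[OF gF(2)] F_wsummable[OF gF(2) q]])
    finally show ?case using insert by simp
  qed
  have "wnorm q (term_fun c k) \<le> 4 * exp (\<theta> (4 * q)) * ?v k" for k
  proof (cases "k \<in> K")
    case True
    have "wnorm q (term_fun c k) \<le> (\<Sum>l<m k. wnorm q (\<lambda>z. c k l * newton_dual \<alpha> m k l z))"
      unfolding term_fun_def expansion_term_eq using True wsum[of "{..<m k}" "\<lambda>l z. c k l * newton_dual \<alpha> m k l z"]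
      by (simp add: F_cmult newton_dual_K)
    also have "\<dots> \<le> (\<Sum>l<m k. cmod (c k l) * (4 * exp (\<theta> (4 * q)) * exp (\<theta> (8 * q * cmod (\<alpha> k)))
        / (cmod (\<alpha> k) + 1) ^ newton_degree m k l))"
    proof (rule sum_mono)
      fix l
      have "wnorm q (newton_dual \<alpha> m k l) \<le> 4 * exp (\<theta> (4 * q)) * exp (\<theta> (8 * q * cmod (\<alpha> k)))
          / (cmod (\<alpha> k) + 1) ^ newton_degree m k l"
        using True m_pos K_down \<alpha>_mono q by (intro wnorm_newton_dual_le inj_below) (auto intro: less_imp_le)
      then show "wnorm q (\<lambda>z. c k l * newton_dual \<alpha> m k l z) \<le> cmod (c k l) * (4 * exp (\<theta> (4 * q))
          * exp (\<theta> (8 * q * cmod (\<alpha> k))) / (cmod (\<alpha> k) + 1) ^ newton_degree m k l)"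
        unfolding wsummable_cmult(2)[OF F_entire F_wsummable, OF newton_dual_K newton_dual_K q, OF True True]
        by (intro mult_left_mono) auto
    qed
    also have "\<dots> = 4 * exp (\<theta> (4 * q)) * ?v k"
      using True by (simp add: weighted_coeff_def sum_distrib_left mult_ac)
    finally show ?thesis .
  next
    case False
    then show ?thesis by (simp add: term_fun_def wnorm_def jet_zero)
  qed
  then show ?thesis
    by (intro summable_comparison_test'[OF sm, of 0])
      (use wnorm_nonneg[OF _ F_wsummable[OF term_fun_in_F q]] q in auto)
qed

lemma expansion_converges:
  assumes c: "coeff_condition \<theta> K \<alpha> m c" and f: "f \<in> F_space \<theta>" "\<And>i. (\<lambda>k. jet (term_fun c k) i) sums jet f i"
  shows "expansion_converges_to \<theta> K \<alpha> m c f"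
  unfolding expansion_converges_to_def partial_sum_eq
  using series_wnorm_tendsto[OF term_fun_in_F summable_wnorm_term_fun[OF c] f]
  by (intro limitin_F_topI f F_sum term_fun_in_F) auto

lemma pair_newton_dual_zero:
  assumes k: "k \<in> K" and l: "l < m k"
  shows "pair (\<lambda>\<xi>. \<xi> ^ s * \<Phi> \<xi>) (newton_dual \<alpha> m k l) = 0"
proof -
  define R where "R = cmod (\<alpha> k) + 1"
  have R: "cmod (\<alpha> k) < R" "0 < R" by (auto simp: R_def add_nonneg_pos)
  have N: "{..<Suc k} \<subseteq> K" using K_down[OF k] by auto
  obtain G where G: "G holomorphic_on UNIV" "\<And>\<xi>. \<Phi> \<xi> = newton \<alpha> m (Suc k) 0 \<xi> * G \<xi>"
    by (rule factor[OF N]) (rule that)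
  have hol: "(\<lambda>\<xi>. \<xi> ^ s * \<Phi> \<xi>) holomorphic_on UNIV"
    by (intro holomorphic_intros gclass_entire[OF gclass_\<Phi>])
  have "pair (\<lambda>\<xi>. \<xi> ^ s * \<Phi> \<xi>) (newton_dual \<alpha> m k l) = circle_mean R (newton \<alpha> m k (Suc l)) (\<lambda>\<xi>. \<xi> ^ s * \<Phi> \<xi>)"
    using k m_pos K_down \<alpha>_mono by (intro pair_newton_dual[OF inj_below _ _ hol R(1)]) (auto intro: less_imp_le)
  also have "\<dots> = 0"
  proof -
    \<comment> \<open>The integrand as an entire function. The exponent \<open>m k - Suc l\<close>
      is where l < m k enters: the denominator divides the part of \<Phi> that belongs to the zeros
      up to index k.\<close>
    define H where "H = (\<lambda>w. w ^ s * ((w - \<alpha> k) ^ (m k - Suc l) * G w))"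
    have "(H has_contour_integral 0) (circlepath 0 R)"
      by (rule Cauchy_theorem_convex_simple[of _ UNIV])
        (use G in \<open>auto simp: H_def intro!: holomorphic_intros\<close>)
    then have "((\<lambda>w. w ^ s * \<Phi> w / newton \<alpha> m k (Suc l) w) has_contour_integral 0) (circlepath 0 R)"
    proof (rule has_contour_integral_eq)
      fix w assume "w \<in> path_image (circlepath 0 R)"
      then have w: "cmod w = R" using R by simp
      have "w \<noteq> \<alpha> n" if "n \<le> k" for n using \<alpha>_mono[OF k that] R(1) w by auto
      then have nz: "newton \<alpha> m k (Suc l) w \<noteq> 0" unfolding newton_eq_0_iff using less_imp_le by blast
      have "newton \<alpha> m (Suc k) 0 w = newton \<alpha> m k (Suc l + (m k - Suc l)) w"
        using l by (simp flip: newton_Suc_block)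
      also have "\<dots> = newton \<alpha> m k (Suc l) w * (w - \<alpha> k) ^ (m k - Suc l)" by (rule newton_add)
      finally show "H w = w ^ s * \<Phi> w / newton \<alpha> m k (Suc l) w"
        using nz by (simp add: H_def G(2)[of w])
    qed
    then show ?thesis by (simp add: circle_mean_def contour_integral_unique)
  qed
  finally show ?thesis .
qed

text \<open>Pairing with \<xi>^s \<Phi> is a continuous functional, so it may be applied to the
  series term by term.\<close>

lemma expansion_solves:
  assumes c: "coeff_condition \<theta> K \<alpha> m c" and f: "f \<in> F_space \<theta>" "\<And>i. (\<lambda>k. jet (term_fun c k) i) sums jet f i"
  shows "\<forall>z. conv T f z = 0"
  unfolding conv_eq_0_iff[OF T f(1)] \<Phi>[symmetric]
proof
  fix s
  let ?g = "\<lambda>\<xi>. \<xi> ^ s * \<Phi> \<xi>"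
  have g: "gclass ?g" by (intro gclass_mult gclass_power gclass_id gclass_\<Phi>)
  define S where "S = restrict (pair ?g) (F_space \<theta>)"
  have S: "S \<in> F_dual \<theta>" using g pair_in_dual(1) by (auto simp: gclass_def S_def)
  have "S (term_fun c k) = 0" for k
  proof (cases "k \<in> K")
    case True
    have "S (term_fun c k) = (\<Sum>l<m k. S (\<lambda>z. c k l * newton_dual \<alpha> m k l z))"
      unfolding term_fun_def expansion_term_eq using True
      by (simp add: dual_sum[OF S] F_cmult newton_dual_K)
    also have "\<dots> = (\<Sum>l<m k. c k l * S (newton_dual \<alpha> m k l))"
      by (intro sum.cong refl dual_cmult[OF S] newton_dual_K True)
    also have "\<dots> = 0"
      using newton_dual_K[OF True] pair_newton_dual_zero[OF True] by (intro sum.neutral) (auto simp: S_def)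
    finally show ?thesis .
  next
    case False
    then show ?thesis using dual_cmult[OF S F_zero, of 0] by (simp add: term_fun_def)
  qed
  then have "S f = 0"
    using dual_series[OF S term_fun_in_F summable_wnorm_term_fun[OF c] f] by (simp add: sums_iff)
  then show "shift_pair \<Phi> f s = 0" using f(1) pair_power_mult[OF gclass_\<Phi> f(1), of s] by (simp add: S_def)
qed

lemma converse_part:
  assumes "coeff_condition \<theta> K \<alpha> m c"
  shows "\<exists>f\<in>F_space \<theta>. expansion_converges_to \<theta> K \<alpha> m c f \<and> (\<forall>z. conv T f z = 0)"
  using series_in_F[OF term_fun_in_F summable_wnorm_term_fun[OF assms]]
    expansion_converges[OF assms] expansion_solves[OF assms] by metis

lemma newton_functional_ex1: "\<exists>!S. is_newton_functional \<theta> \<alpha> m k l S"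
  and newton_functional_eq: "f \<in> F_space \<theta> \<Longrightarrow> (THE S. is_newton_functional \<theta> \<alpha> m k l S) f = pair (newton \<alpha> m k l) f"
proof -
  let ?S = "restrict (pair (newton \<alpha> m k l)) (F_space \<theta>)"
  obtain B p where g: "coeff_growth B p (newton \<alpha> m k l)"
    using gclass_newton[of \<alpha> m k l] unfolding gclass_def by blast
  have ex: "is_newton_functional \<theta> \<alpha> m k l ?S"
    using pair_in_dual[OF g] by (simp add: is_newton_functional_def newton_def fun_eq_iff)
  have uniq: "S = ?S" if "is_newton_functional \<theta> \<alpha> m k l S" for S
    using that ex dual_eqI by (auto simp: is_newton_functional_def)
  show "\<exists>!S. is_newton_functional \<theta> \<alpha> m k l S" using ex uniq by blast
  have "(THE S. is_newton_functional \<theta> \<alpha> m k l S) = ?S" using ex uniq by (rule the_equality)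
  then show "f \<in> F_space \<theta> \<Longrightarrow> (THE S. is_newton_functional \<theta> \<alpha> m k l S) f = pair (newton \<alpha> m k l) f" by simp
qed

text \<open>Each multiplicity is at least 1, so k + 1 is itself bounded by the zero count at radius
  \<open>cmod (\<alpha> k)\<close>. For infinitely many zeros this is a quantitative form of their
  moduli tending to infinity.\<close>

lemma count_bounds:
  obtains c where "0 \<le> c" "\<And>k. k \<in> K \<Longrightarrow> dominated c (cmod (\<alpha> k)) (\<Sum>n<Suc k. m n)"
    "\<And>k. k \<in> K \<Longrightarrow> real (Suc k) \<le> c + \<theta> (c * cmod (\<alpha> k))"
proof -
  obtain c where c: "0 \<le> c"
    "\<And>N a. {..<N} \<subseteq> K \<Longrightarrow> 0 \<le> a \<Longrightarrow> (\<And>n. n < N \<Longrightarrow> cmod (\<alpha> n) \<le> a) \<Longrightarrow> dominated c a (\<Sum>n<N. m n)"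
    by (rule zero_count) (rule that, assumption, blast)
  have 1: "dominated c (cmod (\<alpha> k)) (\<Sum>n<Suc k. m n)" if k: "k \<in> K" for k
    using K_down[OF k] \<alpha>_mono[OF k] by (intro c(2)) auto
  have 2: "real (Suc k) \<le> c + \<theta> (c * cmod (\<alpha> k))" if k: "k \<in> K" for k
  proof -
    have "(\<Sum>n<Suc k. 1) \<le> (\<Sum>n<Suc k. m n)"
      using m_pos K_down[OF k] by (intro sum_mono) (simp add: Suc_le_eq)
    then have "real (Suc k) \<le> real (\<Sum>n<Suc k. m n)" by (simp only: of_nat_le_iff) simp
    then show ?thesis using 1[OF k] unfolding dominated_def by linarith
  qed
  from that[OF c(1) 1 2] show ?thesis .
qed

section \<open>The coefficients of a solution and the recovery of its derivatives at 0\<close>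

context
  fixes f assumes f: "f \<in> F_space \<theta>" and solves: "\<forall>z. conv T f z = 0"
begin

lemma annihilates: "shift_pair \<Phi> f s = 0"
  using solves conv_eq_0_iff[OF T f] by (simp add: \<Phi>)

text \<open>\<open>key_estimate\<close> at radius a = \<open>cmod (\<alpha> k)\<close>, with N the
  product over the zeros before index k, q the power of \<xi> - \<open>\<alpha> k\<close>, and A =
  1. Zeros on the circle |\<xi>| = a may remain in G, which has to be zero-free only in the open
  disc.\<close>

lemma newton_coeff_le:
  assumes r: "0 < r"
  obtains C where "0 < C" "\<And>k l. k \<in> K \<Longrightarrow> 6 \<le> cmod (\<alpha> k) \<Longrightarrow> l < m k \<Longrightarrow>
    cmod (pair (newton \<alpha> m k l) f)
      \<le> C * (cmod (\<alpha> k) + 1) ^ newton_degree m k l * exp (- \<theta> (r * cmod (\<alpha> k)))"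
proof -
  obtain z0 where z0: "cmod z0 \<le> 1" "\<Phi> z0 \<noteq> 0" using ex_\<Phi>_base by blast
  obtain c where c: "0 \<le> c" "\<And>k. k \<in> K \<Longrightarrow> dominated c (cmod (\<alpha> k)) (\<Sum>n<Suc k. m n)"
    by (rule count_bounds) (rule that)
  show ?thesis
  proof (rule key_estimate[OF f annihilates gclass_\<Phi> z0 r c(1)], goal_cases)
    case (1 C)
    note C = 1(1) and key = 1(2)
    have "cmod (pair (newton \<alpha> m k l) f)
      \<le> C * (cmod (\<alpha> k) + 1) ^ newton_degree m k l * exp (- \<theta> (r * cmod (\<alpha> k)))"
      if k: "k \<in> K" and a6: "6 \<le> cmod (\<alpha> k)" and l: "l < m k" for k l
    proof -
      define a where "a = cmod (\<alpha> k)"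
      have a: "6 \<le> a" using a6 by (simp add: a_def)
      define d where "d = newton_degree m k l"
      define n where "n = newton_degree m k 0"
      have d: "d = n + l" by (simp add: d_def n_def newton_degree_def)
      have le_a: "cmod (\<alpha> j) \<le> a" if "j \<le> k" for j using \<alpha>_mono[OF k that] by (simp add: a_def)
      have sub: "{..<k} \<subseteq> K" using K_down[OF k] by auto
      obtain G where G: "G holomorphic_on UNIV" "\<And>\<xi>. \<Phi> \<xi> = newton \<alpha> m k 0 \<xi> * G \<xi>"
        "\<And>\<xi>. G \<xi> = 0 \<Longrightarrow> \<exists>j\<in>K. k \<le> j \<and> \<xi> = \<alpha> j" by (rule factor[OF sub]) (rule that)
      have "cmod (pair (newton \<alpha> m k l) f) \<le> C * 1 * (a + 1) ^ d * exp (- \<theta> (r * a))"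
      proof (rule key[where N = "newton \<alpha> m k 0" and G = G and q = "\<lambda>\<xi>. (\<xi> - \<alpha> k) ^ l" and n = n])
        show "gclass (newton \<alpha> m k l)" by (rule gclass_newton)
        show "newton \<alpha> m k l \<xi> = newton \<alpha> m k 0 \<xi> * (\<xi> - \<alpha> k) ^ l" for \<xi>
          using newton_add[of \<alpha> m k 0 l \<xi>] by simp
        show "(cmod \<xi> - a) ^ n \<le> cmod (newton \<alpha> m k 0 \<xi>)" if "a \<le> cmod \<xi>" for \<xi>
          unfolding n_def by (rule newton_lower) (use le_a that in auto)
        show "cmod (newton \<alpha> m k 0 \<xi>) \<le> (cmod \<xi> + a) ^ n" for \<xi>
          unfolding n_def by (rule newton_upper) (use le_a in auto)
        show "G \<xi> \<noteq> 0" if "cmod \<xi> < a" for \<xi>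
          using G(3)[of \<xi>] that \<alpha>_mono by (fastforce simp: a_def)
        show "cmod (newton \<alpha> m k l \<xi>) \<le> 1 * (cmod \<xi> + a + 1) ^ d" for \<xi>
        proof -
          have "cmod (newton \<alpha> m k l \<xi>) \<le> (cmod \<xi> + a) ^ d"
            unfolding d_def by (rule newton_upper) (use le_a in auto)
          also have "\<dots> \<le> (cmod \<xi> + a + 1) ^ d" using a by (intro power_mono) auto
          finally show ?thesis by simp
        qed
        show "cmod ((\<xi> - \<alpha> k) ^ l) * (a + 1) ^ n \<le> 1 * 2 ^ d * (a + 1) ^ d" if "cmod \<xi> \<le> a / 4" for \<xi>
        proof -
          have "cmod (\<xi> - \<alpha> k) \<le> 2 * (a + 1)"
            using norm_triangle_ineq4[of \<xi> "\<alpha> k"] le_a[of k] that a by simp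
          then have "cmod ((\<xi> - \<alpha> k) ^ l) * (a + 1) ^ n \<le> (2 * (a + 1)) ^ l * (a + 1) ^ n"
            using a unfolding norm_power by (intro mult_right_mono power_mono) auto
          also have "\<dots> = 1 * (2 ^ l * (a + 1) ^ d)" by (simp only: d power_add power_mult_distrib mult_ac)
          also have "\<dots> \<le> 2 ^ n * (2 ^ l * (a + 1) ^ d)" using a by (intro mult_right_mono) auto
          finally show ?thesis by (simp add: d power_add mult_ac)
        qed
        have "d \<le> (\<Sum>n<Suc k. m n)" using l by (simp add: d_def newton_degree_def)
        then have "real d \<le> real (\<Sum>n<Suc k. m n)" by (simp only: of_nat_le_iff)
        then show "dominated c a d" using c(2)[OF k] unfolding dominated_def a_def by linarith
      qed (use a G in \<open>auto intro!: holomorphic_intros\<close>)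
      then show ?thesis by (simp add: a_def d_def)
    qed
    with C show ?thesis by (rule that)
  qed
qed

lemma coeff_condition_solution: "coeff_condition \<theta> K \<alpha> m (\<lambda>k l. pair (newton \<alpha> m k l) f)"
  unfolding coeff_condition_iff
proof (intro allI impI)
  fix r :: real assume r: "0 < r"
  let ?c = "\<lambda>k l. pair (newton \<alpha> m k l) f"
  obtain c where c: "0 \<le> c" "\<And>k. k \<in> K \<Longrightarrow> dominated c (cmod (\<alpha> k)) (\<Sum>n<Suc k. m n)"
    "\<And>k. k \<in> K \<Longrightarrow> real (Suc k) \<le> c + \<theta> (c * cmod (\<alpha> k))"
    by (rule count_bounds) (rule that)
  \<comment> \<open>The surplus 3 c yields three factors e^(-V) up to a constant: one for the number
    \<open>m k\<close> of summands, two for the majorant 1 / (k + 1)^2.\<close>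
  define r' where "r' = r + 3 * c"
  have r': "0 < r'" using r c(1) by (simp add: r'_def)
  obtain C where C: "0 < C" "\<And>k l. k \<in> K \<Longrightarrow> 6 \<le> cmod (\<alpha> k) \<Longrightarrow> l < m k \<Longrightarrow>
    cmod (?c k l) \<le> C * (cmod (\<alpha> k) + 1) ^ newton_degree m k l * exp (- \<theta> (r' * cmod (\<alpha> k)))"
    by (rule newton_coeff_le[OF r']) (rule that)
  have bound: "weighted_coeff r ?c k \<le> C * exp (3 * c) * (1 / (real (Suc k))\<^sup>2)"
    if k: "k \<in> K" and a6: "6 \<le> cmod (\<alpha> k)" for k
  proof -
    define a where "a = cmod (\<alpha> k)"
    have a: "0 \<le> a" by (simp add: a_def)
    define V where "V = c + \<theta> (c * a)"
    have mV: "real (m k) \<le> exp V"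
    proof -
      have "m k \<le> (\<Sum>n<Suc k. m n)" by simp
      then have "real (m k) \<le> real (\<Sum>n<Suc k. m n)" by (simp only: of_nat_le_iff)
      also have "\<dots> \<le> V" using c(2)[OF k] by (simp add: dominated_def V_def a_def)
      also have "\<dots> \<le> exp V" using exp_ge_add_one_self[of V] by linarith
      finally show ?thesis .
    qed
    have kV: "real (Suc k) \<le> exp V"
      using c(3)[OF k] exp_ge_add_one_self[of V] unfolding V_def a_def by linarith
    have "(\<Sum>l<m k. cmod (?c k l) / (a + 1) ^ newton_degree m k l) \<le> (\<Sum>l<m k. C * exp (- \<theta> (r' * a)))"
    proof (rule sum_mono)
      fix l assume "l \<in> {..<m k}"
      then have "cmod (?c k l) \<le> C * (a + 1) ^ newton_degree m k l * exp (- \<theta> (r' * a))"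
        using C(2)[OF k a6] by (simp add: a_def)
      moreover have "0 < (a + 1) ^ newton_degree m k l" using a by simp
      ultimately show "cmod (?c k l) / (a + 1) ^ newton_degree m k l \<le> C * exp (- \<theta> (r' * a))"
        by (simp add: pos_divide_le_eq mult_ac)
    qed
    also have "\<dots> = real (m k) * (C * exp (- \<theta> (r' * a)))" by simp
    also have "\<dots> \<le> exp V * (C * exp (- \<theta> (r' * a)))" using mV C(1) by (intro mult_right_mono) auto
    finally have "weighted_coeff r ?c k \<le> exp (\<theta> (r * a)) * (exp V * (C * exp (- \<theta> (r' * a))))"
      unfolding weighted_coeff_def a_def[symmetric] by (rule mult_left_mono) simp
    also have "\<dots> = C * exp (\<theta> (r * a) + V - \<theta> (r' * a))"
      by (simp add: exp_add exp_diff exp_minus field_simps)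
    also have "\<dots> \<le> C * exp (3 * c - 2 * V)"
    proof -
      have "\<theta> (r * a) + 3 * \<theta> (c * a) \<le> \<theta> (r * a) + \<theta> (3 * (c * a))"
        using theta_scale[of 3 "c * a"] c(1) a by simp
      also have "\<dots> \<le> \<theta> (r * a + 3 * (c * a))" using theta_superadd[of "r * a" "3 * (c * a)"] r c(1) a by simp
      also have "r * a + 3 * (c * a) = r' * a" by (simp add: r'_def algebra_simps)
      finally show ?thesis using C(1) by (simp add: V_def)
    qed
    also have "\<dots> = C * exp (3 * c) * (1 / (exp V)\<^sup>2)" by (simp add: exp_diff exp_double)
    also have "\<dots> \<le> C * exp (3 * c) * (1 / (real (Suc k))\<^sup>2)"
    proof (intro mult_left_mono divide_left_mono)
      show "(real (Suc k))\<^sup>2 \<le> (exp V)\<^sup>2" using kV by (intro power_mono) auto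
    qed (use C(1) in auto)
    finally show ?thesis .
  qed
  \<comment> \<open>From index k0 on the zero count forces modulus at least 6, as
    \<open>newton_coeff_le\<close> requires.\<close>
  obtain k0 :: nat where k0: "c + \<theta> (c * 6) \<le> real k0" using real_arch_simple by blast
  have large: "6 \<le> cmod (\<alpha> k)" if k: "k \<in> K" and "k0 \<le> k" for k
  proof (rule ccontr)
    assume "\<not> ?thesis"
    then have "\<theta> (c * cmod (\<alpha> k)) \<le> \<theta> (c * 6)" using c(1) by (intro theta_mono mult_left_mono) auto
    then show False using c(3)[OF k] k0 that(2) by linarith
  qed
  have "summable (\<lambda>k. inverse (real (Suc k)) ^ 2)"
    using inverse_power_summable[of 2, where 'a = real] by (subst summable_Suc_iff) (simp add: power_inverse)
  then have sm: "summable (\<lambda>k. C * exp (3 * c) * (1 / (real (Suc k))\<^sup>2))"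
    by (intro summable_mult) (simp add: power_divide inverse_eq_divide)
  show "summable (\<lambda>k. if k \<in> K then weighted_coeff r ?c k else 0)"
  proof (rule summable_comparison_test'[OF sm])
    fix k assume k: "k0 \<le> k"
    show "norm (if k \<in> K then weighted_coeff r ?c k else 0) \<le> C * exp (3 * c) * (1 / (real (Suc k))\<^sup>2)"
      using bound[of k] large[of k] k C(1) by (auto simp: weighted_coeff_nonneg)
  qed
qed

text \<open>The remainder S of \<xi>^i satisfies the bounds of \<open>key_estimate\<close> with A =
  2^(i+1) and exponent d = i, whatever the number of nodes; this makes the estimate uniform in
  N.\<close>

lemma newton_remainder_le:
  obtains C where "0 < C"
    "\<And>N a. \<lbrakk>{..<N} \<subseteq> K; 6 \<le> a; \<And>k. k < N \<Longrightarrow> cmod (\<alpha> k) \<le> a; \<And>k. k \<in> K \<Longrightarrow> N \<le> k \<Longrightarrow> a \<le> cmod (\<alpha> k)\<rbrakk>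
      \<Longrightarrow> cmod (jet f i - (\<Sum>k<N. jet (term_fun (\<lambda>k l. pair (newton \<alpha> m k l) f) k) i)) \<le> C * exp (- a)"
proof -
  obtain z0 where z0: "cmod z0 \<le> 1" "\<Phi> z0 \<noteq> 0" using ex_\<Phi>_base by blast
  show ?thesis
  \<comment> \<open>The decay r = 2 is chosen because \<theta>(2 a) \<ge> 2 \<theta>(a): one
    \<theta>(a) pays for (a + 1)^i, the other leaves e^(-a). The first two goals are the sign
    conditions on r and c0, the third is the estimate.\<close>
  proof (rule key_estimate[OF f annihilates gclass_\<Phi> z0, of 2 i], goal_cases)
    case (3 C)
    note C = 3(1) and key = 3(2)
    define C' where "C' = C * 2 ^ (i + 1) * fact i * exp (1 + 2 * offset)"
    have C': "0 < C'" using C by (simp add: C'_def)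
    have "cmod (jet f i - (\<Sum>k<N. jet (term_fun (\<lambda>k l. pair (newton \<alpha> m k l) f) k) i)) \<le> C' * exp (- a)"
      if sub: "{..<N} \<subseteq> K" and a: "6 \<le> a" and le_a: "\<And>k. k < N \<Longrightarrow> cmod (\<alpha> k) \<le> a"
        and ge_a: "\<And>k. k \<in> K \<Longrightarrow> N \<le> k \<Longrightarrow> a \<le> cmod (\<alpha> k)" for N a
    proof -
      obtain G where G: "G holomorphic_on UNIV" "\<And>\<xi>. \<Phi> \<xi> = newton \<alpha> m N 0 \<xi> * G \<xi>"
        "\<And>\<xi>. G \<xi> = 0 \<Longrightarrow> \<exists>j\<in>K. N \<le> j \<and> \<xi> = \<alpha> j" by (rule factor[OF sub]) (rule that)
      define n where "n = newton_degree m N 0"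
      define S where "S = (\<lambda>\<xi>. \<xi> ^ i - (\<Sum>k<N. \<Sum>l<m k. jet (newton_dual \<alpha> m k l) i * newton \<alpha> m k l \<xi>))"
      \<comment> \<open>By \<open>S_eq\<close> every R above a and |\<xi>| represents the same S. R
        is tied to \<xi> for the global bound of S, and fixed at 2 (a + 1) where q has to be
        holomorphic in \<xi>.\<close>
      define q where "q = (\<lambda>R \<xi>. circle_mean R (\<lambda>w. newton \<alpha> m N 0 w * (w - \<xi>)) (\<lambda>w. w ^ i))"
      have nc: "continuous_on A (newton \<alpha> m k l)" for A k l
        by (rule holomorphic_on_imp_continuous_on[OF entire_newton])
      have gn: "gclass (\<lambda>\<xi>. c * newton \<alpha> m k l \<xi>)" for c k l
        by (intro gclass_mult gclass_const gclass_newton)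
      have gsum: "gclass (\<lambda>\<xi>. \<Sum>l<m k. jet (newton_dual \<alpha> m k l) i * newton \<alpha> m k l \<xi>)" for k
        by (rule gclass_sum) (auto intro: gn)
      have gsum2: "gclass (\<lambda>\<xi>. \<Sum>k<N. \<Sum>l<m k. jet (newton_dual \<alpha> m k l) i * newton \<alpha> m k l \<xi>)"
        by (rule gclass_sum) (auto intro: gsum)
      have gS: "gclass S"
        unfolding S_def by (intro gclass_diff gclass_power gclass_id gsum2)
      have pS: "pair S f = jet f i - (\<Sum>k<N. jet (term_fun (\<lambda>k l. pair (newton \<alpha> m k l) f) k) i)"
      proof -
        have "jet f i = pair (\<lambda>\<xi>. S \<xi> + (\<Sum>k<N. \<Sum>l<m k. jet (newton_dual \<alpha> m k l) i * newton \<alpha> m k l \<xi>)) f"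
          using pair_power[OF f, of i] by (simp add: S_def)
        also have "\<dots> = pair S f + (\<Sum>k<N. \<Sum>l<m k. jet (newton_dual \<alpha> m k l) i * pair (newton \<alpha> m k l) f)"
          by (simp add: pair_add[OF gS gsum2 f] pair_sum[OF _ gsum f] pair_sum[OF _ gn f]
              pair_cmult[OF gclass_newton f])
        also have "(\<Sum>k<N. \<Sum>l<m k. jet (newton_dual \<alpha> m k l) i * pair (newton \<alpha> m k l) f)
            = (\<Sum>k<N. jet (term_fun (\<lambda>k l. pair (newton \<alpha> m k l) f) k) i)"
          using sub by (intro sum.cong refl) (auto simp: jet_term_fun mult.commute)
        finally show ?thesis by simp
      qed
      have S_eq: "S \<xi> = newton \<alpha> m N 0 \<xi> * q R \<xi>" if R: "cmod \<xi> < R" "a < R" for \<xi> R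
      proof -
        have Rlt: "cmod (\<alpha> k) < R" if "k < N" for k using le_a[OF that] R(2) by linarith
        have "\<xi> ^ i = (\<Sum>k<N. \<Sum>l<m k. newton \<alpha> m k l \<xi> * circle_mean R (newton \<alpha> m k (Suc l)) (\<lambda>w. w ^ i))
            + newton \<alpha> m N 0 \<xi> * q R \<xi>"
          unfolding q_def by (rule newton_interpolation[OF Rlt R(1)]) (auto intro!: holomorphic_intros)
        also have "(\<Sum>k<N. \<Sum>l<m k. newton \<alpha> m k l \<xi> * circle_mean R (newton \<alpha> m k (Suc l)) (\<lambda>w. w ^ i))
            = (\<Sum>k<N. \<Sum>l<m k. jet (newton_dual \<alpha> m k l) i * newton \<alpha> m k l \<xi>)"
        proof (intro sum.cong refl)
          fix k l assume "k \<in> {..<N}"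
          then have k: "k \<in> K" "k < N" using sub by auto
          have "jet (newton_dual \<alpha> m k l) i = circle_mean R (newton \<alpha> m k (Suc l)) (\<lambda>w. w ^ i)"
            using k K_down m_pos le_a R by (intro jet_newton_dual[OF inj_below, where a = a]) (auto intro: less_imp_le)
          then show "newton \<alpha> m k l \<xi> * circle_mean R (newton \<alpha> m k (Suc l)) (\<lambda>w. w ^ i)
              = jet (newton_dual \<alpha> m k l) i * newton \<alpha> m k l \<xi>" by simp
        qed
        finally show ?thesis by (simp add: S_def)
      qed
      have q_le: "cmod (q R \<xi>) \<le> R ^ i * R / b ^ Suc n" if b: "0 < b" "a + b \<le> R" "cmod \<xi> + b \<le> R" for \<xi> R b
        unfolding q_def
      proof (rule circle_mean_le)
        fix w :: complex assume w: "cmod w = R"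
        have "b ^ n \<le> (cmod w - a) ^ n" using w b by (intro power_mono) auto
        also have "\<dots> \<le> cmod (newton \<alpha> m N 0 w)"
          unfolding n_def by (rule newton_lower) (use le_a w b in auto)
        finally have "b ^ n * b \<le> cmod (newton \<alpha> m N 0 w) * cmod (w - \<xi>)"
          using norm_triangle_ineq2[of w \<xi>] w b by (intro mult_mono) auto
        then show "b ^ Suc n \<le> cmod (newton \<alpha> m N 0 w * (w - \<xi>))" by (simp add: norm_mult mult.commute)
      qed (use a b nc in \<open>auto simp: norm_power intro!: continuous_intros\<close>)
      have "cmod (pair S f) \<le> C * 2 ^ (i + 1) * (a + 1) ^ i * exp (- \<theta> (2 * a))"
      proof (rule key[where N = "newton \<alpha> m N 0" and G = G and q = "q (2 * (a + 1))" and n = n])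
        show "q (2 * (a + 1)) holomorphic_on ball 0 a"
        proof (rule holomorphic_on_subset)
          show "q (2 * (a + 1)) holomorphic_on ball 0 (2 * (a + 1))"
            unfolding q_def
          proof (rule circle_mean_cauchy_holomorphic)
            fix w :: complex assume "cmod w = 2 * (a + 1)"
            then show "newton \<alpha> m N 0 w \<noteq> 0" using le_a a by (fastforce simp: newton_eq_0_iff)
          qed (use nc a in \<open>auto intro!: continuous_intros\<close>)
        qed (use a in auto)
        show "S \<xi> = newton \<alpha> m N 0 \<xi> * q (2 * (a + 1)) \<xi>" if "cmod \<xi> < a" for \<xi>
          by (rule S_eq) (use that a in auto)
        show "(cmod \<xi> - a) ^ n \<le> cmod (newton \<alpha> m N 0 \<xi>)" if "a \<le> cmod \<xi>" for \<xi>
          unfolding n_def by (rule newton_lower) (use le_a that in auto)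
        show N_up: "cmod (newton \<alpha> m N 0 \<xi>) \<le> (cmod \<xi> + a) ^ n" for \<xi>
          unfolding n_def by (rule newton_upper) (use le_a in auto)
        show "G \<xi> \<noteq> 0" if "cmod \<xi> < a" for \<xi>
          using G(3)[of \<xi>] that ge_a by fastforce
        show "cmod (S \<xi>) \<le> 2 ^ (i + 1) * (cmod \<xi> + a + 1) ^ i" for \<xi>
        proof -
          \<comment> \<open>With R = 2 b both R - a and R - |\<xi>| are at least b, and b also
            exceeds |\<xi>| + a, so the powers b^n cancel.\<close>
          define b where "b = cmod \<xi> + a + 1"
          have b: "0 < b" using a by (simp add: b_def add_nonneg_pos)
          have "x < 2 * (x + y + 1) \<and> y < 2 * (x + y + 1)" if "0 \<le> x" "6 \<le> y" for x y :: real
            using that by auto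
          from this[OF norm_ge_zero[of \<xi>] a] have lt: "cmod \<xi> < 2 * b" "a < 2 * b"
            unfolding b_def by blast+
          have "cmod (S \<xi>) = cmod (newton \<alpha> m N 0 \<xi>) * cmod (q (2 * b) \<xi>)"
            by (simp add: S_eq[OF lt] norm_mult)
          also have "\<dots> \<le> b ^ n * ((2 * b) ^ i * (2 * b) / b ^ Suc n)"
          proof (intro mult_mono)
            show "cmod (newton \<alpha> m N 0 \<xi>) \<le> b ^ n"
              by (rule order_trans[OF N_up power_mono]) (use a in \<open>auto simp: b_def\<close>)
            show "cmod (q (2 * b) \<xi>) \<le> (2 * b) ^ i * (2 * b) / b ^ Suc n"
              by (rule q_le[OF b]) (use a in \<open>auto simp: b_def\<close>)
          qed (use b in auto)
          also have "\<dots> = 2 ^ (i + 1) * b ^ i" using b by (simp add: power_mult_distrib)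
          finally show ?thesis by (simp add: b_def)
        qed
        show "cmod (q (2 * (a + 1)) \<xi>) * (a + 1) ^ n \<le> 2 ^ (i + 1) * 2 ^ i * (a + 1) ^ i"
          if "cmod \<xi> \<le> a / 4" for \<xi>
        proof -
          define b where "b = a + 1"
          have b: "0 < b" using a by (simp add: b_def)
          have "cmod (q (2 * b) \<xi>) \<le> (2 * b) ^ i * (2 * b) / b ^ Suc n"
            by (rule q_le[OF b]) (use a that in \<open>auto simp: b_def\<close>)
          then have "cmod (q (2 * b) \<xi>) * b ^ n \<le> (2 * b) ^ i * (2 * b) / b ^ Suc n * b ^ n"
            using b by (intro mult_right_mono) auto
          also have "\<dots> = 1 * (2 ^ (i + 1) * b ^ i)" using b by (simp add: power_mult_distrib)
          also have "\<dots> \<le> 2 ^ i * (2 ^ (i + 1) * b ^ i)" using b by (intro mult_right_mono) auto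
          finally show ?thesis by (simp add: b_def mult_ac)
        qed
        show "dominated (real i) a (real i)" using dominated_const[of i a] a by simp
      qed (use a G gS in auto)
      also have "\<dots> \<le> C * 2 ^ (i + 1) * (fact i * exp (1 + offset + \<theta> a)) * exp (offset - a - \<theta> a)"
      proof (intro mult_mono mult_left_mono)
        have "(a + 1) ^ i \<le> fact i * exp (a + 1)" using a by (intro power_le_fact_exp) auto
        also have "\<dots> \<le> fact i * exp (1 + offset + \<theta> a)"
          using theta_lower[of a] a by (intro mult_left_mono) auto
        finally show "(a + 1) ^ i \<le> fact i * exp (1 + offset + \<theta> a)" .
        show "exp (- \<theta> (2 * a)) \<le> exp (offset - a - \<theta> a)"
          using theta_scale[of 2 a] theta_lower[of a] a by simp
      qed (use C a in auto)
      also have "\<dots> = C' * exp (- a)"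
      proof -
        have "exp (1 + offset + \<theta> a) * exp (offset - a - \<theta> a) = exp (1 + 2 * offset) * exp (- a)"
          by (simp flip: exp_add)
        then show ?thesis by (simp only: C'_def mult.assoc)
      qed
      finally show ?thesis by (simp add: pS)
    qed
    with C' show ?thesis by (rule that)
  qed simp_all
qed

text \<open>For infinitely many zeros the radius a = \<open>cmod (\<alpha> n)\<close> tends to
  infinity and the remainder to 0. For finitely many, a is unbounded as soon as all of them are
  used.\<close>

lemma expansion_jet_sums:
  "(\<lambda>k. jet (term_fun (\<lambda>k l. pair (newton \<alpha> m k l) f) k) i) sums jet f i"
proof -
  let ?t = "\<lambda>k. jet (term_fun (\<lambda>k l. pair (newton \<alpha> m k l) f) k) i"
  obtain C where C: "0 < C"
    "\<And>N a. \<lbrakk>{..<N} \<subseteq> K; 6 \<le> a; \<And>k. k < N \<Longrightarrow> cmod (\<alpha> k) \<le> a; \<And>k. k \<in> K \<Longrightarrow> N \<le> k \<Longrightarrow> a \<le> cmod (\<alpha> k)\<rbrakk>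
      \<Longrightarrow> cmod (jet f i - (\<Sum>k<N. ?t k)) \<le> C * exp (- a)"
    by (rule newton_remainder_le[of i]) (rule that, assumption, blast)
  have ev: "\<exists>n0. \<forall>n\<ge>n0. cmod (jet f i - (\<Sum>k<n. ?t k)) \<le> C * exp (- A)" for A :: real
  proof (cases "K = UNIV")
    case True
    obtain c where c: "0 \<le> c" "\<And>k. k \<in> K \<Longrightarrow> real (Suc k) \<le> c + \<theta> (c * cmod (\<alpha> k))"
      by (rule count_bounds) (rule that)
    obtain n0 :: nat where n0: "c + \<theta> (c * max A 6) \<le> real n0" using real_arch_simple by blast
    have "cmod (jet f i - (\<Sum>k<n. ?t k)) \<le> C * exp (- A)" if n: "n0 \<le> n" for n
    proof -
      have ge: "max A 6 \<le> cmod (\<alpha> n)"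
      proof (rule ccontr)
        assume "\<not> ?thesis"
        then have "\<theta> (c * cmod (\<alpha> n)) \<le> \<theta> (c * max A 6)" using c(1) by (intro theta_mono mult_left_mono) auto
        then show False using c(2)[of n] n0 n True by simp
      qed
      have "cmod (jet f i - (\<Sum>k<n. ?t k)) \<le> C * exp (- cmod (\<alpha> n))"
        by (rule C(2)) (use True ge \<alpha>_mono in \<open>auto intro: less_imp_le\<close>)
      also have "\<dots> \<le> C * exp (- A)" using ge C(1) by (intro mult_left_mono) auto
      finally show ?thesis .
    qed
    then show ?thesis by blast
  next
    case False
    then obtain N where N: "K = {..<N}" using K_cases by blast
    have z: "?t k = 0" if "N \<le> k" for k using that by (subst jet_term_fun) (auto simp: N)
    have "cmod (jet f i - (\<Sum>k<n. ?t k)) \<le> C * exp (- A)" if n: "N \<le> n" for n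
    proof -
      \<comment> \<open>Any radius beyond A, 6 and all moduli of zeros is admissible, since no zero
        is left outside; the sum of the moduli serves as a bound for each of them.\<close>
      define a where "a = max (max A 6) (\<Sum>k<N. cmod (\<alpha> k))"
      have "(\<Sum>k<n. ?t k) = (\<Sum>k<N. ?t k)"
        using n z by (intro sum.mono_neutral_right) auto
      also have "cmod (jet f i - (\<Sum>k<N. ?t k)) \<le> C * exp (- a)"
      proof (rule C(2))
        show "cmod (\<alpha> k) \<le> a" if "k < N" for k
          using member_le_sum[of k "{..<N}" "\<lambda>k. cmod (\<alpha> k)"] that by (simp add: a_def)
      qed (auto simp: N a_def)
      also have "\<dots> \<le> C * exp (- A)" using C(1) by (intro mult_left_mono) (auto simp: a_def)
      finally show ?thesis .
    qed
    then show ?thesis by blast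
  qed
  show ?thesis unfolding sums_def
  proof (rule LIMSEQ_I)
    fix e :: real assume e: "0 < e"
    obtain n0 where n0: "\<And>n. n0 \<le> n \<Longrightarrow> cmod (jet f i - (\<Sum>k<n. ?t k)) \<le> C * exp (- ln (2 * C / e))"
      using ev by blast
    have lt: "C * exp (- ln (2 * C / e)) < e" using C(1) e by (simp add: exp_minus)
    show "\<exists>n0. \<forall>n\<ge>n0. norm ((\<Sum>k<n. ?t k) - jet f i) < e"
    proof (intro exI allI impI)
      fix n assume "n0 \<le> n"
      from le_less_trans[OF n0[OF this] lt] show "norm ((\<Sum>k<n. ?t k) - jet f i) < e"
        by (subst norm_minus_commute)
    qed
  qed
qed

end

lemma direct_part:
  assumes f: "f \<in> F_space \<theta>" "\<forall>z. conv T f z = 0"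
  shows "\<exists>c. expansion_converges_to \<theta> K \<alpha> m c f \<and> coeff_condition \<theta> K \<alpha> m c \<and>
    (\<forall>k\<in>K. \<forall>l<m k. c k l = (THE S. is_newton_functional \<theta> \<alpha> m k l S) f)"
proof (intro exI conjI)
  show "coeff_condition \<theta> K \<alpha> m (\<lambda>k l. pair (newton \<alpha> m k l) f)" by (rule coeff_condition_solution[OF f])
  then show "expansion_converges_to \<theta> K \<alpha> m (\<lambda>k l. pair (newton \<alpha> m k l) f) f"
    by (rule expansion_converges[OF _ f(1) expansion_jet_sums[OF f]])
qed (simp add: newton_functional_eq[OF f(1)])

end

theorem theorem3p5:
  fixes \<theta> :: "real \<Rightarrow> real"
    and T :: "(complex \<Rightarrow> complex) \<Rightarrow> complex"
    and \<Phi> :: "complex \<Rightarrow> complex"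
    and K :: "nat set"
    and \<alpha> :: "nat \<Rightarrow> complex"
    and m :: "nat \<Rightarrow> nat"
  assumes "identity_weight \<theta> \<or> young_function \<theta>"
    and "T \<in> F_dual \<theta>" and "\<exists>f\<in>F_space \<theta>. T f \<noteq> 0"
    and "\<Phi> = fourier_borel T"
    and "\<exists>\<xi>. \<Phi> \<xi> = 0"
    and "zero_enumeration \<Phi> K \<alpha> m"
  shows "(\<forall>k\<in>K. \<forall>l<m k. \<exists>!S. is_newton_functional \<theta> \<alpha> m k l S) \<and>
    (\<forall>f\<in>F_space \<theta>. (\<forall>z. conv T f z = 0) \<longrightarrow>
       (\<exists>c :: nat \<Rightarrow> nat \<Rightarrow> complex.
          expansion_converges_to \<theta> K \<alpha> m c f \<and>
          coeff_condition \<theta> K \<alpha> m c \<and>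
          (\<forall>k\<in>K. \<forall>l<m k. c k l = (THE S. is_newton_functional \<theta> \<alpha> m k l S) f))) \<and>
    (\<forall>c :: nat \<Rightarrow> nat \<Rightarrow> complex. coeff_condition \<theta> K \<alpha> m c \<longrightarrow>
       (\<exists>f\<in>F_space \<theta>. expansion_converges_to \<theta> K \<alpha> m c f \<and> (\<forall>z. conv T f z = 0)))"
proof -
  interpret conv_equation \<theta> T \<Phi> K \<alpha> m
    by unfold_locales (fact assms)+
  show ?thesis
    using newton_functional_ex1 direct_part converse_part by blast
qed

end
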